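(* Let $l\geq 2$, let $p$ be a prime number and let $\mathbb{F}_l$ be the free group of rank $l$. Then the singular locus $\chi^i_{Sing}(\mathbb{F}_l,PSL(p,\mathbb{C}))$ of $\chi^i(\mathbb{F}_l,PSL(p,\mathbb{C}))$ is connected of (complex) dimension $(p-1)(l-1)$.
   Context: A subgroup of $PSL(p,\mathbb{C})$ is irreducible if it is not contained in any (proper) parabolic subgroup; an irreducible subgroup is bad if its centralizer in $PSL(p,\mathbb{C})$ is non-trivial. A representation is irreducible (resp. bad) if its image is. $\mathrm{Hom}(\mathbb{F}_l,PSL(p,\mathbb{C}))=PSL(p,\mathbb{C})^l$ has its usual (transcendental) topology; $\chi^i(\mathbb{F}_l,PSL(p,\mathbb{C}))$ is the quotient, with quotient topology, of the open subset of irreducible representations by conjugation by $PSL(p,\mathbb{C})$. The singular locus $\chi^i_{Sing}(\mathbb{F}_l,PSL(p,\mathbb{C}))$ is the subset of conjugacy classes of bad representations, with the subspace topology. *)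

theory Defs
  imports "HOL-Analysis.Analysis" "HOL-Algebra.Coset" "HOL-Algebra.Generated_Groups"
    "HOL-Computational_Algebra.Primes"
begin

section \<open>The group PSL(p,C)\<close>

text \<open>The size \<open>p\<close> of the matrices is \<open>CARD('p)\<close>.\<close>

definition SL_group :: "(complex^'p^'p) monoid" where
  "SL_group = \<lparr>carrier = {A. det A = 1}, monoid.mult = (**), one = mat 1\<rparr>"

definition centralizer :: "('a, 'b) monoid_scheme \<Rightarrow> 'a set \<Rightarrow> 'a set" where
  "centralizer G H = {g \<in> carrier G. \<forall>h\<in>H. g \<otimes>\<^bsub>G\<^esub> h = h \<otimes>\<^bsub>G\<^esub> g}"

definition SL_center :: "(complex^'p^'p) set" where
  "SL_center = centralizer SL_group (carrier SL_group)"

definition PSL_group :: "(complex^'p^'p) set monoid" where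
  "PSL_group = SL_group Mod SL_center"

definition to_PSL :: "complex^'p^'p \<Rightarrow> (complex^'p^'p) set" where
  "to_PSL A = SL_center #>\<^bsub>SL_group\<^esub> A"

lemma group_SL_group: "group (SL_group :: (complex^'p^'p) monoid)"
proof (rule groupI)
  fix A :: "complex^'p^'p"
  assume A: "A \<in> carrier SL_group"
  then have "invertible A"
    by (simp add: SL_group_def invertible_det_nz)
  then obtain B where "A ** B = mat 1" "B ** A = mat 1"
    by (auto simp: invertible_def)
  moreover from this(1) A have "det B = 1"
    using det_mul[of A B] by (simp add: SL_group_def)
  ultimately show "\<exists>B\<in>carrier SL_group. B \<otimes>\<^bsub>SL_group\<^esub> A = \<one>\<^bsub>SL_group\<^esub>"
    by (auto simp: SL_group_def)
qed (simp_all add: SL_group_def det_mul matrix_mul_assoc)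

lemma SL_center_normal: "(SL_center :: (complex^'p^'p) set) \<lhd> SL_group"
proof -
  interpret group "SL_group :: (complex^'p^'p) monoid" by (rule group_SL_group)
  have mem: "z \<in> carrier SL_group" if "z \<in> SL_center" for z :: "complex^'p^'p"
    using that by (simp add: SL_center_def centralizer_def)
  have comm: "x \<otimes>\<^bsub>SL_group\<^esub> z = z \<otimes>\<^bsub>SL_group\<^esub> x"
    if "z \<in> SL_center" "x \<in> carrier SL_group" for x z :: "complex^'p^'p"
    using that by (simp add: SL_center_def centralizer_def)
  have sub: "subgroup (SL_center :: (complex^'p^'p) set) SL_group"
  proof
    fix x y :: "complex^'p^'p"
    assume xy: "x \<in> SL_center" "y \<in> SL_center"
    have c: "x \<in> carrier SL_group" "y \<in> carrier SL_group"
      and x: "\<And>h. h \<in> carrier SL_group \<Longrightarrow> h \<otimes>\<^bsub>SL_group\<^esub> x = x \<otimes>\<^bsub>SL_group\<^esub> h"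
      and y: "\<And>h. h \<in> carrier SL_group \<Longrightarrow> h \<otimes>\<^bsub>SL_group\<^esub> y = y \<otimes>\<^bsub>SL_group\<^esub> h"
      using mem[OF xy(1)] mem[OF xy(2)] comm[OF xy(1)] comm[OF xy(2)] by blast+
    have "x \<otimes>\<^bsub>SL_group\<^esub> y \<otimes>\<^bsub>SL_group\<^esub> h = h \<otimes>\<^bsub>SL_group\<^esub> (x \<otimes>\<^bsub>SL_group\<^esub> y)"
      if h: "h \<in> carrier SL_group" for h
    proof -
      have "h \<otimes>\<^bsub>SL_group\<^esub> (x \<otimes>\<^bsub>SL_group\<^esub> y) = x \<otimes>\<^bsub>SL_group\<^esub> h \<otimes>\<^bsub>SL_group\<^esub> y"
        using c h by (simp only: m_assoc[symmetric] x)
      also have "\<dots> = x \<otimes>\<^bsub>SL_group\<^esub> y \<otimes>\<^bsub>SL_group\<^esub> h"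
        using c h by (simp only: m_assoc y m_closed)
      finally show ?thesis by simp
    qed
    then show "x \<otimes>\<^bsub>SL_group\<^esub> y \<in> SL_center"
      using c by (simp add: SL_center_def centralizer_def)
  next
    fix x :: "complex^'p^'p"
    assume x: "x \<in> SL_center"
    then have xc: "x \<in> carrier SL_group"
      by (rule mem)
    have "inv\<^bsub>SL_group\<^esub> x \<otimes>\<^bsub>SL_group\<^esub> y = y \<otimes>\<^bsub>SL_group\<^esub> inv\<^bsub>SL_group\<^esub> x"
      if y: "y \<in> carrier SL_group" for y
    proof -
      have "y = inv\<^bsub>SL_group\<^esub> x \<otimes>\<^bsub>SL_group\<^esub> (y \<otimes>\<^bsub>SL_group\<^esub> x)"
        using xc y comm[OF x y] by (simp add: m_assoc[symmetric])
      then have "y \<otimes>\<^bsub>SL_group\<^esub> inv\<^bsub>SL_group\<^esub> x =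
          inv\<^bsub>SL_group\<^esub> x \<otimes>\<^bsub>SL_group\<^esub> (y \<otimes>\<^bsub>SL_group\<^esub> x) \<otimes>\<^bsub>SL_group\<^esub> inv\<^bsub>SL_group\<^esub> x"
        by (rule arg_cong)
      also have "\<dots> = inv\<^bsub>SL_group\<^esub> x \<otimes>\<^bsub>SL_group\<^esub> y"
        using xc y by (simp add: m_assoc)
      finally show ?thesis by simp
    qed
    then show "inv\<^bsub>SL_group\<^esub> x \<in> SL_center"
      using xc by (simp add: SL_center_def centralizer_def)
  qed (auto simp: SL_center_def centralizer_def)
  show ?thesis
    unfolding normal_inv_iff
  proof (intro conjI sub ballI)
    fix x h :: "complex^'p^'p"
    assume x: "x \<in> carrier SL_group" and h: "h \<in> SL_center"
    from mem[OF h] comm[OF h x] x have "x \<otimes>\<^bsub>SL_group\<^esub> h \<otimes>\<^bsub>SL_group\<^esub> inv\<^bsub>SL_group\<^esub> x = h"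
      by (simp add: m_assoc)
    with h show "x \<otimes>\<^bsub>SL_group\<^esub> h \<otimes>\<^bsub>SL_group\<^esub> inv\<^bsub>SL_group\<^esub> x \<in> SL_center"
      by simp
  qed
qed

lemma group_PSL_group: "group (PSL_group :: (complex^'p^'p) set monoid)"
  unfolding PSL_group_def by (rule normal.factorgroup_is_group[OF SL_center_normal])

lemma carrier_PSL_group: "carrier PSL_group = to_PSL ` carrier SL_group"
  by (auto simp: PSL_group_def FactGroup_def RCOSETS_def to_PSL_def)

text \<open>
  A parabolic subgroup of PSL(p,C) is the stabilizer of a flag, i.e. of a chain of linear subspaces
  of \<open>C^p\<close>. The chain may be partial; chains containing no proper non-zero subspace give the whole
  group.
\<close>

definition flag_stabilizer :: "(complex^'p) set set \<Rightarrow> (complex^'p^'p) set set" where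
  "flag_stabilizer F = to_PSL ` {A \<in> carrier SL_group. \<forall>W\<in>F. (*v) A ` W = W}"

definition parabolic :: "(complex^'p^'p) set set \<Rightarrow> bool" where
  "parabolic P \<longleftrightarrow>
    (\<exists>F. (\<forall>W\<in>F. vec.subspace W) \<and> (\<forall>V\<in>F. \<forall>W\<in>F. V \<subseteq> W \<or> W \<subseteq> V) \<and> P = flag_stabilizer F)"

definition irreducible_subgroup :: "(complex^'p^'p) set set \<Rightarrow> bool" where
  "irreducible_subgroup H \<longleftrightarrow> subgroup H PSL_group \<and>
    (\<forall>P. parabolic P \<and> P \<noteq> carrier PSL_group \<longrightarrow> \<not> H \<subseteq> P)"

definition bad_subgroup :: "(complex^'p^'p) set set \<Rightarrow> bool" where
  "bad_subgroup H \<longleftrightarrow> irreducible_subgroup H \<and> centralizer PSL_group H \<noteq> {\<one>\<^bsub>PSL_group\<^esub>}"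


section \<open>The character variety of a free group and its singular locus\<close>

definition quotient_topology :: "'a topology \<Rightarrow> ('a \<Rightarrow> 'b) \<Rightarrow> 'b topology" where
  "quotient_topology X q =
    topology (\<lambda>U. U \<subseteq> q ` topspace X \<and> openin X {x \<in> topspace X. q x \<in> U})"

lemma openin_quotient_topology:
  "openin (quotient_topology X q) U \<longleftrightarrow>
    U \<subseteq> q ` topspace X \<and> openin X {x \<in> topspace X. q x \<in> U}"
proof -
  have "istopology (\<lambda>U. U \<subseteq> q ` topspace X \<and> openin X {x \<in> topspace X. q x \<in> U})"
    unfolding istopology_def
  proof (intro conjI allI impI)
    fix S T
    assume "S \<subseteq> q ` topspace X \<and> openin X {x \<in> topspace X. q x \<in> S}"
      and "T \<subseteq> q ` topspace X \<and> openin X {x \<in> topspace X. q x \<in> T}"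
    moreover have "{x \<in> topspace X. q x \<in> S \<inter> T} =
        {x \<in> topspace X. q x \<in> S} \<inter> {x \<in> topspace X. q x \<in> T}" by auto
    ultimately show "openin X {x \<in> topspace X. q x \<in> S \<inter> T}"
      and "S \<inter> T \<subseteq> q ` topspace X"
      by auto
  next
    fix K
    assume K: "\<forall>S\<in>K. S \<subseteq> q ` topspace X \<and> openin X {x \<in> topspace X. q x \<in> S}"
    then show "\<Union>K \<subseteq> q ` topspace X" by auto
    have "{x \<in> topspace X. q x \<in> \<Union>K} = (\<Union>S\<in>K. {x \<in> topspace X. q x \<in> S})" by auto
    with K show "openin X {x \<in> topspace X. q x \<in> \<Union>K}" by auto
  qed
  then show ?thesis
    by (simp add: quotient_topology_def topology_inverse')
qed

lemma topspace_quotient_topology: "topspace (quotient_topology X q) = q ` topspace X"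
proof
  show "topspace (quotient_topology X q) \<subseteq> q ` topspace X"
    using openin_topspace[of "quotient_topology X q"] unfolding openin_quotient_topology by simp
  have "{x \<in> topspace X. q x \<in> q ` topspace X} = topspace X" by auto
  then have "openin (quotient_topology X q) (q ` topspace X)"
    by (simp add: openin_quotient_topology)
  then show "q ` topspace X \<subseteq> topspace (quotient_topology X q)"
    by (rule openin_subset)
qed

lemma quotient_map_quotient_topology: "quotient_map X (quotient_topology X q) q"
  unfolding quotient_map_def topspace_quotient_topology openin_quotient_topology by auto

definition PSL_topology :: "(complex^'p^'p) set topology" where
  "PSL_topology = quotient_topology (top_of_set (carrier SL_group)) to_PSL"

text \<open>
  A homomorphism from the free group of rank \<open>l = CARD('l)\<close> to a group is the tuple of the images
  of the free generators; its image is the subgroup they generate.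
\<close>

definition Hom_topology :: "('l \<Rightarrow> (complex^'p^'p) set) topology" where
  "Hom_topology = product_topology (\<lambda>_. PSL_topology) UNIV"

definition rep_image :: "('l \<Rightarrow> (complex^'p^'p) set) \<Rightarrow> (complex^'p^'p) set set" where
  "rep_image \<rho> = generate PSL_group (range \<rho>)"

definition irreducible_reps :: "('l \<Rightarrow> (complex^'p^'p) set) set" where
  "irreducible_reps = {\<rho>. range \<rho> \<subseteq> carrier PSL_group \<and> irreducible_subgroup (rep_image \<rho>)}"

definition bad_reps :: "('l \<Rightarrow> (complex^'p^'p) set) set" where
  "bad_reps = {\<rho>. range \<rho> \<subseteq> carrier PSL_group \<and> bad_subgroup (rep_image \<rho>)}"

definition conj_class :: "('l \<Rightarrow> (complex^'p^'p) set) \<Rightarrow> ('l \<Rightarrow> (complex^'p^'p) set) set" where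
  "conj_class \<rho> =
    {(\<lambda>k. g \<otimes>\<^bsub>PSL_group\<^esub> \<rho> k \<otimes>\<^bsub>PSL_group\<^esub> inv\<^bsub>PSL_group\<^esub> g) |g. g \<in> carrier PSL_group}"

definition char_variety :: "('l \<Rightarrow> (complex^'p^'p) set) set topology" where
  "char_variety = quotient_topology (subtopology Hom_topology irreducible_reps) conj_class"

definition sing_locus :: "('l \<Rightarrow> (complex^'p^'p) set) set topology" where
  "sing_locus = subtopology char_variety (conj_class ` bad_reps)"


section \<open>Complex dimension\<close>

text \<open>
  A complex structure on a space \<open>X\<close> is given by its structure sheaf: a predicate \<open>\<O>\<close> such that
  \<open>\<O> U f\<close> states that \<open>U\<close> is open and that \<open>f\<close> is holomorphic on \<open>U\<close>.
\<close>

type_synonym 'a sheaf = "'a set \<Rightarrow> ('a \<Rightarrow> complex) \<Rightarrow> bool"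

text \<open>The space \<open>C^I\<close>, encoded (like \<^const>\<open>Euclidean_space\<close>) by functions vanishing off \<open>I\<close>.\<close>

definition complex_space :: "'i set \<Rightarrow> ('i \<Rightarrow> complex) topology" where
  "complex_space I = subtopology (product_topology (\<lambda>_. euclidean) UNIV) {z. \<forall>i. i \<notin> I \<longrightarrow> z i = 0}"

text \<open>
  For finite \<open>I\<close>, a function of several complex variables is holomorphic iff it is continuous and
  holomorphic in each variable separately (Osgood).
\<close>

definition holo :: "'i set \<Rightarrow> ('i \<Rightarrow> complex) sheaf" where
  "holo I U f \<longleftrightarrow> openin (complex_space I) U \<and>
    continuous_map (subtopology (complex_space I) U) euclidean f \<and>
    (\<forall>z\<in>U. \<forall>i\<in>I. (\<lambda>w. f (z(i := w))) field_differentiable at (z i))"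

text \<open>
  On a subset \<open>S\<close> of \<open>X\<close>, the holomorphic functions are those which locally extend to holomorphic
  functions on \<open>X\<close>; on a quotient of \<open>X\<close>, those whose pullback to \<open>X\<close> is holomorphic.
\<close>

definition sub_sheaf :: "'a topology \<Rightarrow> 'a sheaf \<Rightarrow> 'a set \<Rightarrow> 'a sheaf" where
  "sub_sheaf X \<O> S V f \<longleftrightarrow> openin (subtopology X S) V \<and>
    (\<forall>y\<in>V. \<exists>W g. y \<in> W \<and> openin X W \<and> \<O> W g \<and> (\<forall>x\<in>W \<inter> V. f x = g x))"

definition quotient_sheaf :: "'a topology \<Rightarrow> 'a sheaf \<Rightarrow> ('a \<Rightarrow> 'b) \<Rightarrow> 'b sheaf" where
  "quotient_sheaf X \<O> q V g \<longleftrightarrow> V \<subseteq> q ` topspace X \<and> \<O> {x \<in> topspace X. q x \<in> V} (g \<circ> q)"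

text \<open>
  A chart of dimension \<open>d\<close>: an isomorphism (of spaces with structure sheaf) from an open subset \<open>V\<close>
  of \<open>X\<close> onto an open subset \<open>U\<close> of \<open>C^d\<close>.
\<close>

definition complex_chart ::
  "'a topology \<Rightarrow> 'a sheaf \<Rightarrow> nat \<Rightarrow> 'a set \<Rightarrow> (nat \<Rightarrow> complex) set \<Rightarrow> ('a \<Rightarrow> nat \<Rightarrow> complex) \<Rightarrow> bool"
where
  "complex_chart X \<O> d V U \<phi> \<longleftrightarrow>
    openin X V \<and> openin (complex_space {..<d}) U \<and>
    homeomorphic_map (subtopology X V) (subtopology (complex_space {..<d}) U) \<phi> \<and>
    (\<forall>U' f. openin (complex_space {..<d}) U' \<and> U' \<subseteq> U \<longrightarrow>
      (holo {..<d} U' f \<longleftrightarrow> \<O> {x \<in> V. \<phi> x \<in> U'} (f \<circ> \<phi>)))"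

text \<open>
  As usual for reduced complex spaces, the dimension is the largest dimension of the space at its
  regular points, i.e. at the points having a neighbourhood which is a complex manifold.
\<close>

definition has_complex_dim :: "'a topology \<Rightarrow> 'a sheaf \<Rightarrow> nat \<Rightarrow> bool" where
  "has_complex_dim X \<O> n \<longleftrightarrow>
    (\<exists>V U \<phi>. V \<noteq> {} \<and> complex_chart X \<O> n V U \<phi>) \<and>
    (\<forall>d V U \<phi>. V \<noteq> {} \<and> complex_chart X \<O> d V U \<phi> \<longrightarrow> d \<le> n)"

text \<open>
  The complex structures on tuples of matrices (through their entries), on tuples in SL(p,C) (a
  submanifold), on the representations into PSL(p,C), on the character variety, whose holomorphic
  functions are the conjugation-invariant holomorphic functions of irreducible representations, and
  on its singular locus.
\<close>

definition matrix_tuple :: "('l \<times> 'p \<times> 'p \<Rightarrow> complex) \<Rightarrow> 'l \<Rightarrow> complex^'p^'p" where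
  "matrix_tuple z k = (\<chi> i j. z (k, i, j))"

definition matrix_sheaf :: "('l::finite \<Rightarrow> complex^'p^'p) sheaf" where
  "matrix_sheaf = quotient_sheaf (complex_space UNIV) (holo UNIV) matrix_tuple"

definition SL_tuples :: "('l::finite \<Rightarrow> complex^'p^'p) set" where
  "SL_tuples = {A. \<forall>k. A k \<in> carrier SL_group}"

definition Hom_sheaf :: "('l::finite \<Rightarrow> (complex^'p^'p) set) sheaf" where
  "Hom_sheaf = quotient_sheaf (top_of_set SL_tuples) (sub_sheaf euclidean matrix_sheaf SL_tuples)
    (\<lambda>A k. to_PSL (A k))"

definition char_variety_sheaf :: "('l::finite \<Rightarrow> (complex^'p^'p) set) set sheaf" where
  "char_variety_sheaf = quotient_sheaf (subtopology Hom_topology irreducible_reps)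
    (sub_sheaf Hom_topology Hom_sheaf irreducible_reps) conj_class"

definition sing_locus_sheaf :: "('l::finite \<Rightarrow> (complex^'p^'p) set) set sheaf" where
  "sing_locus_sheaf = sub_sheaf char_variety char_variety_sheaf (conj_class ` bad_reps)"

end

theory Submission
  imports Defs "HOL-Complex_Analysis.Cauchy_Integral_Formula" "HOL-Number_Theory.Cong"
    "HOL-Computational_Algebra.Fundamental_Theorem_Algebra"
begin

text \<open>
  Let \<open>\<rho>\<close> be a bad representation, lifted to matrices \<open>A k\<close> of determinant 1. A non-trivial element of its
  centralizer lifts to a matrix \<open>M\<close> with \<open>M A\<^sub>k = \<omega>\<^sub>k A\<^sub>k M\<close> for \<open>p\<close>-th roots of unity \<open>\<omega>\<^sub>k\<close>, and by Schur's lemma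
  some \<open>\<omega>\<close> at an index \<open>k0\<close> is not 1. As \<open>p\<close> is prime, this \<open>\<omega>\<close> is primitive: \<open>A k0\<close> permutes the eigenspaces of
  \<open>M\<close> cyclically, so \<open>M\<close> has \<open>p\<close> distinct eigenvalues, and in a suitable eigenbasis every \<open>A k\<close> is a diagonal
  matrix times a power \<open>Q^(e k)\<close> of one fixed cyclic matrix \<open>Q\<close>, with \<open>A k0 = Q\<close> (\<open>normal_form\<close>,
  \<open>bad_normal_form\<close>). Conversely such a monomial tuple is bad as soon as one of its diagonal parts is not
  scalar (\<open>param_bad_iff\<close>). Hence the singular locus is a finite union of pieces, indexed by \<open>k0\<close> and the
  exponents \<open>e\<close>, and each piece is the image of \<open>l - 1\<close> copies of the diagonal torus of PSL, without the
  points where all the diagonals are scalar.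

  The pieces are connected: written with exponentials, the excluded parameters meet a complex line through an
  admissible parameter in a countable set, whose complement in the line is connected. Two pieces meet in classes of representations onto the group generated by \<open>Q\<close> and a diagonal
  matrix of order \<open>p\<close>: these commute in PSL, both centralize the representation, and the normal
  form for one or for the other puts the class into two different pieces (\<open>piece_meets_hub\<close>).

  For the upper bound on the dimension, the coordinates of a chart, pulled back to the parameters,
  are holomorphic. A continuous and separately holomorphic function is differentiable (\<open>holo_derivative\<close>),
  and a differentiable image of a null set is a null set. So the finitely many pieces cannot cover an open
  set of a space of larger dimension (\<open>chart_dim_le\<close>).

  A chart of dimension \<open>(p - 1) * (l - 1)\<close> is found as follows. Where all generators except \<open>k0\<close> have non-zero trace, only the
  exponents \<open>e k0 = 1\<close> and \<open>e k = 0\<close> are possible, and a bad class is given by the diagonal matrices of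
  trace 1 at the indices \<open>k \<noteq> k0\<close>, up to a simultaneous cyclic shift of their entries. The Fourier transform
  over the integers modulo \<open>p\<close> turns the shift into multiplication by roots of unity, so suitable monomials
  in the Fourier coefficients separate the classes; a \<open>p\<close>-th root of one of these monomials recovers the
  diagonals (\<open>coords_chart_section\<close>, \<open>class_chart_section_coords\<close>). The Fourier coefficients are read off from
  sums \<open>\<Sum>\<zeta>^(ja) B^a X B^(p - a)\<close>, polynomial in the matrices, so these monomials extend to
  conjugation-invariant holomorphic functions on an open set of representations (\<open>inv_coord\<close>).
\<close>

section \<open>Holomorphic functions of several variables\<close>

definition polydisc :: "'i set \<Rightarrow> ('i \<Rightarrow> complex) \<Rightarrow> real \<Rightarrow> ('i \<Rightarrow> complex) set" where
  "polydisc I z r = {w. (\<forall>i. i \<notin> I \<longrightarrow> w i = 0) \<and> (\<forall>i\<in>I. norm (w i - z i) < r)}"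

lemma polydisc_mono: "r \<le> s \<Longrightarrow> polydisc I z r \<subseteq> polydisc I z s"
  by (force simp: polydisc_def)

lemma topspace_complex_space: "topspace (complex_space I) = {z. \<forall>i. i \<notin> I \<longrightarrow> z i = 0}"
  by (simp add: complex_space_def)

text \<open>
  For finite \<open>I\<close> the polydiscs are a basis of neighbourhoods; this replaces the product topology by explicit
  radii in all later estimates.
\<close>

lemma openin_complex_space_iff:
  assumes "finite I"
  shows "openin (complex_space I) U \<longleftrightarrow>
    U \<subseteq> topspace (complex_space I) \<and> (\<forall>z\<in>U. \<exists>r>0. polydisc I z r \<subseteq> U)"
proof
  assume U: "openin (complex_space I) U"
  then obtain T where T: "openin (product_topology (\<lambda>_. euclidean) UNIV) T"
    and UT: "U = T \<inter> {z. \<forall>i. i \<notin> I \<longrightarrow> z i = 0}"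
    by (auto simp: complex_space_def openin_subtopology)
  have "\<exists>r>0. polydisc I z r \<subseteq> U" if z: "z \<in> U" for z
  proof -
    from z UT have zT: "z \<in> T" and z0: "\<And>i. i \<notin> I \<Longrightarrow> z i = 0" by auto
    have "\<exists>V. finite {i \<in> UNIV. V i \<noteq> topspace euclidean} \<and> (\<forall>i\<in>UNIV. openin euclidean (V i)) \<and>
        z \<in> Pi\<^sub>E UNIV V \<and> Pi\<^sub>E UNIV V \<subseteq> T"
      using T[unfolded openin_product_topology_alt] zT by (rule bspec)
    then obtain V where V: "\<And>i. open (V i)" "z \<in> Pi\<^sub>E UNIV V" "Pi\<^sub>E UNIV V \<subseteq> T"
      by auto
    have "\<exists>r>0. ball (z i) r \<subseteq> V i" for i
      using V(1)[of i] V(2) by (auto simp: open_contains_ball PiE_def)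
    then obtain r where r: "\<And>i. r i > 0" "\<And>i. ball (z i) (r i) \<subseteq> V i" by metis
    define \<rho> where "\<rho> = Min (insert 1 (r ` I))"
    have \<rho>: "\<rho> > 0" "\<And>i. i \<in> I \<Longrightarrow> \<rho> \<le> r i"
      using assms r(1) by (auto simp: \<rho>_def)
    have "polydisc I z \<rho> \<subseteq> U"
    proof
      fix w assume w: "w \<in> polydisc I z \<rho>"
      have "w i \<in> V i" for i
      proof (cases "i \<in> I")
        case True
        then have "norm (w i - z i) < r i" using w \<rho>(2)[of i] by (force simp: polydisc_def)
        then show ?thesis using r(2)[of i] by (auto simp: subset_iff dist_norm norm_minus_commute)
      next
        case False
        then have "w i = z i" using w z0 by (simp add: polydisc_def)
        then show ?thesis using V(2) by auto
      qed
      then have "w \<in> T" using V(3) by auto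
      then show "w \<in> U" using w by (auto simp: UT polydisc_def)
    qed
    with \<rho>(1) show ?thesis by blast
  qed
  then show "U \<subseteq> topspace (complex_space I) \<and> (\<forall>z\<in>U. \<exists>r>0. polydisc I z r \<subseteq> U)"
    using openin_subset[OF U] by blast
next
  assume R: "U \<subseteq> topspace (complex_space I) \<and> (\<forall>z\<in>U. \<exists>r>0. polydisc I z r \<subseteq> U)"
  show "openin (complex_space I) U"
  proof (subst openin_subopen, intro ballI)
    fix z assume z: "z \<in> U"
    with R obtain r where r: "r > 0" "polydisc I z r \<subseteq> U" by blast
    define V where "V i = (if i \<in> I then ball (z i) r else UNIV)" for i
    have "finite {i. V i \<noteq> UNIV}"
      by (rule finite_subset[OF _ assms]) (auto simp: V_def)
    then have "openin (product_topology (\<lambda>_. euclidean) UNIV) (Pi\<^sub>E UNIV V)"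
      by (subst openin_PiE_gen) (auto simp: V_def)
    then have "openin (complex_space I) (Pi\<^sub>E UNIV V \<inter> {z. \<forall>i. i \<notin> I \<longrightarrow> z i = 0})"
      unfolding complex_space_def openin_subtopology by blast
    moreover have "Pi\<^sub>E UNIV V \<inter> {z. \<forall>i. i \<notin> I \<longrightarrow> z i = 0} = polydisc I z r"
      by (auto simp: V_def polydisc_def PiE_def Pi_def dist_norm norm_minus_commute)
    moreover have "z \<in> polydisc I z r"
      using R z r(1) by (auto simp: polydisc_def topspace_complex_space)
    ultimately show "\<exists>T. openin (complex_space I) T \<and> z \<in> T \<and> T \<subseteq> U"
      using r(2) by metis
  qed
qed

text \<open>
  Cauchy's inequality on discs of radius \<open>r/2\<close> bounds the derivative by \<open>2M/r\<close>.
\<close>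

lemma one_var_lipschitz:
  fixes g :: "complex \<Rightarrow> complex"
  assumes r: "r > 0" and g: "\<And>t. t \<in> ball z (2*r) \<Longrightarrow> g field_differentiable at t"
    and M: "\<And>t. t \<in> ball z (2*r) \<Longrightarrow> norm (g t) \<le> M"
    and t: "t \<in> ball z r" and t': "t' \<in> ball z r"
  shows "norm (g t - g t') \<le> 2 * M / r * norm (t - t')"
proof (rule field_differentiable_bound[where S = "ball z r" and f' = "deriv g"])
  fix s assume s: "s \<in> ball z r"
  have sub: "cball s (r/2) \<subseteq> ball z (2*r)"
  proof
    fix x assume "x \<in> cball s (r/2)"
    with s have "dist z s < r" "dist s x \<le> r/2" by auto
    then show "x \<in> ball z (2*r)" using dist_triangle[of z x s] r by simp
  qed
  have "s \<in> ball z (2*r)" using sub r by (meson centre_in_cball half_gt_zero less_imp_le subsetD)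
  then show "(g has_field_derivative deriv g s) (at s within ball z r)"
    using g field_differentiable_derivI has_field_derivative_at_within by blast
  have "g holomorphic_on ball s (r/2)"
    unfolding holomorphic_on_def
    by (metis sub ball_subset_cball subsetD g field_differentiable_at_within)
  moreover have "continuous_on (cball s (r/2)) g"
    by (meson sub subsetD continuous_at_imp_continuous_on field_differentiable_imp_continuous_at g)
  moreover have "norm (g x) \<le> M" if "norm (s - x) = r/2" for x
    using sub that by (intro M) (auto simp: subset_iff dist_norm)
  ultimately have "norm ((deriv ^^ 1) g s) \<le> fact 1 * M / (r/2) ^ 1"
    using r by (intro Cauchy_inequality) auto
  then show "norm (deriv g s) \<le> 2 * M / r" by (simp add: field_simps)
qed (use t t' in auto)

context
  fixes I :: "'i set" and U :: "('i \<Rightarrow> complex) set" and f :: "('i \<Rightarrow> complex) \<Rightarrow> complex"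
  assumes fin: "finite I" and holo: "holo I U f"
begin

lemma holo_locally_bounded:
  assumes "z \<in> U"
  obtains r M where "r > 0" "polydisc I z r \<subseteq> U" "\<And>w. w \<in> polydisc I z r \<Longrightarrow> norm (f w) \<le> M"
proof -
  have U: "openin (complex_space I) U"
    and c: "continuous_map (subtopology (complex_space I) U) euclidean f"
    using holo by (auto simp: holo_def)
  have "openin (subtopology (complex_space I) U)
     {x \<in> topspace (subtopology (complex_space I) U). f x \<in> ball (f z) 1}"
    by (rule openin_continuous_map_preimage[OF c]) simp
  then have "openin (complex_space I) {x \<in> U. f x \<in> ball (f z) 1}"
    using U openin_open_subtopology openin_subset[OF U] by (simp add: Int_absorb1 openin_open_subtopology)
  with assms obtain r where r: "r > 0" "polydisc I z r \<subseteq> {x \<in> U. f x \<in> ball (f z) 1}"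
    unfolding openin_complex_space_iff[OF fin] by force
  have "norm (f w) \<le> norm (f z) + 1" if "w \<in> polydisc I z r" for w
  proof -
    have "dist (f z) (f w) < 1" using r(2) that by auto
    then show ?thesis using norm_triangle_ineq[of "f z" "f w - f z"]
      by (simp add: dist_norm norm_minus_commute)
  qed
  with r show ?thesis using that by blast
qed

text \<open>
  The one-variable estimate, applied while the coordinates are exchanged one after the other.
\<close>

lemma holo_lipschitz:
  assumes r: "r > 0" and sub: "polydisc I z (2*r) \<subseteq> U"
    and M: "\<And>w. w \<in> polydisc I z (2*r) \<Longrightarrow> norm (f w) \<le> M"
    and w: "w \<in> polydisc I z r" and w': "w' \<in> polydisc I z r"
  shows "norm (f w - f w') \<le> 2 * M / r * (\<Sum>i\<in>I. norm (w i - w' i))"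
proof -
  have "norm (f w - f w') \<le> 2 * M / r * (\<Sum>i\<in>K. norm (w i - w' i))"
    if "finite K" "K \<subseteq> I" "w \<in> polydisc I z r" "\<And>i. i \<notin> K \<Longrightarrow> w i = w' i" for K w
    using that
  proof (induction K arbitrary: w rule: finite_induct)
    case empty
    then have "w = w'" by auto
    then show ?case by simp
  next
    case (insert j K)
    define v where "v = w(j := w' j)"
    have v: "v \<in> polydisc I z r"
      using insert.prems w' by (auto simp: v_def polydisc_def)
    have "norm (f v - f w') \<le> 2 * M / r * (\<Sum>i\<in>K. norm (v i - w' i))"
      by (rule insert.IH[OF _ v]) (use insert.prems in \<open>auto simp: v_def\<close>)
    also have "(\<Sum>i\<in>K. norm (v i - w' i)) = (\<Sum>i\<in>K. norm (w i - w' i))"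
      by (rule sum.cong) (use insert in \<open>auto simp: v_def\<close>)
    finally have 1: "norm (f v - f w') \<le> 2 * M / r * (\<Sum>i\<in>K. norm (w i - w' i))" .
    have jI: "j \<in> I" using insert by auto
    have in2: "w(j := t) \<in> polydisc I z (2*r)" if "t \<in> ball (z j) (2*r)" for t
    proof -
      have "norm (w i - z i) < 2 * r" if "i \<in> I" for i
        using insert.prems(2) that r by (force simp: polydisc_def)
      then show ?thesis using insert.prems(2) that jI
        by (auto simp: polydisc_def dist_norm norm_minus_commute)
    qed
    have "norm (f (w(j := w j)) - f (w(j := w' j))) \<le> 2 * M / r * norm (w j - w' j)"
    proof (rule one_var_lipschitz[OF r, where z = "z j"])
      fix t assume t: "t \<in> ball (z j) (2*r)"
      show "norm (f (w(j := t))) \<le> M" by (rule M[OF in2[OF t]])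
      have "w(j := t) \<in> U" using in2[OF t] sub by auto
      then have "(\<lambda>s. f ((w(j := t))(j := s))) field_differentiable at ((w(j := t)) j)"
        using holo jI unfolding holo_def by blast
      then show "(\<lambda>s. f (w(j := s))) field_differentiable at t" by simp
    qed (use insert.prems w' jI in \<open>auto simp: polydisc_def dist_norm norm_minus_commute\<close>)
    then have 2: "norm (f w - f v) \<le> 2 * M / r * norm (w j - w' j)" by (simp add: v_def)
    have "norm (f w - f w') \<le> norm (f w - f v) + norm (f v - f w')"
      using norm_triangle_ineq[of "f w - f v" "f v - f w'"] by simp
    also have "\<dots> \<le> 2 * M / r * norm (w j - w' j) + 2 * M / r * (\<Sum>i\<in>K. norm (w i - w' i))"
      using 1 2 by linarith
    finally show ?case using insert by (simp add: algebra_simps)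
  qed
  from this[OF fin order_refl w] show ?thesis using w w' by (auto simp: polydisc_def)
qed

text \<open>
  The differentiability half of Osgood's lemma. One coordinate \<open>j\<close> is changed at a time. The increment in
  direction \<open>j\<close> at a point near \<open>z\<close> differs from that at \<open>z\<close> by the increment of a holomorphic function \<open>G\<close> of one
  variable. By the Lipschitz estimate \<open>G\<close> is uniformly small on a whole disc, hence by Cauchy's inequality it
  is also Lipschitz with a small constant.
\<close>

lemma holo_derivative:
  assumes zU: "z \<in> U"
  obtains c where "\<And>\<epsilon>. \<epsilon> > 0 \<Longrightarrow> \<exists>\<delta>>0. \<forall>w\<in>polydisc I z \<delta>.
    norm (f w - f z - (\<Sum>i\<in>I. c i * (w i - z i))) \<le> \<epsilon> * (\<Sum>i\<in>I. norm (w i - z i))"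
proof -
  obtain R M where R: "R > 0" "polydisc I z R \<subseteq> U"
    and M: "\<And>w. w \<in> polydisc I z R \<Longrightarrow> norm (f w) \<le> M"
    using holo_locally_bounded[OF zU] by metis
  define r where "r = R / 2"
  have r: "r > 0" using R by (simp add: r_def)
  have z0: "\<And>i. i \<notin> I \<Longrightarrow> z i = 0"
    using zU holo openin_subset unfolding holo_def by (fastforce simp: topspace_complex_space)
  have zP: "z \<in> polydisc I z R" using R z0 by (auto simp: polydisc_def)
  define L where "L = 2 * M / r"
  have M0: "M \<ge> 0" using M[OF zP] norm_ge_zero order_trans by blast
  have L0: "L \<ge> 0" using M0 r by (simp add: L_def)
  have lip: "norm (f w - f w') \<le> L * (\<Sum>i\<in>I. norm (w i - w' i))"
    if "w \<in> polydisc I z r" "w' \<in> polydisc I z r" for w w'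
    unfolding L_def by (rule holo_lipschitz) (use that r R M in \<open>auto simp: r_def\<close>)
  define c where "c i = deriv (\<lambda>t. f (z(i := t))) (z i)" for i
  have "\<exists>\<delta>>0. \<forall>w\<in>polydisc I z \<delta>. (\<forall>i. i \<notin> K \<longrightarrow> w i = z i) \<longrightarrow>
      norm (f w - f z - (\<Sum>i\<in>K. c i * (w i - z i))) \<le> \<epsilon> * (\<Sum>i\<in>K. norm (w i - z i))"
    if "finite K" "K \<subseteq> I" "\<epsilon> > 0" for \<epsilon> K
    using that
  proof (induction K rule: finite_induct)
    case empty
    have "\<forall>w. (\<forall>i. w i = z i) \<longrightarrow> w = z" by auto
    then show ?case by (intro exI[of _ 1]) auto
  next
    case (insert j K)
    then obtain \<delta>1 where d1: "\<delta>1 > 0" and IH: "\<And>w. w\<in>polydisc I z \<delta>1 \<Longrightarrow> (\<forall>i. i \<notin> K \<longrightarrow> w i = z i) \<Longrightarrow>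
      norm (f w - f z - (\<Sum>i\<in>K. c i * (w i - z i))) \<le> \<epsilon> * (\<Sum>i\<in>K. norm (w i - z i))"
      by auto
    have jI: "j \<in> I" using insert by auto
    have "(\<lambda>t. f (z(j := t))) field_differentiable at (z j)"
      using holo jI zU unfolding holo_def by blast
    then have "((\<lambda>t. f (z(j := t))) has_derivative (*) (c j)) (at (z j))"
      using field_differentiable_derivI has_field_derivative_def c_def by metis
    then obtain \<delta>2 where d2: "\<delta>2 > 0" and D: "\<And>t. norm (t - z j) < \<delta>2 \<Longrightarrow>
        norm (f (z(j := t)) - f z - c j * (t - z j)) \<le> \<epsilon>/2 * norm (t - z j)"
      unfolding has_derivative_at_alt using insert.prems(2)
      by (metis fun_upd_triv half_gt_zero)
    define N where "N = real (card I)"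
    define \<delta>3 where "\<delta>3 = \<epsilon> * r / (8 * (L * N + 1))"
    have LN: "L * N \<ge> 0" using L0 by (simp add: N_def)
    have d3: "\<delta>3 > 0" using insert.prems r LN by (simp add: \<delta>3_def)
    define \<delta> where "\<delta> = min (min \<delta>1 \<delta>2) (min \<delta>3 (r/2))"
    have d: "\<delta> > 0" using d1 d2 d3 r by (simp add: \<delta>_def)
    \<comment> \<open>One half of \<open>\<epsilon>\<close> is spent on the derivative at \<open>z\<close>, the other half on the function \<open>G\<close>.\<close>
    have "norm (f w - f z - (\<Sum>i\<in>insert j K. c i * (w i - z i))) \<le> \<epsilon> * (\<Sum>i\<in>insert j K. norm (w i - z i))"
      if w: "w \<in> polydisc I z \<delta>" and wK: "\<And>i. i \<notin> insert j K \<Longrightarrow> w i = z i" for w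
    proof -
      define v where "v = w(j := z j)"
      have "v \<in> polydisc I z \<delta>1"
        using w d1 z0 by (auto simp: polydisc_def v_def \<delta>_def)
      then have "norm (f v - f z - (\<Sum>i\<in>K. c i * (v i - z i))) \<le> \<epsilon> * (\<Sum>i\<in>K. norm (v i - z i))"
        by (rule IH) (use wK in \<open>auto simp: v_def\<close>)
      also have "(\<Sum>i\<in>K. norm (v i - z i)) = (\<Sum>i\<in>K. norm (w i - z i))"
        by (rule sum.cong) (use insert in \<open>auto simp: v_def\<close>)
      also have "(\<Sum>i\<in>K. c i * (v i - z i)) = (\<Sum>i\<in>K. c i * (w i - z i))"
        by (rule sum.cong) (use insert in \<open>auto simp: v_def\<close>)
      finally have 1: "norm (f v - f z - (\<Sum>i\<in>K. c i * (w i - z i))) \<le> \<epsilon> * (\<Sum>i\<in>K. norm (w i - z i))" .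
      have wj: "norm (w j - z j) < \<delta>" using w jI by (auto simp: polydisc_def)
      have 2: "norm (f (z(j := w j)) - f z - c j * (w j - z j)) \<le> \<epsilon>/2 * norm (w j - z j)"
        by (rule D) (use wj in \<open>auto simp: \<delta>_def\<close>)
      define G where "G t = f (w(j := t)) - f (z(j := t))" for t
      have inr: "w(j := t) \<in> polydisc I z r" "z(j := t) \<in> polydisc I z r" if "t \<in> ball (z j) r" for t
      proof -
        have "norm (w i - z i) < r" if "i \<in> I" for i
          using w r that by (force simp: polydisc_def \<delta>_def)
        then show "w(j := t) \<in> polydisc I z r"
          using w that jI by (auto simp: polydisc_def dist_norm norm_minus_commute)
        show "z(j := t) \<in> polydisc I z r"
          using z0 r that jI by (auto simp: polydisc_def dist_norm norm_minus_commute)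
      qed
      have "norm (G (w j) - G (z j)) \<le> 2 * (L * N * \<delta>3) / (r/2) * norm (w j - z j)"
      proof (rule one_var_lipschitz[where z = "z j"])
        fix t assume t: "t \<in> ball (z j) (2 * (r/2))"
        then have t: "t \<in> ball (z j) r" by simp
        have "w(j := t) \<in> U" "z(j := t) \<in> U"
          using inr[OF t] R(2) polydisc_mono[of r R I z] r by (auto simp: r_def)
        then have "(\<lambda>s. f ((w(j := t))(j := s))) field_differentiable at ((w(j := t)) j)"
          "(\<lambda>s. f ((z(j := t))(j := s))) field_differentiable at ((z(j := t)) j)"
          using holo jI unfolding holo_def by blast+
        then show "G field_differentiable at t"
          unfolding G_def by (intro field_differentiable_diff) simp_all
        have "norm (G t) \<le> L * (\<Sum>i\<in>I. norm ((w(j := t)) i - (z(j := t)) i))"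
          unfolding G_def by (rule lip) (use inr[OF t] in auto)
        also have "(\<Sum>i\<in>I. norm ((w(j := t)) i - (z(j := t)) i)) \<le> (\<Sum>i\<in>I. \<delta>3)"
        proof (rule sum_mono)
          fix i assume "i \<in> I"
          then have "norm (w i - z i) < \<delta>3" using w by (auto simp: polydisc_def \<delta>_def)
          then show "norm ((w(j := t)) i - (z(j := t)) i) \<le> \<delta>3" using d3 by auto
        qed
        finally show "norm (G t) \<le> L * N * \<delta>3" using L0 by (simp add: N_def mult_left_mono mult.assoc)
      qed (use r wj in \<open>auto simp: \<delta>_def dist_norm norm_minus_commute\<close>)
      also have "\<dots> \<le> \<epsilon>/2 * norm (w j - z j)"
      proof (rule mult_right_mono)
        have "8 * (L * N * \<delta>3) \<le> \<epsilon> * r"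
          using LN insert.prems r by (simp add: \<delta>3_def field_simps)
        then show "2 * (L * N * \<delta>3) / (r/2) \<le> \<epsilon>/2" using r by (simp add: field_simps)
      qed auto
      finally have 3: "norm (G (w j) - G (z j)) \<le> \<epsilon>/2 * norm (w j - z j)" .
      have "f w - f z - (\<Sum>i\<in>insert j K. c i * (w i - z i)) =
        (f v - f z - (\<Sum>i\<in>K. c i * (w i - z i))) + (f (z(j := w j)) - f z - c j * (w j - z j)) + (G (w j) - G (z j))"
        using insert by (simp add: G_def v_def algebra_simps)
      also have "norm \<dots> \<le> \<epsilon> * (\<Sum>i\<in>K. norm (w i - z i)) + \<epsilon>/2 * norm (w j - z j) + \<epsilon>/2 * norm (w j - z j)"
        by (intro order_trans[OF norm_triangle_ineq] add_mono 1 2 3)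
      finally show ?thesis using insert by (simp add: algebra_simps)
    qed
    with d show ?case by (intro exI[of _ \<delta>] conjI ballI impI) auto
  qed
  note * = this[OF fin order_refl]
  have "\<exists>\<delta>>0. \<forall>w\<in>polydisc I z \<delta>.
    norm (f w - f z - (\<Sum>i\<in>I. c i * (w i - z i))) \<le> \<epsilon> * (\<Sum>i\<in>I. norm (w i - z i))" if "\<epsilon> > 0" for \<epsilon>
  proof -
    from *[OF that] obtain \<delta> where "\<delta>>0" and D: "\<forall>w\<in>polydisc I z \<delta>. (\<forall>i. i \<notin> I \<longrightarrow> w i = z i) \<longrightarrow>
      norm (f w - f z - (\<Sum>i\<in>I. c i * (w i - z i))) \<le> \<epsilon> * (\<Sum>i\<in>I. norm (w i - z i))" by blast
    moreover have "\<forall>w\<in>polydisc I z \<delta>. (\<forall>i. i \<notin> I \<longrightarrow> w i = z i)" using z0 by (auto simp: polydisc_def)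
    ultimately show ?thesis by blast
  qed
  then show ?thesis by (rule that)
qed

text \<open>
  A family \<open>F\<close> of functions on any normed space may be substituted; differentiability within a set is
  what the null set argument needs.
\<close>

lemma holo_chain:
  fixes F :: "'e::real_normed_vector \<Rightarrow> 'i \<Rightarrow> complex"
  assumes FU: "F x \<in> U" and F0: "\<And>y i. i \<notin> I \<Longrightarrow> F y i = 0"
    and F: "\<And>i. i \<in> I \<Longrightarrow> ((\<lambda>y. F y i) has_derivative F' i) (at x within S)"
  obtains c where "((\<lambda>y. f (F y)) has_derivative (\<lambda>h. \<Sum>i\<in>I. c i * F' i h)) (at x within S)"
proof -
  obtain c where c: "\<And>\<epsilon>. \<epsilon> > 0 \<Longrightarrow> \<exists>\<delta>>0. \<forall>w\<in>polydisc I (F x) \<delta>.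
    norm (f w - f (F x) - (\<Sum>i\<in>I. c i * (w i - F x i))) \<le> \<epsilon> * (\<Sum>i\<in>I. norm (w i - F x i))"
    using holo_derivative[OF FU] by blast
  have lin: "((\<lambda>y. \<Sum>i\<in>I. c i * F y i) has_derivative (\<lambda>h. \<Sum>i\<in>I. c i * F' i h)) (at x within S)"
    by (intro has_derivative_sum has_derivative_mult_right F)
  have "\<exists>B d. B > 0 \<and> d > 0 \<and> (\<forall>y\<in>S. norm (y - x) < d \<longrightarrow> norm (F y i - F x i) \<le> B * norm (y - x))"
    if i: "i \<in> I" for i
  proof -
    obtain d where d: "d > 0" "\<And>y. y \<in> S \<Longrightarrow> norm (y - x) < d \<Longrightarrow>
        norm (F y i - F x i - F' i (y - x)) \<le> 1 * norm (y - x)"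
      using F[OF i] unfolding has_derivative_within_alt by (metis zero_less_one)
    obtain K where K: "K > 0" "\<And>h. norm (F' i h) \<le> norm h * K"
      using F[OF i] bounded_linear.pos_bounded unfolding has_derivative_within_alt by blast
    have "norm (F y i - F x i) \<le> (1 + K) * norm (y - x)" if "y \<in> S" "norm (y - x) < d" for y
      using d(2)[OF that] K(2)[of "y - x"] norm_triangle_ineq[of "F y i - F x i - F' i (y - x)" "F' i (y - x)"]
      by (simp add: algebra_simps)
    with d(1) K(1) show ?thesis by (intro exI[of _ "1 + K"] exI[of _ d]) auto
  qed
  then obtain B d where B: "\<And>i. i \<in> I \<Longrightarrow> B i > (0::real)" and d: "\<And>i. i \<in> I \<Longrightarrow> d i > (0::real)"
    and BF: "\<And>i y. i \<in> I \<Longrightarrow> y \<in> S \<Longrightarrow> norm (y - x) < d i \<Longrightarrow> norm (F y i - F x i) \<le> B i * norm (y - x)"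
    by metis
  define d0 where "d0 = Min (insert 1 (d ` I))"
  have d0: "d0 > 0" "\<And>i. i \<in> I \<Longrightarrow> d0 \<le> d i" using fin d by (auto simp: d0_def)
  define C where "C = 1 + sum B I"
  have C: "C > 0" and CB: "\<And>i. i \<in> I \<Longrightarrow> B i < C" "sum B I \<le> C"
  proof -
    have nn: "sum B I \<ge> 0" using B by (intro sum_nonneg) (auto intro: less_imp_le)
    then show "C > 0" "sum B I \<le> C" by (auto simp: C_def)
    show "B i < C" if "i \<in> I" for i
      using member_le_sum[OF that _ fin, of B] B by (force simp: C_def intro: less_imp_le)
  qed
  have "\<exists>\<delta>>0. \<forall>y\<in>S. norm (y - x) < \<delta> \<longrightarrow>
      norm (f (F y) - f (F x) - (\<Sum>i\<in>I. c i * F' i (y - x))) \<le> e * norm (y - x)" if e: "e > 0" for e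
  proof -
    obtain \<delta>1 where d1: "\<delta>1 > 0" and D1: "\<And>w. w \<in> polydisc I (F x) \<delta>1 \<Longrightarrow>
      norm (f w - f (F x) - (\<Sum>i\<in>I. c i * (w i - F x i))) \<le> (e / (2*C)) * (\<Sum>i\<in>I. norm (w i - F x i))"
      using c[of "e / (2*C)"] e C by auto
    obtain \<delta>2 where d2: "\<delta>2 > 0" and D2: "\<And>y. y \<in> S \<Longrightarrow> norm (y - x) < \<delta>2 \<Longrightarrow>
      norm ((\<Sum>i\<in>I. c i * F y i) - (\<Sum>i\<in>I. c i * F x i) - (\<Sum>i\<in>I. c i * F' i (y - x))) \<le> e/2 * norm (y - x)"
      using lin[unfolded has_derivative_within_alt, THEN conjunct2, rule_format, of "e/2"] e by auto
    define \<delta> where "\<delta> = min d0 (min \<delta>2 (\<delta>1 / C))"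
    have dd: "\<delta> > 0" using d0 d1 d2 C by (simp add: \<delta>_def)
    have "norm (f (F y) - f (F x) - (\<Sum>i\<in>I. c i * F' i (y - x))) \<le> e * norm (y - x)"
      if y: "y \<in> S" "norm (y - x) < \<delta>" for y
    proof -
      have b: "norm (F y i - F x i) \<le> B i * norm (y - x)" if "i \<in> I" for i
        by (rule BF) (use y that d0(2)[OF that] in \<open>auto simp: \<delta>_def\<close>)
      have yC: "C * norm (y - x) < \<delta>1" using y C by (simp add: \<delta>_def field_simps)
      have "F y \<in> polydisc I (F x) \<delta>1"
        unfolding polydisc_def
      proof (safe)
        fix i assume i: "i \<in> I"
        have "B i * norm (y - x) \<le> C * norm (y - x)" by (rule mult_right_mono) (use CB(1)[OF i] in auto)
        then show "norm (F y i - F x i) < \<delta>1" using b[OF i] yC by linarith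
      qed (use F0 in auto)
      note 1 = D1[OF this]
      have "(\<Sum>i\<in>I. norm (F y i - F x i)) \<le> (\<Sum>i\<in>I. B i * norm (y - x))"
        by (rule sum_mono) (rule b)
      also have "\<dots> \<le> C * norm (y - x)"
        unfolding sum_distrib_right[symmetric] by (rule mult_right_mono) (use CB in auto)
      finally have "(e / (2*C)) * (\<Sum>i\<in>I. norm (F y i - F x i)) \<le> (e / (2*C)) * (C * norm (y - x))"
        by (rule mult_left_mono) (use e C in auto)
      then have 2: "norm (f (F y) - f (F x) - (\<Sum>i\<in>I. c i * (F y i - F x i))) \<le> e / 2 * norm (y - x)"
        using 1 C by (auto intro: order_trans)
      have 3: "norm ((\<Sum>i\<in>I. c i * F y i) - (\<Sum>i\<in>I. c i * F x i) - (\<Sum>i\<in>I. c i * F' i (y - x))) \<le> e/2 * norm (y - x)"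
        by (rule D2) (use y in \<open>auto simp: \<delta>_def\<close>)
      have "f (F y) - f (F x) - (\<Sum>i\<in>I. c i * F' i (y - x)) =
        (f (F y) - f (F x) - (\<Sum>i\<in>I. c i * (F y i - F x i))) +
        ((\<Sum>i\<in>I. c i * F y i) - (\<Sum>i\<in>I. c i * F x i) - (\<Sum>i\<in>I. c i * F' i (y - x)))"
        by (simp add: right_diff_distrib sum_subtractf)
      also have "norm \<dots> \<le> e/2 * norm (y - x) + e/2 * norm (y - x)"
        by (intro order_trans[OF norm_triangle_ineq] add_mono 2 3)
      finally show ?thesis by linarith
    qed
    with dd show ?thesis by (intro exI[of _ \<delta>] conjI ballI impI) auto
  qed
  moreover have "bounded_linear (\<lambda>h. \<Sum>i\<in>I. c i * F' i h)"
    using lin has_derivative_bounded_linear by blast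
  ultimately have "((\<lambda>y. f (F y)) has_derivative (\<lambda>h. \<Sum>i\<in>I. c i * F' i h)) (at x within S)"
    unfolding has_derivative_within_alt by simp
  then show ?thesis by (rule that)
qed

lemma holo_chain_field:
  assumes FU: "F x \<in> U" and F0: "\<And>y i. i \<notin> I \<Longrightarrow> F y i = 0"
    and F: "\<And>i. i \<in> I \<Longrightarrow> (\<lambda>y. F y i) field_differentiable at x"
  shows "(\<lambda>y. f (F y)) field_differentiable at x"
proof -
  define d where "d i = deriv (\<lambda>y. F y i) x" for i
  have "((\<lambda>y. F y i) has_derivative (*) (d i)) (at x within UNIV)" if "i \<in> I" for i
    using field_differentiable_derivI[OF F[OF that]] by (simp add: has_field_derivative_def d_def)
  from holo_chain[where S = UNIV, OF FU F0 this] obtain c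
    where "((\<lambda>y. f (F y)) has_derivative (\<lambda>h. \<Sum>i\<in>I. c i * (d i * h))) (at x)" by auto
  moreover have "(\<lambda>h. \<Sum>i\<in>I. c i * (d i * h)) = (*) (\<Sum>i\<in>I. c i * d i)"
    by (auto simp: sum_distrib_right mult.assoc)
  ultimately show ?thesis
    unfolding field_differentiable_def has_field_derivative_def by metis
qed

end

lemma holo_coordinate:
  assumes "openin (complex_space I) U"
  shows "holo I U (\<lambda>z. z i)"
  unfolding holo_def
proof (intro conjI ballI)
  show "continuous_map (subtopology (complex_space I) U) euclidean (\<lambda>z. z i)"
    unfolding complex_space_def
    by (intro continuous_map_from_subtopology continuous_map_product_projection) auto
  show "(\<lambda>w. (z(j := w)) i) field_differentiable at (z j)" for z j
    by (cases "i = j") auto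
qed fact

no_notation fps_nth (infixl "$" 75)

section \<open>Representations as tuples of matrices\<close>

lemma mat_mult_entry [simp]: "(mat c ** A) $ i $ j = c * A $ i $ j" for A :: "complex^'n^'n"
  by (simp add: matrix_matrix_mult_def mat_def if_distrib[of "\<lambda>x. x * _"] cong: if_cong)

lemma mult_mat_entry [simp]: "(A ** mat c) $ i $ j = A $ i $ j * c" for A :: "complex^'n^'n"
  by (simp add: matrix_matrix_mult_def mat_def if_distrib[of "\<lambda>x. _ * x"] cong: if_cong)

lemma mat_central: "mat c ** A = A ** mat c" for A :: "complex^'n^'n"
  by (simp add: vec_eq_iff)

lemma mat_mult_mat: "mat c ** mat d = (mat (c * d) :: complex^'n^'n)"
  by (simp add: vec_eq_iff) (simp add: mat_def)

lemma mat_mult_mat_assoc: "mat c ** (mat d ** A) = (mat (c * d) ** A :: complex^'n^'n)"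
  by (simp add: matrix_mul_assoc mat_mult_mat)

lemma mat_pull: "A ** (mat c ** B) = mat c ** (A ** B)" for A :: "complex^'n^'n"
  by (metis mat_central matrix_mul_assoc)

lemma mat_vector_mult: "mat c *v x = c *s (x :: complex^'n)"
  by (simp add: vec_eq_iff matrix_vector_mult_def mat_def if_distrib[of "\<lambda>x. x * _"] cong: if_cong)

lemma det_mat: "det (mat c :: complex^'n^'n) = c ^ CARD('n)"
  by (subst det_diagonal) (simp_all add: mat_def)

lemma det_mat_mult: "det (mat c ** A) = c ^ CARD('n) * det A" for A :: "complex^'n^'n"
  by (simp add: det_mul det_mat)

lemma mat_mult_cancel: "c \<noteq> 0 \<Longrightarrow> mat c ** A = mat c ** B \<longleftrightarrow> A = B" for A :: "complex^'n^'n"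
  by (simp add: vec_eq_iff)

lemma carrier_SL [simp]: "A \<in> carrier SL_group \<longleftrightarrow> det A = 1"
  by (simp add: SL_group_def)

lemma mult_SL [simp]: "A \<otimes>\<^bsub>SL_group\<^esub> B = A ** B"
  by (simp add: SL_group_def)

lemma matrix_mult_add_left: "(A + B) ** C = A ** C + B ** C" for A :: "complex^'n^'m"
  by (vector matrix_matrix_mult_def sum.distrib[symmetric] distrib_right)

lemma det_nz_inverse:
  fixes g :: "complex^'n^'n"
  assumes "det g \<noteq> 0"
  obtains h where "g ** h = mat 1" "h ** g = mat 1" "det g * det h = 1"
proof -
  from assms obtain h where h: "g ** h = mat 1" "h ** g = mat 1"
    by (auto simp: invertible_det_nz[symmetric] invertible_def)
  then have "det g * det h = 1" by (metis det_I det_mul)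
  with h show ?thesis by (rule that)
qed

lemma SL_inverse:
  fixes g :: "complex^'n^'n"
  assumes "det g = 1"
  obtains h where "g ** h = mat 1" "h ** g = mat 1" "det h = 1"
proof -
  have "det g \<noteq> 0" using assms by simp
  then obtain h where "g ** h = mat 1" "h ** g = mat 1" "det g * det h = 1"
    by (rule det_nz_inverse)
  with assms show ?thesis by (intro that[of h]) simp_all
qed

definition elementary :: "'n \<Rightarrow> 'n \<Rightarrow> complex^'n^'n" where
  "elementary i j = (\<chi> r s. if r = i \<and> s = j then 1 else 0)"

lemma det_transvection:
  assumes "i \<noteq> j"
  shows "det (mat 1 + elementary i j :: complex^'n^'n) = 1"
proof -
  have "mat 1 + elementary i j = (\<chi> k. if k = i then row i (mat 1) + 1 *s row j (mat 1) else row k (mat 1 :: complex^'n^'n))"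
    using assms by (simp add: vec_eq_iff elementary_def row_def mat_def)
  then show ?thesis using det_row_operation[of i j "mat 1 :: complex^'n^'n" 1] assms by simp
qed

text \<open>
  A central matrix commutes with the transvections \<open>1 + E\<^sub>i\<^sub>a\<close>, hence with all \<open>E\<^sub>i\<^sub>a\<close>, which forces it
  to be scalar.
\<close>

lemma SL_center_eq: "(SL_center :: (complex^'p^'p) set) = {mat c |c. c ^ CARD('p) = 1}"
proof (intro Set.set_eqI iffI)
  fix z :: "complex^'p^'p"
  assume z: "z \<in> SL_center"
  then have dz: "det z = 1" and comm: "\<And>h. det h = 1 \<Longrightarrow> z ** h = h ** z"
    by (auto simp: SL_center_def centralizer_def)
  have off: "z $ a $ i = 0 \<and> z $ i $ i = z $ a $ a" if ai: "a \<noteq> i" for a i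
  proof -
    define N :: "complex^'p^'p" where "N = elementary i a"
    have "det (mat 1 + N) = 1" unfolding N_def by (rule det_transvection) (use ai in simp)
    from comm[OF this] have "z ** N = N ** z"
      by (simp add: matrix_add_ldistrib matrix_mult_add_left)
    then have "(z ** N) $ b $ a = (N ** z) $ b $ a" for b by simp
    then have "z $ b $ i = (if b = i then z $ a $ a else 0)" for b
      by (simp add: matrix_matrix_mult_def N_def elementary_def if_distrib[of "\<lambda>x. x * _"] if_distrib[of "\<lambda>x. _ * x"] cong: if_cong)
    then show ?thesis using ai by auto
  qed
  fix i0 :: 'p
  have zc: "z = mat (z $ i0 $ i0)" for i0
  proof -
    have "z $ a $ b = (if a = b then z $ i0 $ i0 else 0)" for a b
    proof (cases "a = b")
      case True
      then show ?thesis using off[of i0 a] by (cases "a = i0") simp_all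
    next
      case False
      then show ?thesis using off[of a b] by simp
    qed
    then show ?thesis unfolding vec_eq_iff mat_def vec_lambda_beta by blast
  qed
  with dz have "(z $ i0 $ i0) ^ CARD('p) = 1" for i0 by (metis det_mat)
  with zc show "z \<in> {mat c |c. c ^ CARD('p) = 1}" by blast
next
  fix z :: "complex^'p^'p"
  assume "z \<in> {mat c |c. c ^ CARD('p) = 1}"
  then obtain c where "z = mat c" "c ^ CARD('p) = 1" by blast
  then show "z \<in> SL_center"
    by (auto simp: SL_center_def centralizer_def det_mat mat_central)
qed

lemma to_PSL_eq: "to_PSL A = {mat c ** A |c. c ^ CARD('p) = 1}" for A :: "complex^'p^'p"
  by (auto simp: to_PSL_def r_coset_def SL_center_eq)

lemma to_PSL_eq_iff:
  fixes A B :: "complex^'p^'p"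
  shows "to_PSL A = to_PSL B \<longleftrightarrow> (\<exists>c. c ^ CARD('p) = 1 \<and> B = mat c ** A)"
proof
  assume "to_PSL A = to_PSL B"
  moreover have "B \<in> to_PSL B" by (auto simp: to_PSL_eq intro!: exI[of _ 1])
  ultimately show "\<exists>c. c ^ CARD('p) = 1 \<and> B = mat c ** A" by (auto simp: to_PSL_eq)
next
  assume "\<exists>c. c ^ CARD('p) = 1 \<and> B = mat c ** A"
  then obtain c where c: "c ^ CARD('p) = 1" "B = mat c ** A" by blast
  then have c0: "c \<noteq> 0" by (auto simp: power_0_left)
  show "to_PSL A = to_PSL B"
  proof (intro Set.set_eqI iffI)
    fix x assume "x \<in> to_PSL A"
    then obtain d where d: "x = mat d ** A" "d ^ CARD('p) = 1" by (auto simp: to_PSL_eq)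
    then have "x = mat (d / c) ** B" "(d / c) ^ CARD('p) = 1"
      using c c0 by (auto simp: mat_mult_mat_assoc power_divide)
    then show "x \<in> to_PSL B" by (auto simp: to_PSL_eq)
  next
    fix x assume "x \<in> to_PSL B"
    then obtain d where d: "x = mat d ** B" "d ^ CARD('p) = 1" by (auto simp: to_PSL_eq)
    then have "x = mat (d * c) ** A" "(d * c) ^ CARD('p) = 1"
      using c by (auto simp: mat_mult_mat_assoc power_mult_distrib)
    then show "x \<in> to_PSL A" by (auto simp: to_PSL_eq)
  qed
qed

lemma mult_PSL:
  assumes "det A = 1" "det B = 1"
  shows "to_PSL A \<otimes>\<^bsub>PSL_group\<^esub> to_PSL B = to_PSL (A ** B)"
  using normal.rcos_sum[OF SL_center_normal, of A B] assms
  by (simp add: to_PSL_def PSL_group_def FactGroup_def)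

lemma to_PSL_carrier [simp]: "det A = 1 \<Longrightarrow> to_PSL A \<in> carrier PSL_group"
  by (simp add: carrier_PSL_group)

lemma one_PSL: "\<one>\<^bsub>PSL_group\<^esub> = to_PSL (mat 1)"
proof -
  interpret G: group PSL_group by (rule group_PSL_group)
  have "to_PSL (mat 1) \<otimes>\<^bsub>PSL_group\<^esub> to_PSL (mat 1) = to_PSL (mat 1)"
    by (simp add: mult_PSL)
  then show ?thesis by (metis G.r_cancel_one' to_PSL_carrier det_I)
qed

lemma inv_PSL:
  assumes "g ** h = mat 1" "det g = 1" "det h = 1"
  shows "inv\<^bsub>PSL_group\<^esub> (to_PSL g) = to_PSL h"
proof -
  interpret G: group PSL_group by (rule group_PSL_group)
  have "h ** g = mat 1" using assms by (simp add: matrix_left_right_inverse)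
  then show ?thesis using assms by (intro G.inv_equality) (simp_all add: mult_PSL one_PSL)
qed

lemma carrier_PSL_cases:
  assumes "x \<in> carrier PSL_group"
  obtains A where "det A = 1" "x = to_PSL A"
  using assms by (auto simp: carrier_PSL_group)

definition proj_tuple :: "('l \<Rightarrow> complex^'p^'p) \<Rightarrow> 'l \<Rightarrow> (complex^'p^'p) set" where
  "proj_tuple A = (\<lambda>k. to_PSL (A k))"

lemma SL_tuplesD: "A \<in> SL_tuples \<Longrightarrow> det (A k) = 1"
  by (simp add: SL_tuples_def)

lemma SL_tuplesI: "(\<And>k. det (A k) = 1) \<Longrightarrow> A \<in> SL_tuples"
  by (simp add: SL_tuples_def)

lemma range_proj_tuple: "A \<in> SL_tuples \<Longrightarrow> range (proj_tuple A) \<subseteq> carrier PSL_group"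
  by (auto simp: proj_tuple_def SL_tuplesD)

lemma proj_tuple_lift:
  fixes \<rho> :: "'l::finite \<Rightarrow> (complex^'p^'p) set"
  assumes "range \<rho> \<subseteq> carrier PSL_group"
  obtains A where "A \<in> SL_tuples" "\<rho> = proj_tuple A"
proof -
  have "\<forall>k. \<exists>A. det A = 1 \<and> \<rho> k = to_PSL A"
    using assms carrier_PSL_cases by (metis range_subsetD)
  then obtain A where "\<And>k. det (A k) = 1 \<and> \<rho> k = to_PSL (A k)" by metis
  then show ?thesis by (intro that[of A]) (auto simp: SL_tuples_def proj_tuple_def)
qed

lemma subspace_all_axes:
  fixes W :: "(complex^'n) set"
  assumes W: "vec.subspace W" and ax: "\<And>i. axis i 1 \<in> W"
  shows "W = UNIV"
proof -
  have "x \<in> W" for x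
  proof -
    have "x = (\<Sum>i\<in>UNIV. x $ i *s axis i 1)" by (rule basis_expansion[symmetric])
    also have "\<dots> \<in> W" by (intro vec.subspace_sum[OF W] vec.subspace_scale[OF W] ax)
    finally show ?thesis .
  qed
  then show ?thesis by auto
qed

text \<open>
  Irreducibility of the subgroup of PSL generated by the classes, read on the matrices themselves:
  no proper non-zero subspace is stabilized. See \<open>irreducible_reps_iff\<close>.
\<close>

definition irreducible_tuple :: "('l \<Rightarrow> complex^'p^'p) \<Rightarrow> bool" where
  "irreducible_tuple A \<longleftrightarrow>
    (\<forall>W. vec.subspace W \<and> (\<forall>k. (*v) (A k) ` W = W) \<longrightarrow> W = {0} \<or> W = UNIV)"

lemma image_mat_subspace:
  fixes A :: "complex^'n^'n"
  assumes "vec.subspace W" "c \<noteq> 0"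
  shows "(*v) (mat c ** A) ` W = (*v) A ` W"
proof -
  have m: "(mat c ** A) *v w = A *v (c *s w)" for w
    by (simp add: mat_central[of c A] matrix_vector_mul_assoc[symmetric] mat_vector_mult)
  show ?thesis
  proof (intro Set.set_eqI iffI)
    fix x assume "x \<in> (*v) (mat c ** A) ` W"
    then show "x \<in> (*v) A ` W" using vec.subspace_scale[OF assms(1)] m by auto
  next
    fix x assume "x \<in> (*v) A ` W"
    then obtain w where w: "w \<in> W" "x = A *v w" by auto
    then have "x = (mat c ** A) *v (inverse c *s w)"
      using assms(2) by (simp add: m vec.scale_scale)
    then show "x \<in> (*v) (mat c ** A) ` W" using vec.subspace_scale[OF assms(1)] w by blast
  qed
qed

lemma inverse_image_eq:
  assumes "g ** h = mat 1" "h ** g = mat 1" "(*v) g ` W = W"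
  shows "(*v) h ` W = W"
proof -
  have "(*v) h ` W = (*v) h ` ((*v) g ` W)" using assms(3) by simp
  also have "\<dots> = W" using assms(2) by (simp add: image_image matrix_vector_mul_assoc)
  finally show ?thesis .
qed

lemma subgroup_flag_stabilizer:
  "subgroup (flag_stabilizer F :: (complex^'p^'p) set set) PSL_group"
proof -
  interpret G: group "PSL_group :: (complex^'p^'p) set monoid" by (rule group_PSL_group)
  show ?thesis
  proof
    show "flag_stabilizer F \<subseteq> carrier PSL_group"
      by (auto simp: flag_stabilizer_def)
    show "\<one>\<^bsub>PSL_group\<^esub> \<in> flag_stabilizer F"
      by (auto simp: flag_stabilizer_def one_PSL intro!: image_eqI[of _ _ "mat 1"])
  next
    fix x y :: "(complex^'p^'p) set"
    assume "x \<in> flag_stabilizer F" "y \<in> flag_stabilizer F"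
    then obtain A B where A: "det A = 1" "\<forall>W\<in>F. (*v) A ` W = W" "x = to_PSL A"
      and B: "det B = 1" "\<forall>W\<in>F. (*v) B ` W = W" "y = to_PSL B"
      by (auto simp: flag_stabilizer_def)
    have "(*v) (A ** B) ` W = W" if "W \<in> F" for W
    proof -
      have "(*v) (A ** B) ` W = (*v) A ` ((*v) B ` W)"
        by (simp add: image_image matrix_vector_mul_assoc)
      then show ?thesis using A B that by simp
    qed
    then show "x \<otimes>\<^bsub>PSL_group\<^esub> y \<in> flag_stabilizer F"
      using A B by (auto simp: flag_stabilizer_def mult_PSL det_mul intro!: image_eqI[of _ _ "A ** B"])
  next
    fix x :: "(complex^'p^'p) set"
    assume "x \<in> flag_stabilizer F"
    then obtain A where A: "det A = 1" "\<forall>W\<in>F. (*v) A ` W = W" "x = to_PSL A"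
      by (auto simp: flag_stabilizer_def)
    obtain h where h: "A ** h = mat 1" "h ** A = mat 1" "det h = 1"
      using A(1) by (rule SL_inverse)
    then have "inv\<^bsub>PSL_group\<^esub> x = to_PSL h" using A by (simp add: inv_PSL)
    moreover have "\<forall>W\<in>F. (*v) h ` W = W"
      using A by (auto intro!: inverse_image_eq[OF h(1,2)] simp del: mult_SL)
    ultimately show "inv\<^bsub>PSL_group\<^esub> x \<in> flag_stabilizer F"
      using h A by (auto simp: flag_stabilizer_def intro!: image_eqI[of _ _ h])
  qed
qed

lemma to_PSL_in_flag_stabilizer:
  assumes W: "vec.subspace W" "W \<in> F" and A: "to_PSL A \<in> flag_stabilizer F"
  shows "(*v) (A :: complex^'p^'p) ` W = W"
proof -
  obtain B where B: "(*v) B ` W = W" "to_PSL B = to_PSL A"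
    using A W by (auto simp: flag_stabilizer_def)
  then obtain c where c: "c ^ CARD('p) = 1" "A = mat c ** B" by (auto simp: to_PSL_eq_iff)
  then have "c \<noteq> 0" by (auto simp: power_0_left)
  then show ?thesis using c B image_mat_subspace[OF W(1)] by simp
qed

text \<open>
  For the flag consisting of one proper non-zero subspace the stabilizer is a proper subgroup, because
  transvections move every such subspace. Conversely, a flag with proper stabilizer contains a proper
  non-zero subspace, and a lift of an element of the stabilizer preserves it since scalars do.
\<close>

lemma irreducible_reps_iff:
  fixes A :: "'l::finite \<Rightarrow> complex^'p^'p"
  assumes p: "CARD('p) \<ge> 2" and A: "A \<in> SL_tuples"
  shows "proj_tuple A \<in> irreducible_reps \<longleftrightarrow> irreducible_tuple A"
proof
  assume irr: "proj_tuple A \<in> irreducible_reps"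
  interpret G: group "PSL_group :: (complex^'p^'p) set monoid" by (rule group_PSL_group)
  show "irreducible_tuple A"
    unfolding irreducible_tuple_def
  proof (intro allI impI, elim conjE, rule ccontr)
    fix W assume W: "vec.subspace W" and inv: "\<forall>k. (*v) (A k) ` W = W"
      and n0': "\<not> (W = {0} \<or> W = UNIV)"
    from n0' have n0: "W \<noteq> UNIV" "W \<noteq> {0}" by auto
    have "rep_image (proj_tuple A) \<subseteq> flag_stabilizer {W}"
      unfolding rep_image_def
      by (rule G.generate_subgroup_incl[OF _ subgroup_flag_stabilizer])
         (use A inv in \<open>auto simp: flag_stabilizer_def proj_tuple_def SL_tuplesD\<close>)
    moreover have "parabolic (flag_stabilizer {W})" using W by (auto simp: parabolic_def)
    ultimately have "flag_stabilizer {W} = carrier PSL_group"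
      using irr by (auto simp: irreducible_reps_def irreducible_subgroup_def)
    then have all: "(*v) B ` W = W" if "det B = 1" for B
      using to_PSL_in_flag_stabilizer[OF W, of "{W}" B] that by simp
    have step: "w $ j *s axis i 1 \<in> W" if w: "w \<in> W" and ij: "i \<noteq> j" for w i j
    proof -
      define N :: "complex^'p^'p" where "N = elementary i j"
      have "det (mat 1 + N) = 1" unfolding N_def by (rule det_transvection[OF ij])
      from all[OF this] w have "(mat 1 + N) *v w \<in> W" by blast
      then have "N *v w \<in> W"
        using vec.subspace_diff[OF W _ w] by (simp add: matrix_vector_mult_add_rdistrib) (metis add_diff_cancel_left')
      moreover have "N *v w = w $ j *s axis i 1"
        by (simp add: vec_eq_iff matrix_vector_mult_def N_def elementary_def axis_def if_distrib[of "\<lambda>x. x * _"] cong: if_cong)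
      ultimately show ?thesis by simp
    qed
    have "0 \<in> W" using vec.subspace_0[OF W] .
    with n0 obtain w where w: "w \<in> W" "w \<noteq> 0" by auto
    then obtain j where j: "w $ j \<noteq> 0" by (auto simp: vec_eq_iff)
    have ax: "axis i (1::complex) \<in> W" if "i \<noteq> j" for i
      using vec.subspace_scale[OF W step[OF w(1) that], of "inverse (w $ j)"] j
      by (simp add: vec.scale_scale)
    obtain i where i: "i \<noteq> j"
      using p card_le_Suc0_iff_eq[of "UNIV :: 'p set"] by (auto simp: numeral_2_eq_2 not_less_eq_eq[symmetric]) metis
    have "axis j (1::complex) \<in> W"
      using step[OF ax[OF i], of j i] i by (simp add: axis_def)
    with ax have ax: "axis i (1::complex) \<in> W" for i by (cases "i = j") auto
    have "W = UNIV" using subspace_all_axes[OF W ax] .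
    with n0 show False by auto
  qed
next
  assume irr: "irreducible_tuple A"
  interpret G: group "PSL_group :: (complex^'p^'p) set monoid" by (rule group_PSL_group)
  have "subgroup (rep_image (proj_tuple A)) PSL_group"
    unfolding rep_image_def by (rule G.generate_is_subgroup[OF range_proj_tuple[OF A]])
  moreover have "\<not> rep_image (proj_tuple A) \<subseteq> P"
    if P: "parabolic P" "P \<noteq> carrier PSL_group" for P
  proof
    assume sub: "rep_image (proj_tuple A) \<subseteq> P"
    from P(1) obtain F where F: "\<forall>W\<in>F. vec.subspace W" and PF: "P = flag_stabilizer F"
      by (auto simp: parabolic_def)
    have triv: "W = {0} \<or> W = UNIV" if W: "W \<in> F" for W
    proof -
      have "to_PSL (A k) \<in> flag_stabilizer F" for k
      proof -
        have "proj_tuple A k \<in> rep_image (proj_tuple A)"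
          unfolding rep_image_def by (rule generate.incl) simp
        then show ?thesis using sub by (auto simp: PF proj_tuple_def)
      qed
      then have "\<forall>k. (*v) (A k) ` W = W"
        using to_PSL_in_flag_stabilizer[OF _ W] F W by simp
      then show ?thesis using irr F W unfolding irreducible_tuple_def by blast
    qed
    have stab: "(*v) B ` W = W" if "det B = 1" "W \<in> F" for B W
    proof -
      obtain h where "B ** h = mat 1" using \<open>det B = 1\<close> by (rule SL_inverse)
      then have "surj ((*v) B)"
        by (intro surjI[of _ "(*v) h"]) (simp add: matrix_vector_mul_assoc)
      then show ?thesis using triv[OF that(2)] by auto
    qed
    have "{B \<in> carrier SL_group. \<forall>W\<in>F. (*v) B ` W = W} = carrier SL_group"
      by (intro equalityI subsetI; simp add: stab)
    then have "P = carrier PSL_group"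
      unfolding PF flag_stabilizer_def carrier_PSL_group by (rule arg_cong)
    with P(2) show False by simp
  qed
  ultimately show "proj_tuple A \<in> irreducible_reps"
    using range_proj_tuple[OF A] by (auto simp: irreducible_reps_def irreducible_subgroup_def)
qed

lemma irreducible_tuple_conj:
  assumes g: "det g \<noteq> 0" and c: "\<And>k. c k \<noteq> 0" and AB: "\<And>k. g ** A k = mat (c k) ** (B k ** g)"
    and irr: "irreducible_tuple A"
  shows "irreducible_tuple B"
  unfolding irreducible_tuple_def
proof (intro allI impI, elim conjE, rule disjCI)
  fix W assume W: "vec.subspace W" and inv: "\<forall>k. (*v) (B k) ` W = W" and "W \<noteq> UNIV"
  obtain h where h: "g ** h = mat 1" "h ** g = mat 1" using g by (rule det_nz_inverse)
  have gh: "(*v) g ` (*v) h ` W = W" using h by (simp add: image_image matrix_vector_mul_assoc)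
  have sub: "vec.subspace ((*v) h ` W)" by (rule vec.subspace_image[OF W])
  have "(*v) (A k) ` ((*v) h ` W) = (*v) h ` W" for k
  proof -
    have "A k ** h = h ** (g ** A k) ** h" by (simp add: matrix_mul_assoc h)
    also have "\<dots> = mat (c k) ** (h ** B k ** (g ** h))"
      by (simp add: AB mat_pull matrix_mul_assoc[symmetric])
    finally have "A k ** h = mat (c k) ** (h ** B k)" using h by simp
    then have "(*v) (A k) ` ((*v) h ` W) = (*v) (mat (c k) ** (h ** B k)) ` W"
      by (simp add: image_image matrix_vector_mul_assoc)
    also have "\<dots> = (*v) (h ** B k) ` W" by (rule image_mat_subspace[OF W c])
    also have "\<dots> = (*v) h ` ((*v) (B k) ` W)" by (simp add: image_image matrix_vector_mul_assoc)
    finally show ?thesis using inv by simp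
  qed
  then have "(*v) h ` W = {0} \<or> (*v) h ` W = UNIV" using irr sub unfolding irreducible_tuple_def by blast
  moreover have "(*v) h ` W \<noteq> UNIV"
  proof
    assume "(*v) h ` W = UNIV"
    then have "W = (*v) g ` UNIV" using gh by simp
    moreover have "surj ((*v) g)" by (rule surjI[of _ "(*v) h"]) (simp add: matrix_vector_mul_assoc h)
    ultimately show False using \<open>W \<noteq> UNIV\<close> by simp
  qed
  ultimately have "(*v) h ` W = {0}" by blast
  then show "W = {0}" using gh by auto
qed

lemma conj_class_self:
  assumes r: "range \<rho> \<subseteq> carrier PSL_group"
  shows "\<rho> \<in> conj_class \<rho>"
proof -
  interpret G: group PSL_group by (rule group_PSL_group)
  have "\<rho> k \<in> carrier PSL_group" for k using r by auto
  then have "\<rho> = (\<lambda>k. \<one>\<^bsub>PSL_group\<^esub> \<otimes>\<^bsub>PSL_group\<^esub> \<rho> k \<otimes>\<^bsub>PSL_group\<^esub> inv\<^bsub>PSL_group\<^esub> \<one>\<^bsub>PSL_group\<^esub>)"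
    by (intro ext) simp
  then show ?thesis unfolding conj_class_def by (intro CollectI exI[of _ "\<one>\<^bsub>PSL_group\<^esub>"]) simp
qed

lemma conj_class_eqI_PSL:
  fixes \<rho> \<sigma> :: "'l \<Rightarrow> (complex^'p^'p) set"
  assumes r: "range \<rho> \<subseteq> carrier PSL_group" "g \<in> carrier PSL_group"
    and s: "\<And>k. \<sigma> k = g \<otimes>\<^bsub>PSL_group\<^esub> \<rho> k \<otimes>\<^bsub>PSL_group\<^esub> inv\<^bsub>PSL_group\<^esub> g"
  shows "conj_class \<rho> = conj_class \<sigma>"
proof -
  interpret G: group "PSL_group :: (complex^'p^'p) set monoid" by (rule group_PSL_group)
  have rk: "\<rho> k \<in> carrier PSL_group" for k using r by auto
  have 1: "h \<otimes>\<^bsub>PSL_group\<^esub> \<sigma> k \<otimes>\<^bsub>PSL_group\<^esub> inv\<^bsub>PSL_group\<^esub> h =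
      (h \<otimes>\<^bsub>PSL_group\<^esub> g) \<otimes>\<^bsub>PSL_group\<^esub> \<rho> k \<otimes>\<^bsub>PSL_group\<^esub> inv\<^bsub>PSL_group\<^esub> (h \<otimes>\<^bsub>PSL_group\<^esub> g)"
    if "h \<in> carrier PSL_group" for h k
    using that r(2) rk[of k] by (simp add: s G.m_assoc G.inv_mult_group)
  have 2: "h \<otimes>\<^bsub>PSL_group\<^esub> \<rho> k \<otimes>\<^bsub>PSL_group\<^esub> inv\<^bsub>PSL_group\<^esub> h =
      (h \<otimes>\<^bsub>PSL_group\<^esub> inv\<^bsub>PSL_group\<^esub> g) \<otimes>\<^bsub>PSL_group\<^esub> \<sigma> k \<otimes>\<^bsub>PSL_group\<^esub> inv\<^bsub>PSL_group\<^esub> (h \<otimes>\<^bsub>PSL_group\<^esub> inv\<^bsub>PSL_group\<^esub> g)"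
    if "h \<in> carrier PSL_group" for h k
    using that r(2) rk[of k] by (subst 1) (simp_all add: G.m_assoc)
  show ?thesis
  proof (intro equalityI subsetI)
    fix x assume "x \<in> conj_class \<rho>"
    then obtain h where h: "h \<in> carrier PSL_group"
      and x: "x = (\<lambda>k. h \<otimes>\<^bsub>PSL_group\<^esub> \<rho> k \<otimes>\<^bsub>PSL_group\<^esub> inv\<^bsub>PSL_group\<^esub> h)"
      unfolding conj_class_def by blast
    have "h \<otimes>\<^bsub>PSL_group\<^esub> inv\<^bsub>PSL_group\<^esub> g \<in> carrier PSL_group" using h r(2) by simp
    then show "x \<in> conj_class \<sigma>" unfolding conj_class_def x using 2[OF h] by blast
  next
    fix x assume "x \<in> conj_class \<sigma>"
    then obtain h where h: "h \<in> carrier PSL_group"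
      and x: "x = (\<lambda>k. h \<otimes>\<^bsub>PSL_group\<^esub> \<sigma> k \<otimes>\<^bsub>PSL_group\<^esub> inv\<^bsub>PSL_group\<^esub> h)"
      unfolding conj_class_def by blast
    have "h \<otimes>\<^bsub>PSL_group\<^esub> g \<in> carrier PSL_group" using h r(2) by simp
    then show "x \<in> conj_class \<rho>" unfolding conj_class_def x using 1[OF h] by blast
  qed
qed

text \<open>
  Over the complex numbers \<open>g\<close> can be scaled to determinant 1; comparing determinants shows that the scalars
  \<open>c k\<close> are \<open>p\<close>-th roots of unity, hence trivial in PSL.
\<close>

lemma conj_class_eqI:
  fixes A B :: "'l::finite \<Rightarrow> complex^'p^'p"
  assumes A: "A \<in> SL_tuples" and B: "B \<in> SL_tuples" and g: "det g \<noteq> 0"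
    and AB: "\<And>k. g ** A k = mat (c k) ** (B k ** g)"
  shows "conj_class (proj_tuple A) = conj_class (proj_tuple B)"
proof -
  have "c k ^ CARD('p) = 1" for k
  proof -
    have "det (g ** A k) = det (mat (c k) ** (B k ** g))" by (simp add: AB)
    then show ?thesis using SL_tuplesD[OF A] SL_tuplesD[OF B] g by (simp add: det_mul det_mat)
  qed
  note c = this
  obtain d where d: "d ^ CARD('p) = 1 / det g"
    by (metis exists_complex_root zero_less_card_finite less_numeral_extra(3))
  then have d0: "d \<noteq> 0" using g by (auto simp: power_0_left)
  define g' where "g' = mat d ** g"
  have g': "det g' = 1" using d g by (simp add: g'_def det_mul det_mat)
  obtain h where h: "g' ** h = mat 1" "h ** g' = mat 1" "det h = 1" using g' by (rule SL_inverse)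
  have "proj_tuple B k = to_PSL g' \<otimes>\<^bsub>PSL_group\<^esub> proj_tuple A k \<otimes>\<^bsub>PSL_group\<^esub> inv\<^bsub>PSL_group\<^esub> (to_PSL g')" for k
  proof -
    have "g' ** A k = mat (c k) ** (B k ** g')"
      unfolding g'_def by (metis AB mat_pull matrix_mul_assoc)
    then have "g' ** A k ** h = mat (c k) ** (B k ** (g' ** h))"
      by (simp add: matrix_mul_assoc)
    then have "g' ** A k ** h = mat (c k) ** B k" using h by simp
    then have "to_PSL (B k) = to_PSL (g' ** A k ** h)" using c by (auto simp: to_PSL_eq_iff)
    then show ?thesis
      using SL_tuplesD[OF A] h g' by (simp add: proj_tuple_def inv_PSL[OF h(1)] mult_PSL det_mul)
  qed
  then show ?thesis
    using g' by (intro conj_class_eqI_PSL[OF range_proj_tuple[OF A], of "to_PSL g'"]) auto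
qed

lemma conj_class_eqD:
  fixes A B :: "'l::finite \<Rightarrow> complex^'p^'p"
  assumes A: "A \<in> SL_tuples" and B: "B \<in> SL_tuples"
    and eq: "conj_class (proj_tuple A) = conj_class (proj_tuple B)"
  shows "\<exists>g c. det g = 1 \<and> (\<forall>k. c k ^ CARD('p) = 1) \<and> (\<forall>k. g ** A k = mat (c k) ** (B k ** g))"
proof -
  have "proj_tuple B \<in> conj_class (proj_tuple A)"
    using conj_class_self[OF range_proj_tuple[OF B]] eq by simp
  then obtain x where x: "x \<in> carrier PSL_group"
    "proj_tuple B = (\<lambda>k. x \<otimes>\<^bsub>PSL_group\<^esub> proj_tuple A k \<otimes>\<^bsub>PSL_group\<^esub> inv\<^bsub>PSL_group\<^esub> x)"
    by (auto simp: conj_class_def)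
  obtain g where g: "det g = 1" "x = to_PSL g" using x(1) by (rule carrier_PSL_cases)
  obtain h where h: "g ** h = mat 1" "h ** g = mat 1" "det h = 1" using g(1) by (rule SL_inverse)
  have "\<exists>c. c ^ CARD('p) = 1 \<and> g ** A k = mat c ** (B k ** g)" for k
  proof -
    have "to_PSL (B k) = to_PSL (g ** A k ** h)"
      using fun_cong[OF x(2), of k] SL_tuplesD[OF A] g h
      by (simp add: proj_tuple_def inv_PSL[OF h(1)] mult_PSL det_mul)
    then obtain c where c: "c ^ CARD('p) = 1" "g ** A k ** h = mat c ** B k"
      by (auto simp: to_PSL_eq_iff)
    have "g ** A k = (g ** A k ** h) ** g" by (simp add: matrix_mul_assoc[symmetric] h)
    also have "\<dots> = mat c ** (B k ** g)" by (simp add: c matrix_mul_assoc)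
    finally show ?thesis using c by blast
  qed
  then have "\<exists>c. \<forall>k. c k ^ CARD('p) = 1 \<and> g ** A k = mat (c k) ** (B k ** g)" by (intro choice) blast
  with g show ?thesis by blast
qed

lemma poly_det: "poly (det P) x = det (\<chi> i j. poly (P $ i $ j) x)" for P :: "complex poly^'n^'n"
  by (simp add: det_def poly_sum poly_prod)

text \<open>
  If the polynomial \<open>det (x - M)\<close> were a constant \<open>k\<close>, then \<open>det (1 - t M) = k t^n\<close> for \<open>t \<noteq> 0\<close>; letting \<open>t\<close>
  tend to 0 gives \<open>1 = 0\<close>. So the characteristic polynomial has a root.
\<close>

lemma complex_matrix_eigenvector:
  fixes M :: "complex^'n^'n"
  obtains v c where "v \<noteq> 0" "M *v v = c *s v"
proof -
  define P :: "complex poly^'n^'n" where "P = (\<chi> i j. [:- (M $ i $ j), if i = j then 1 else 0:])"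
  define Q :: "complex poly^'n^'n" where "Q = (\<chi> i j. [:if i = j then 1 else 0, - (M $ i $ j):])"
  have PQ: "poly (det P) x = x ^ CARD('n) * poly (det Q) (1 / x)" if "x \<noteq> 0" for x
  proof -
    have "(\<chi> i j. poly (P $ i $ j) x) = mat x ** (\<chi> i j. poly (Q $ i $ j) (1 / x))"
      using that by (simp add: vec_eq_iff P_def Q_def field_simps)
    then show ?thesis by (simp add: poly_det det_mul det_mat)
  qed
  have "\<not> constant (poly (det P))"
  proof
    assume "constant (poly (det P))"
    then have "degree (det P) = 0" by (simp add: constant_degree)
    then obtain k where "det P = [:k:]" by (rule degree_eq_zeroE)
    then have k: "poly (det P) x = k" for x by simp
    have Qt: "poly (det Q) t = k * t ^ CARD('n)" if "t \<noteq> 0" for t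
    proof -
      have "poly (det P) (1 / t) = (1 / t) ^ CARD('n) * poly (det Q) (1 / (1 / t))"
        by (rule PQ) (use that in simp)
      then have "k = (1 / t) ^ CARD('n) * poly (det Q) t" unfolding k by simp
      then have "k * t ^ CARD('n) = (1 / t * t) ^ CARD('n) * poly (det Q) t"
        by (simp only: power_mult_distrib mult.assoc mult.commute mult.left_commute)
      then show ?thesis using that by simp
    qed
    have "(\<lambda>t. poly (det Q) t) \<midarrow>0\<rightarrow> poly (det Q) 0" using poly_isCont isCont_def by blast
    moreover have "eventually (\<lambda>t. poly (det Q) t = k * t ^ CARD('n)) (at 0)"
      using Qt by (auto simp: eventually_at_filter)
    ultimately have "((\<lambda>t. k * t ^ CARD('n)) \<longlongrightarrow> poly (det Q) 0) (at 0)"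
      by (rule Lim_transform_eventually)
    moreover have "((\<lambda>t. k * t ^ CARD('n)) \<longlongrightarrow> k * 0 ^ CARD('n)) (at (0::complex))"
      by (intro tendsto_intros)
    ultimately have "poly (det Q) 0 = k * 0 ^ CARD('n)"
      using tendsto_unique trivial_limit_at by blast
    moreover have "(\<chi> i j. poly (Q $ i $ j) 0) = mat 1" by (simp add: vec_eq_iff Q_def mat_def)
    then have "poly (det Q) 0 = 1" by (simp add: poly_det)
    ultimately show False by (simp add: power_0_left)
  qed
  then obtain c where c: "poly (det P) c = 0" using fundamental_theorem_of_algebra by blast
  define B where "B = mat c - M"
  have "(\<chi> i j. poly (P $ i $ j) c) = B" by (simp add: vec_eq_iff P_def B_def mat_def)
  then have "det B = 0" using c by (simp add: poly_det)
  then have "\<not> invertible B" by (simp add: invertible_det_nz)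
  then have "\<not> (\<forall>x. B *v x = 0 \<longrightarrow> x = 0)"
    using matrix_left_invertible_ker[of B] invertible_left_inverse[of B] by blast
  then obtain v where v: "v \<noteq> 0" "B *v v = 0" by blast
  then have "M *v v = c *s v"
    by (simp add: B_def matrix_vector_mult_diff_rdistrib mat_vector_mult)
  with v show ?thesis using that by blast
qed

text \<open>
  Schur's lemma: an eigenspace of \<open>M\<close> is stabilized by all \<open>A k\<close>.
\<close>

lemma commuting_irreducible_scalar:
  fixes A :: "'l::finite \<Rightarrow> complex^'p^'p"
  assumes irr: "irreducible_tuple A" and A: "A \<in> SL_tuples" and comm: "\<And>k. M ** A k = A k ** M"
  obtains c where "M = mat c"
proof -
  obtain v c where v: "v \<noteq> 0" "M *v v = c *s v"
    by (rule complex_matrix_eigenvector)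
  define W where "W = {w. M *v w = c *s w}"
  have W: "vec.subspace W"
    by (auto simp: vec.subspace_def W_def matrix_vector_right_distrib vec.scale_right_distrib
       vec.scale_left_commute vector_scalar_commute)
  have "(*v) (A k) ` W = W" for k
  proof -
    obtain h where h: "A k ** h = mat 1" "h ** A k = mat 1" using SL_tuplesD[OF A, of k] by (rule SL_inverse)
    have "h ** M = h ** M ** (A k ** h)" using h by simp
    also have "\<dots> = h ** A k ** M ** h" by (simp add: matrix_mul_assoc[symmetric] comm) (simp add: matrix_mul_assoc comm)
    finally have hM: "h ** M = M ** h" using h by simp
    have 1: "B *v w \<in> W" if "w \<in> W" "M ** B = B ** M" for B w
    proof -
      have "M *v (B *v w) = B *v (M *v w)" using that by (simp add: matrix_vector_mul_assoc)
      also have "\<dots> = c *s (B *v w)" using that by (simp add: W_def vector_scalar_commute)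
      finally show ?thesis by (simp add: W_def)
    qed
    show ?thesis
    proof (intro Set.set_eqI iffI)
      fix x assume x: "x \<in> W"
      have "x = A k *v (h *v x)" by (simp add: matrix_vector_mul_assoc h)
      then show "x \<in> (*v) (A k) ` W" using 1[OF x, of h] hM by auto
    qed (use 1 comm in auto)
  qed
  then have "W = {0} \<or> W = UNIV" using irr W unfolding irreducible_tuple_def by blast
  moreover have "v \<in> W" using v by (simp add: W_def)
  ultimately have "W = UNIV" using v by auto
  then have "M *v w = mat c *v w" for w by (auto simp: W_def mat_vector_mult)
  then have "M = mat c" by (simp add: matrix_eq)
  then show ?thesis by (rule that)
qed

text \<open>
  The relations \<open>M A\<^sub>k = \<omega>\<^sub>k A\<^sub>k M\<close> express that the class of \<open>M\<close> centralizes the representation in PSL.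
  Were all \<open>\<omega>\<^sub>k = 1\<close>, then \<open>M\<close> would be scalar and its class trivial.
\<close>

lemma bad_repsD:
  fixes A :: "'l::finite \<Rightarrow> complex^'p^'p"
  assumes p: "CARD('p) \<ge> 2" and A: "A \<in> SL_tuples" and bad: "proj_tuple A \<in> bad_reps"
  obtains M \<omega> k0 where "det M = 1" "\<And>k. M ** A k = mat (\<omega> k) ** (A k ** M)"
    "\<And>k. \<omega> k ^ CARD('p) = 1" "\<omega> k0 \<noteq> 1"
proof -
  interpret G: group "PSL_group :: (complex^'p^'p) set monoid" by (rule group_PSL_group)
  have irr: "irreducible_tuple A"
    using bad irreducible_reps_iff[OF p A]
    by (auto simp: bad_reps_def irreducible_reps_def bad_subgroup_def)
  let ?C = "centralizer PSL_group (rep_image (proj_tuple A))"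
  have sub: "rep_image (proj_tuple A) \<subseteq> carrier PSL_group"
    unfolding rep_image_def using G.generate_incl[OF range_proj_tuple[OF A]] .
  have "\<one>\<^bsub>PSL_group\<^esub> \<in> ?C" using sub by (auto simp: centralizer_def)
  moreover have "?C \<noteq> {\<one>\<^bsub>PSL_group\<^esub>}" using bad by (simp add: bad_reps_def bad_subgroup_def)
  ultimately obtain x where x: "x \<in> ?C" "x \<noteq> \<one>\<^bsub>PSL_group\<^esub>" by blast
  then have "x \<in> carrier PSL_group" by (simp add: centralizer_def)
  then obtain M where M: "det M = 1" "x = to_PSL M" by (rule carrier_PSL_cases)
  have "\<exists>c. c ^ CARD('p) = 1 \<and> M ** A k = mat c ** (A k ** M)" for k
  proof -
    have "proj_tuple A k \<in> rep_image (proj_tuple A)"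
      unfolding rep_image_def by (rule generate.incl) simp
    then have "x \<otimes>\<^bsub>PSL_group\<^esub> proj_tuple A k = proj_tuple A k \<otimes>\<^bsub>PSL_group\<^esub> x"
      using x(1) by (simp add: centralizer_def)
    then have "to_PSL (A k ** M) = to_PSL (M ** A k)"
      using M SL_tuplesD[OF A, of k] by (simp add: proj_tuple_def mult_PSL)
    then show ?thesis by (simp add: to_PSL_eq_iff)
  qed
  then obtain \<omega> where \<omega>: "\<And>k. \<omega> k ^ CARD('p) = 1 \<and> M ** A k = mat (\<omega> k) ** (A k ** M)" by metis
  have "\<exists>k0. \<omega> k0 \<noteq> 1"
  proof (rule ccontr)
    assume "\<nexists>k0. \<omega> k0 \<noteq> 1"
    then have "M ** A k = A k ** M" for k using \<omega>[of k] by simp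
    then obtain c where c: "M = mat c" using commuting_irreducible_scalar[OF irr A] by blast
    then have "c ^ CARD('p) = 1" using M(1) by (simp add: det_mat)
    moreover have "mat c = mat c ** (mat 1 :: complex^'p^'p)" by simp
    ultimately have "to_PSL (mat 1) = to_PSL M" unfolding c to_PSL_eq_iff by blast
    then show False using x(2) M(2) by (simp add: one_PSL)
  qed
  then obtain k0 where "\<omega> k0 \<noteq> 1" by blast
  with M(1) \<omega> show ?thesis by (intro that[of M \<omega> k0]) simp_all
qed

lemma bad_repsI:
  fixes A :: "'l::finite \<Rightarrow> complex^'p^'p"
  assumes p: "CARD('p) \<ge> 2" and A: "A \<in> SL_tuples" and irr: "irreducible_tuple A"
    and M: "det M = 1" "\<And>k. M ** A k = mat (\<omega> k) ** (A k ** M)" and k0: "\<omega> k0 \<noteq> 1"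
  shows "proj_tuple A \<in> bad_reps"
proof -
  interpret G: group "PSL_group :: (complex^'p^'p) set monoid" by (rule group_PSL_group)
  have "\<omega> k ^ CARD('p) = 1" for k
  proof -
    have "det (M ** A k) = det (mat (\<omega> k) ** (A k ** M))" by (simp add: M(2))
    then show ?thesis using SL_tuplesD[OF A] M(1) by (simp add: det_mul det_mat)
  qed
  note \<omega> = this
  let ?x = "to_PSL M"
  have xc: "?x \<in> carrier PSL_group" using M(1) by simp
  have r: "range (proj_tuple A) \<subseteq> carrier PSL_group" by (rule range_proj_tuple[OF A])
  have comm: "?x \<otimes>\<^bsub>PSL_group\<^esub> proj_tuple A k = proj_tuple A k \<otimes>\<^bsub>PSL_group\<^esub> ?x" for k
  proof -
    have "to_PSL (A k ** M) = to_PSL (M ** A k)"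
      unfolding to_PSL_eq_iff using \<omega>[of k] M(2)[of k] by blast
    then show ?thesis using M(1) SL_tuplesD[OF A, of k] by (simp add: proj_tuple_def mult_PSL)
  qed
  have sub: "subgroup (centralizer PSL_group {?x}) PSL_group"
  proof
    fix a b assume "a \<in> centralizer PSL_group {?x}" "b \<in> centralizer PSL_group {?x}"
    then have a: "a \<in> carrier PSL_group" "a \<otimes>\<^bsub>PSL_group\<^esub> ?x = ?x \<otimes>\<^bsub>PSL_group\<^esub> a"
      and b: "b \<in> carrier PSL_group" "b \<otimes>\<^bsub>PSL_group\<^esub> ?x = ?x \<otimes>\<^bsub>PSL_group\<^esub> b"
      by (simp_all add: centralizer_def)
    have "a \<otimes>\<^bsub>PSL_group\<^esub> b \<otimes>\<^bsub>PSL_group\<^esub> ?x = a \<otimes>\<^bsub>PSL_group\<^esub> ?x \<otimes>\<^bsub>PSL_group\<^esub> b"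
      using a(1) b(1) xc by (simp add: G.m_assoc b(2))
    also have "\<dots> = ?x \<otimes>\<^bsub>PSL_group\<^esub> (a \<otimes>\<^bsub>PSL_group\<^esub> b)"
      using a b xc by (simp add: a(2) G.m_assoc[symmetric])
    finally show "a \<otimes>\<^bsub>PSL_group\<^esub> b \<in> centralizer PSL_group {?x}"
      using a b by (simp add: centralizer_def)
  next
    fix a assume "a \<in> centralizer PSL_group {?x}"
    then have a: "a \<in> carrier PSL_group" "a \<otimes>\<^bsub>PSL_group\<^esub> ?x = ?x \<otimes>\<^bsub>PSL_group\<^esub> a"
      by (simp_all add: centralizer_def)
    have "inv\<^bsub>PSL_group\<^esub> a \<otimes>\<^bsub>PSL_group\<^esub> ?x =
        inv\<^bsub>PSL_group\<^esub> a \<otimes>\<^bsub>PSL_group\<^esub> (?x \<otimes>\<^bsub>PSL_group\<^esub> a) \<otimes>\<^bsub>PSL_group\<^esub> inv\<^bsub>PSL_group\<^esub> a"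
      using a(1) xc by (simp add: G.m_assoc)
    also have "\<dots> = inv\<^bsub>PSL_group\<^esub> a \<otimes>\<^bsub>PSL_group\<^esub> (a \<otimes>\<^bsub>PSL_group\<^esub> ?x) \<otimes>\<^bsub>PSL_group\<^esub> inv\<^bsub>PSL_group\<^esub> a"
      by (simp only: a(2))
    also have "\<dots> = ?x \<otimes>\<^bsub>PSL_group\<^esub> inv\<^bsub>PSL_group\<^esub> a"
      using a(1) xc by (simp add: G.m_assoc[symmetric])
    finally show "inv\<^bsub>PSL_group\<^esub> a \<in> centralizer PSL_group {?x}"
      using a by (simp add: centralizer_def)
  qed (use xc in \<open>auto simp: centralizer_def\<close>)
  have "rep_image (proj_tuple A) \<subseteq> centralizer PSL_group {?x}"
    unfolding rep_image_def
  proof (rule G.generate_subgroup_incl[OF _ sub])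
    show "range (proj_tuple A) \<subseteq> centralizer PSL_group {?x}"
    proof (rule image_subsetI)
      fix k
      have "proj_tuple A k \<in> carrier PSL_group" using r by auto
      then show "proj_tuple A k \<in> centralizer PSL_group {?x}"
        by (simp add: centralizer_def comm)
    qed
  qed
  then have "?x \<in> centralizer PSL_group (rep_image (proj_tuple A))"
    using xc by (fastforce simp: centralizer_def)
  moreover have "?x \<noteq> \<one>\<^bsub>PSL_group\<^esub>"
  proof
    assume "?x = \<one>\<^bsub>PSL_group\<^esub>"
    then have "to_PSL (mat 1) = to_PSL M" by (simp add: one_PSL)
    then obtain c where c: "M = mat c" "c ^ CARD('p) = 1" by (auto simp: to_PSL_eq_iff)
    then have c0: "c \<noteq> 0" by (auto simp: power_0_left)
    have "mat c ** A k0 = mat c ** (mat (\<omega> k0) ** A k0)"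
      using M(2)[of k0] unfolding c(1) by (metis mat_central mat_pull)
    then have "A k0 = mat (\<omega> k0) ** A k0" using c0 by (simp add: mat_mult_cancel)
    then have "mat 1 ** A k0 = mat (\<omega> k0) ** A k0" by simp
    then have "(1 - \<omega> k0) * A k0 $ i $ j = 0" for i j
      by (metis mat_mult_entry mult_1 right_minus_eq left_diff_distrib)
    then have "A k0 = 0" using k0 by (simp add: vec_eq_iff)
    then have "A k0 = mat 0 ** A k0" by (simp add: vec_eq_iff)
    then have "det (A k0) = 0" using det_mat_mult[of 0 "A k0"] by (simp add: power_0_left)
    then show False using SL_tuplesD[OF A, of k0] by simp
  qed
  moreover have "proj_tuple A \<in> irreducible_reps" using irreducible_reps_iff[OF p A] irr by simp
  ultimately show ?thesis
    using r by (auto simp: bad_reps_def irreducible_reps_def bad_subgroup_def)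
qed

lemma bad_imp_irreducible: "bad_reps \<subseteq> irreducible_reps"
  by (auto simp: bad_reps_def irreducible_reps_def bad_subgroup_def)

section \<open>Monomial normal form\<close>

definition diag :: "('n \<Rightarrow> complex) \<Rightarrow> complex^'n^'n" where
  "diag s = (\<chi> i j. if i = j then s i else 0)"

lemma diag_mult_entry [simp]: "(diag s ** A) $ i $ j = s i * A $ i $ j"
  by (simp add: matrix_matrix_mult_def diag_def if_distrib[of "\<lambda>x. x * _"] cong: if_cong)

lemma mult_diag_entry [simp]: "(A ** diag s) $ i $ j = A $ i $ j * s j"
  by (simp add: matrix_matrix_mult_def diag_def if_distrib[of "\<lambda>x. _ * x"] cong: if_cong)

lemma diag_vector_entry [simp]: "(diag s *v x) $ i = s i * x $ i"
  by (simp add: matrix_vector_mult_def diag_def if_distrib[of "\<lambda>x. x * _"] cong: if_cong)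

lemma det_diag: "det (diag s) = (\<Prod>i\<in>UNIV. s i)"
  by (subst det_diagonal) (simp_all add: diag_def)

lemma diag_const: "diag (\<lambda>_. c) = mat c"
  by (simp add: diag_def mat_def)

lemma diag_scale: "diag (\<lambda>i. c * s i) = mat c ** diag s"
  by (simp add: vec_eq_iff del: mult_diag_entry) (simp add: diag_def)

lemma power_mod_root:
  fixes w :: complex
  assumes "w ^ p = 1"
  shows "w ^ (n mod p) = w ^ n"
proof -
  have "w ^ n = w ^ (p * (n div p) + n mod p)" by simp
  also have "\<dots> = (w ^ p) ^ (n div p) * w ^ (n mod p)" by (simp only: power_add power_mult)
  finally show ?thesis using assms by simp
qed

lemma root_power_eq_1_iff:
  fixes w :: complex
  assumes "prime p" "w ^ p = 1" "w \<noteq> 1"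
  shows "w ^ n = 1 \<longleftrightarrow> p dvd n"
proof
  assume n: "w ^ n = 1"
  show "p dvd n"
  proof (rule ccontr)
    assume "\<not> p dvd n"
    then have "coprime n p" using prime_imp_coprime[OF assms(1)] coprime_commute by blast
    then obtain x where x: "[n * x = Suc 0] (mod p)" using cong_solve_coprime_nat by blast
    have "1 < p" using assms(1) by (rule prime_gt_1_nat)
    then have "(n * x) mod p = 1" using x by (simp add: cong_def)
    then have "w ^ (n * x) = w" using power_mod_root[OF assms(2), of "n * x"] by simp
    then show False using n assms(3) by (simp add: power_mult)
  qed
next
  assume "p dvd n"
  then show "w ^ n = 1" using assms(2) by (auto simp: power_mult)
qed

lemma root_power_inj:
  fixes w :: complex
  assumes "prime p" "w ^ p = 1" "w \<noteq> 1" "a < p" "b < p" "w ^ a = w ^ b"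
  shows "a = b"
proof -
  have *: "a = b" if "a \<le> b" "w ^ a = w ^ b" "a < p" "b < p" for a b
  proof -
    have "w \<noteq> 0" using assms prime_gt_0_nat by (metis power_0_left zero_neq_one neq0_conv)
    then have "w ^ (b - a) = 1" using that by (simp add: power_diff)
    then have "p dvd b - a" using root_power_eq_1_iff[OF assms(1-3)] by simp
    moreover have "b - a < p" using that by simp
    ultimately have "b - a = 0" using nat_dvd_not_less by blast
    then show ?thesis using that by simp
  qed
  show ?thesis
  proof (cases "a \<le> b")
    case True
    then show ?thesis using * assms(4-6) by simp
  next
    case False
    then have "b = a" using * assms(4-6) by simp
    then show ?thesis by simp
  qed
qed

text \<open>
  The \<open>p\<close> distinct powers of \<open>w\<close> exhaust the \<open>p\<close> roots of \<open>x^p = 1\<close>.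
\<close>

lemma root_as_power:
  fixes w z :: complex
  assumes "prime p" "w ^ p = 1" "w \<noteq> 1" "z ^ p = 1"
  obtains n where "n < p" "z = w ^ n"
proof -
  have inj: "inj_on (\<lambda>n. w ^ n) {..<p}"
    using root_power_inj[OF assms(1-3)] by (auto simp: inj_on_def)
  have sub: "(\<lambda>n. w ^ n) ` {..<p} \<subseteq> {z. z ^ p = 1}"
  proof (intro image_subsetI CollectI)
    show "(w ^ n) ^ p = 1" for n using assms(2) by (metis power_commutes power_mult mult.commute power_one)
  qed
  have "card {z::complex. z ^ p = 1} = p"
    using card_roots_unity_eq[of p] prime_gt_1_nat[OF assms(1)] by simp
  then have "(\<lambda>n. w ^ n) ` {..<p} = {z. z ^ p = 1}"
    using card_image[OF inj] sub by (intro card_subset_eq finite_roots_unity) (use prime_gt_1_nat[OF assms(1)] in auto)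
  then have "z \<in> (\<lambda>n. w ^ n) ` {..<p}" using assms(4) by simp
  then show ?thesis using that by auto
qed

text \<open>
  A non-zero vector of \<open>W\<close> with minimal support is a multiple of a coordinate vector: if two of its
  coordinates were non-zero, a diagonal matrix separating them, minus a scalar, would cancel one of them
  and keep the other.
\<close>

lemma subspace_contains_axis:
  fixes W :: "(complex^'n) set"
  assumes W: "vec.subspace W" "W \<noteq> {0}"
    and sep: "\<And>i j. i \<noteq> j \<Longrightarrow> \<exists>t. t i \<noteq> t j \<and> (\<forall>x\<in>W. diag t *v x \<in> W)"
  obtains i where "axis i 1 \<in> W"
proof -
  let ?supp = "\<lambda>x::complex^'n. {i. x $ i \<noteq> 0}"
  have "0 \<in> W" using vec.subspace_0[OF W(1)] .
  then obtain x0 where "x0 \<in> W \<and> x0 \<noteq> 0" using W(2) by auto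
  then obtain x where x: "x \<in> W" "x \<noteq> 0"
    and min: "\<And>y. y \<in> W \<Longrightarrow> y \<noteq> 0 \<Longrightarrow> card (?supp x) \<le> card (?supp y)"
    using ex_has_least_nat[of "\<lambda>x. x \<in> W \<and> x \<noteq> 0" x0 "\<lambda>x. card (?supp x)"] by blast
  obtain i where i: "x $ i \<noteq> 0" using x(2) by (auto simp: vec_eq_iff)
  have "x $ j = 0" if "j \<noteq> i" for j
  proof (rule ccontr)
    assume j: "x $ j \<noteq> 0"
    obtain t where t: "t i \<noteq> t j" "\<And>x. x \<in> W \<Longrightarrow> diag t *v x \<in> W"
      using sep[of i j] \<open>j \<noteq> i\<close> by blast
    define y where "y = diag t *v x - t i *s x"
    have y: "y $ k = (t k - t i) * x $ k" for k by (simp add: y_def algebra_simps)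
    have "y \<in> W" unfolding y_def
      by (intro vec.subspace_diff[OF W(1)] t(2) vec.subspace_scale[OF W(1)] x(1))
    moreover have "y \<noteq> 0"
    proof -
      have "y $ j \<noteq> 0" using y t(1) j by auto
      then show ?thesis by auto
    qed
    ultimately have "card (?supp x) \<le> card (?supp y)" by (rule min)
    moreover have "?supp y \<subset> ?supp x"
    proof
      show "?supp y \<subseteq> ?supp x" by (auto simp: y)
      have "i \<in> ?supp x" "i \<notin> ?supp y" using i by (auto simp: y)
      then show "?supp y \<noteq> ?supp x" by blast
    qed
    then have "card (?supp y) < card (?supp x)" by (intro psubset_card_mono) auto
    ultimately show False by simp
  qed
  then have "x = x $ i *s axis i 1" by (auto simp: vec_eq_iff axis_def)
  then have "axis i 1 = inverse (x $ i) *s x" using i by (metis vec.scale_scale left_inverse vec.scale_one)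
  then have "axis i 1 \<in> W" using vec.subspace_scale[OF W(1) x(1)] by simp
  then show ?thesis by (rule that)
qed

locale cyclic_index =
  fixes ix :: "'p::finite \<Rightarrow> nat"
  assumes ix_bij: "bij_betw ix UNIV {..<CARD('p)}" and prime: "prime CARD('p)"
begin

definition pos :: "nat \<Rightarrow> 'p" where "pos n = inv_into UNIV ix (n mod CARD('p))"

lemma p_gt_1: "1 < CARD('p)" using prime by (rule prime_gt_1_nat)

lemma ix_less [simp]: "ix i < CARD('p)"
  using ix_bij by (auto simp: bij_betw_def)

lemma ix_pos [simp]: "ix (pos n) = n mod CARD('p)"
proof -
  have "n mod CARD('p) \<in> ix ` UNIV" using ix_bij p_gt_1 by (simp add: bij_betw_def)
  then show ?thesis unfolding pos_def by (rule f_inv_into_f)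
qed

lemma ix_eq_iff: "ix i = ix j \<longleftrightarrow> i = j"
  using ix_bij by (auto simp: bij_betw_def inj_on_def)

lemma pos_ix [simp]: "pos (ix i) = i"
  by (simp add: ix_eq_iff[symmetric])

lemma pos_eq_iff: "pos m = pos n \<longleftrightarrow> m mod CARD('p) = n mod CARD('p)"
  by (simp add: ix_eq_iff[symmetric])

lemma pos_add_mod [simp]: "pos (m mod CARD('p) + n) = pos (m + n)" "pos (m + n mod CARD('p)) = pos (m + n)"
  by (simp_all add: pos_eq_iff mod_simps)

definition shiftmat :: "nat \<Rightarrow> complex^'p^'p" where
  "shiftmat e = (\<chi> i j. if i = pos (ix j + e) then 1 else 0)"

lemma mult_shiftmat_entry: "(A ** shiftmat e) $ i $ j = A $ i $ pos (ix j + e)"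
  by (simp add: matrix_matrix_mult_def shiftmat_def if_distrib[of "\<lambda>x. _ * x"] cong: if_cong)

lemma shiftmat_add: "shiftmat e ** shiftmat f = shiftmat (e + f)"
  by (simp add: vec_eq_iff mult_shiftmat_entry) (simp add: shiftmat_def add.assoc add.commute[of f])

lemma shiftmat_p: "shiftmat (CARD('p) * n) = mat 1"
proof -
  have "pos (ix j + CARD('p) * n) = j" for j
  proof -
    have "(ix j + CARD('p) * n) mod CARD('p) = ix j mod CARD('p)" by simp
    then have "pos (ix j + CARD('p) * n) = pos (ix j)" by (simp only: pos_eq_iff)
    then show ?thesis by simp
  qed
  then show ?thesis by (simp add: shiftmat_def mat_def)
qed

lemma shiftmat_axis: "shiftmat e *v axis j 1 = axis (pos (ix j + e)) 1"
  by (simp add: vec_eq_iff matrix_vector_mult_def shiftmat_def axis_def if_distrib[of "\<lambda>x. _ * x"] cong: if_cong)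

lemma det_shiftmat_nz: "det (shiftmat e) \<noteq> 0"
proof -
  have "e + (CARD('p) * e - e) = CARD('p) * e" using p_gt_1 by simp
  then have "shiftmat e ** shiftmat (CARD('p) * e - e) = mat 1"
    by (simp only: shiftmat_add shiftmat_p)
  then have "det (shiftmat e) * det (shiftmat (CARD('p) * e - e)) = 1" by (metis det_mul det_I)
  then show ?thesis by auto
qed

definition c0 :: complex where "c0 = (SOME c. c ^ CARD('p) * det (shiftmat 1) = 1)"

lemma c0: "c0 ^ CARD('p) * det (shiftmat 1) = 1"
proof -
  obtain c where "1 / det (shiftmat 1) = c ^ CARD('p)"
    using exists_complex_root[of "CARD('p)" "1 / det (shiftmat 1)"] p_gt_1 by (metis not_one_less_zero)
  then have "c ^ CARD('p) * det (shiftmat 1) = 1" using det_shiftmat_nz by (simp add: field_simps)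
  then show ?thesis unfolding c0_def by (rule someI)
qed

lemma c0_nz: "c0 \<noteq> 0"
  using c0 p_gt_1 by (auto simp: power_0_left)

text \<open>
  The powers of the cyclic permutation matrix, scaled to determinant 1.
\<close>

definition cyc :: "nat \<Rightarrow> complex^'p^'p" where "cyc e = mat (c0 ^ e) ** shiftmat e"

lemma cyc_add: "cyc e ** cyc f = cyc (e + f)"
proof -
  have "cyc e ** cyc f = mat (c0 ^ e) ** (mat (c0 ^ f) ** (shiftmat e ** shiftmat f))"
    unfolding cyc_def by (metis mat_pull matrix_mul_assoc)
  then show ?thesis by (simp add: shiftmat_add cyc_def mat_mult_mat_assoc power_add)
qed

lemma cyc_p: "cyc (CARD('p) * n) = mat (c0 ^ (CARD('p) * n))"
  by (simp add: cyc_def shiftmat_p)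

lemma cyc_0 [simp]: "cyc 0 = mat 1"
  using cyc_p[of 0] by simp

lemma det_cyc [simp]: "det (cyc e) = 1"
proof (induction e)
  case (Suc e)
  have "cyc (Suc e) = cyc 1 ** cyc e" by (simp add: cyc_add)
  moreover have "det (cyc 1) = 1" using c0 by (simp add: cyc_def det_mul det_mat)
  ultimately show ?case using Suc by (simp add: det_mul)
qed simp

lemma cyc_entry: "cyc e $ i $ j = (if i = pos (ix j + e) then c0 ^ e else 0)"
  by (simp add: cyc_def) (simp add: shiftmat_def)

text \<open>
  Conjugation by the cyclic matrix shifts the entries of a diagonal matrix.
\<close>

lemma diag_cyc: "diag s ** cyc e = cyc e ** diag (\<lambda>j. s (pos (ix j + e)))"
  by (simp add: vec_eq_iff cyc_entry)

lemma cyc_axis: "cyc e *v axis j 1 = c0 ^ e *s axis (pos (ix j + e)) 1"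
  by (simp add: cyc_def matrix_vector_mul_assoc[symmetric] shiftmat_axis mat_vector_mult)

lemma root_shift: "w ^ CARD('p) = 1 \<Longrightarrow> w ^ ix (pos n) = (w::complex) ^ n"
  by (simp add: power_mod_root)

lemma root_diag_cyc:
  assumes "w ^ CARD('p) = 1"
  shows "diag (\<lambda>i. w ^ ix i) ** cyc e = mat (w ^ e) ** (cyc e ** diag (\<lambda>i. w ^ ix i))"
  unfolding diag_cyc root_shift[OF assms]
  by (simp add: vec_eq_iff power_add)

definition monomial :: "('l \<Rightarrow> nat) \<Rightarrow> ('l \<Rightarrow> 'p \<Rightarrow> complex) \<Rightarrow> 'l \<Rightarrow> complex^'p^'p" where
  "monomial e s k = diag (s k) ** cyc (e k)"

lemma monomial_SL: "(\<And>k. (\<Prod>i\<in>UNIV. s k i) = 1) \<Longrightarrow> monomial e s \<in> SL_tuples"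
  by (intro SL_tuplesI) (simp add: monomial_def det_mul det_diag)

lemma root_diag_monomial:
  assumes "w ^ CARD('p) = 1"
  shows "diag (\<lambda>i. w ^ ix i) ** monomial e s k = mat (w ^ e k) ** (monomial e s k ** diag (\<lambda>i. w ^ ix i))"
proof -
  have dd: "diag (\<lambda>i. w ^ ix i) ** diag (s k) = diag (s k) ** diag (\<lambda>i. w ^ ix i)"
    by (simp add: vec_eq_iff) (simp add: diag_def)
  have "diag (\<lambda>i. w ^ ix i) ** monomial e s k = diag (s k) ** (diag (\<lambda>i. w ^ ix i) ** cyc (e k))"
    by (simp add: monomial_def matrix_mul_assoc dd)
  then show ?thesis by (simp only: root_diag_cyc[OF assms] mat_pull monomial_def matrix_mul_assoc[symmetric])
qed

lemma bad_repsI':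
  fixes A :: "'l::finite \<Rightarrow> complex^'p^'p"
  assumes A: "A \<in> SL_tuples" and irr: "irreducible_tuple A"
    and M: "det M \<noteq> 0" "\<And>k. M ** A k = mat (\<omega> k) ** (A k ** M)" and k0: "\<omega> k0 \<noteq> 1"
  shows "proj_tuple A \<in> bad_reps"
proof -
  obtain d where d: "1 / det M = d ^ CARD('p)"
    using exists_complex_root[of "CARD('p)" "1 / det M"] p_gt_1 by (metis not_one_less_zero)
  have "det (mat d ** M) = 1" using d M(1) by (simp add: det_mul det_mat d[symmetric])
  moreover have "(mat d ** M) ** A k = mat (\<omega> k) ** (A k ** (mat d ** M))" for k
    by (metis M(2) mat_pull matrix_mul_assoc)
  ultimately show ?thesis
    using p_gt_1 by (intro bad_repsI[where M = "mat d ** M" and \<omega> = \<omega>, OF _ A irr _ _ k0]) simp_all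
qed

lemma zeta: "cis (2 * pi / CARD('p)) ^ CARD('p) = 1" "cis (2 * pi / CARD('p)) \<noteq> 1"
proof -
  show "cis (2 * pi / CARD('p)) ^ CARD('p) = 1"
    using p_gt_1 by (simp only: Complex.DeMoivre) simp
  have "inj_on (\<lambda>j. exp (2 * of_real pi * \<i> * of_nat j / of_nat CARD('p))) {..<CARD('p)}"
    using bij_betw_roots_unity[of "CARD('p)"] p_gt_1 by (simp add: bij_betw_def)
  from inj_onD[OF this, of 1 0]
  have "exp (2 * of_real pi * \<i> * of_nat 1 / of_nat CARD('p)) \<noteq> exp (2 * of_real pi * \<i> * of_nat 0 / of_nat CARD('p))"
    using p_gt_1 by auto
  then show "cis (2 * pi / CARD('p)) \<noteq> 1" by (simp add: cis_conv_exp mult_ac)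
qed

lemma monomial_bad:
  fixes e :: "'l::finite \<Rightarrow> nat"
  assumes s: "\<And>k. (\<Prod>i\<in>UNIV. s k i) = 1" and irr: "irreducible_tuple (monomial e s)" and k0: "e k0 = 1"
  shows "proj_tuple (monomial e s) \<in> bad_reps"
proof (rule bad_repsI'[OF monomial_SL[OF s] irr _ root_diag_monomial[OF zeta(1)]])
  show "det (diag (\<lambda>i::'p. cis (2 * pi / CARD('p)) ^ ix i)) \<noteq> 0" by (simp add: det_diag)
  show "cis (2 * pi / CARD('p)) ^ e k0 \<noteq> 1" using k0 zeta(2) by simp
qed

text \<open>
  The differences \<open>d\<close> with \<open>s (n + d) = s n\<close> for all \<open>n\<close> form a subgroup of the integers modulo the
  prime \<open>p\<close>, so a function \<open>s\<close> with a non-zero period is constant.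
\<close>

lemma shift_separates:
  assumes ij: "i \<noteq> j" and nc: "s a \<noteq> s (b::'p)"
  shows "\<exists>m. s (pos (ix i + m)) \<noteq> s (pos (ix j + m))"
proof (rule ccontr)
  assume "\<not> ?thesis"
  then have eq: "s (pos (ix i + m)) = s (pos (ix j + m))" for m by blast
  define d where "d = ix j + (CARD('p) - ix i)"
  have step: "s (pos n) = s (pos (n + d))" for n
  proof -
    have il: "ix i < CARD('p)" by simp
    have "pos (ix i + (n + (CARD('p) - ix i))) = pos n" unfolding pos_eq_iff using il
      by (metis add.left_commute le_add_diff_inverse less_imp_le mod_add_self2)
    moreover have "pos (ix j + (n + (CARD('p) - ix i))) = pos (n + d)" by (simp add: d_def add_ac)
    ultimately show ?thesis using eq[of "n + (CARD('p) - ix i)"] by simp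
  qed
  have steps: "s (pos n) = s (pos (n + t * d))" for n t
  proof (induction t)
    case (Suc t)
    then show ?case using step[of "n + t * d"] by (simp add: add_ac)
  qed simp
  have "\<not> CARD('p) dvd d"
  proof
    assume "CARD('p) dvd d"
    then have "d mod CARD('p) = 0" by simp
    then have "(d + ix i) mod CARD('p) = ix i" by (metis ix_less mod_add_left_eq add_0 mod_less)
    moreover have "d + ix i = ix j + CARD('p)" using ix_less[of i] unfolding d_def by linarith
    ultimately have "ix i = ix j" by simp
    then show False using ij by (simp add: ix_eq_iff)
  qed
  then have "coprime d CARD('p)" using prime_imp_coprime[OF prime] coprime_commute by blast
  then obtain x where x: "[d * x = Suc 0] (mod CARD('p))" using cong_solve_coprime_nat by blast
  have "s (pos 0) = s (pos (0 + (x * ix c) * d))" for c by (rule steps)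
  moreover have "pos (0 + (x * ix c) * d) = c" for c
  proof -
    have "[(d * x) * ix c = Suc 0 * ix c] (mod CARD('p))" using x by (rule cong_scalar_right)
    then have "((x * ix c) * d) mod CARD('p) = ix c mod CARD('p)" by (simp add: cong_def mult_ac)
    then show ?thesis by (metis add_0 pos_eq_iff pos_ix)
  qed
  ultimately have "s c = s (pos 0)" for c by metis
  then show False using nc by metis
qed

text \<open>
  A stable subspace is also stable under all cyclic shifts of the non-constant diagonal. Some shift
  separates any two given indices, so the subspace contains a coordinate vector, and the cyclic
  matrix moves this vector to all the others.
\<close>

lemma monomial_irreducible:
  fixes e :: "'l::finite \<Rightarrow> nat"
  assumes k0: "e k0 = 1" "s k0 = (\<lambda>_. 1)" and k1: "s k1 a \<noteq> s k1 b"
  shows "irreducible_tuple (monomial e s)"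
  unfolding irreducible_tuple_def
proof (intro allI impI, elim conjE)
  fix W assume W: "vec.subspace W" and inv: "\<forall>k. (*v) (monomial e s k) ` W = W"
  have c1: "(*v) (cyc 1) ` W = W"
    using inv[rule_format, of k0] by (simp add: monomial_def k0 diag_const)
  have cm: "(*v) (cyc m) ` W = W" for m
  proof (induction m)
    case (Suc m)
    have "(*v) (cyc (Suc m)) ` W = (*v) (cyc 1) ` ((*v) (cyc m) ` W)"
      by (simp add: image_image matrix_vector_mul_assoc cyc_add)
    then show ?case using Suc c1 by simp
  qed simp
  have "W = (*v) (diag (s k1)) ` ((*v) (cyc (e k1)) ` W)"
    using inv[rule_format, of k1] by (simp add: image_image matrix_vector_mul_assoc monomial_def)
  then have dW: "(*v) (diag (s k1)) ` W = W" by (simp add: cm)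
  have sh: "diag (\<lambda>j. s k1 (pos (ix j + m))) *v x \<in> W" if x: "x \<in> W" for m x
  proof -
    have "diag (s k1) *v (cyc m *v x) \<in> W" using cm[of m] dW x by blast
    then have "cyc m *v (diag (\<lambda>j. s k1 (pos (ix j + m))) *v x) \<in> (*v) (cyc m) ` W"
      by (simp add: matrix_vector_mul_assoc diag_cyc cm)
    then obtain y where y: "y \<in> W" "cyc m *v (diag (\<lambda>j. s k1 (pos (ix j + m))) *v x) = cyc m *v y" by blast
    obtain h where "h ** cyc m = mat 1" using det_cyc[of m] by (rule SL_inverse)
    then have "diag (\<lambda>j. s k1 (pos (ix j + m))) *v x = y"
      using arg_cong[OF y(2), of "(*v) h"] by (simp add: matrix_vector_mul_assoc matrix_mul_assoc)
    then show ?thesis using y(1) by simp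
  qed
  show "W = {0} \<or> W = UNIV"
  proof (rule disjCI)
    assume nW: "W \<noteq> UNIV"
    show "W = {0}"
    proof (rule ccontr)
      assume "W \<noteq> {0}"
      then obtain i where i: "axis i 1 \<in> W"
      proof (rule subspace_contains_axis[OF W])
        fix i j :: 'p assume "i \<noteq> j"
        then obtain m where "s k1 (pos (ix i + m)) \<noteq> s k1 (pos (ix j + m))"
          using shift_separates[OF _ k1] by blast
        then show "\<exists>t. t i \<noteq> t j \<and> (\<forall>x\<in>W. diag t *v x \<in> W)"
          using sh by (intro exI[of _ "\<lambda>j. s k1 (pos (ix j + m))"]) auto
      qed
      have "axis j 1 \<in> W" for j
      proof -
        define m where "m = ix j + (CARD('p) - ix i)"
        have "ix i + m = ix j + CARD('p)" using ix_less[of i] unfolding m_def by linarith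
        then have "(ix i + m) mod CARD('p) = ix j mod CARD('p)" by simp
        then have "pos (ix i + m) = j" by (metis pos_eq_iff pos_ix)
        then have "c0 ^ m *s axis j 1 \<in> W" using cm[of m] i cyc_axis[of m i] by force
        from vec.subspace_scale[OF W this, of "inverse (c0 ^ m)"] show ?thesis
          using c0_nz by (simp add: vec.scale_scale)
      qed
      then show False using subspace_all_axes[OF W] nW by blast
    qed
  qed
qed

text \<open>
  If all diagonals are scalar, the vectors with equal coordinates form a stable line.
\<close>

lemma monomial_irreducible_nonscalar:
  fixes e :: "'l::finite \<Rightarrow> nat"
  assumes s: "\<And>k. (\<Prod>i\<in>UNIV. s k i) = 1" and irr: "irreducible_tuple (monomial e s)"
  obtains k i j where "s k i \<noteq> s k j"
proof (rule ccontr)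
  assume "\<not> thesis"
  then have const: "s k i = s k j" for k i j using that by blast
  define W where "W = {x::complex^'p. \<forall>i j. x $ i = x $ j}"
  have W: "vec.subspace W" by (auto simp: vec.subspace_def W_def) metis+
  have act: "monomial e s k *v x = (s k (pos 0) * c0 ^ e k) *s x" if "x \<in> W" for k x
  proof -
    have "(cyc m *v x) $ i = c0 ^ m * x $ i" for i m
    proof -
      have "(cyc m *v x) $ i = (\<Sum>j\<in>UNIV. (if i = pos (ix j + m) then c0 ^ m else 0) * x $ i)"
        unfolding matrix_vector_mult_def vec_lambda_beta cyc_entry
        by (rule sum.cong) (use that in \<open>auto simp: W_def\<close>)
      also have "\<dots> = (\<Sum>j\<in>UNIV. if j = pos (ix i + (CARD('p) * m - m)) then c0 ^ m * x $ i else 0)"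
      proof (rule sum.cong, simp)
        fix j
        have mm: "m + (CARD('p) * m - m) = CARD('p) * m" using p_gt_1 by simp
        have "i = pos (ix j + m) \<longleftrightarrow> j = pos (ix i + (CARD('p) * m - m))"
        proof
          assume "i = pos (ix j + m)"
          then have "pos (ix i + (CARD('p) * m - m)) = pos ((ix j + m) + (CARD('p) * m - m))"
            by (simp only: ix_pos pos_add_mod)
          also have "(ix j + m) + (CARD('p) * m - m) = ix j + (m + (CARD('p) * m - m))" by (rule add.assoc)
          finally have "pos (ix i + (CARD('p) * m - m)) = pos (ix j + (m + (CARD('p) * m - m)))" .
          also have "\<dots> = pos (ix j)" unfolding mm pos_eq_iff by simp
          finally show "j = pos (ix i + (CARD('p) * m - m))" by simp
        next
          assume "j = pos (ix i + (CARD('p) * m - m))"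
          then have "pos (ix j + m) = pos ((ix i + (CARD('p) * m - m)) + m)"
            by (simp only: ix_pos pos_add_mod)
          also have "(ix i + (CARD('p) * m - m)) + m = ix i + (m + (CARD('p) * m - m))" by linarith
          finally have "pos (ix j + m) = pos (ix i + (m + (CARD('p) * m - m)))" .
          also have "\<dots> = pos (ix i)" unfolding mm pos_eq_iff by simp
          finally show "i = pos (ix j + m)" by simp
        qed
        then show "(if i = pos (ix j + m) then c0 ^ m else 0) * x $ i =
            (if j = pos (ix i + (CARD('p) * m - m)) then c0 ^ m * x $ i else 0)" by simp
      qed
      finally show ?thesis by simp
    qed
    then have "monomial e s k *v x = diag (s k) *v (c0 ^ e k *s x)"
      by (simp add: monomial_def matrix_vector_mul_assoc[symmetric] vec_eq_iff)
    then show ?thesis using const by (simp add: vec_eq_iff)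
  qed
  have nz: "s k (pos 0) * c0 ^ e k \<noteq> 0" for k
  proof -
    have "s k (pos 0) \<noteq> 0" using s[of k] by (metis UNIV_I finite prod_zero zero_neq_one)
    then show ?thesis using c0_nz by simp
  qed
  have "(*v) (monomial e s k) ` W = W" for k
  proof (intro Set.set_eqI iffI)
    fix x assume "x \<in> (*v) (monomial e s k) ` W"
    then show "x \<in> W" using act vec.subspace_scale[OF W] by auto
  next
    fix x assume x: "x \<in> W"
    let ?c = "s k (pos 0) * c0 ^ e k"
    have y: "inverse ?c *s x \<in> W" by (rule vec.subspace_scale[OF W x])
    have "x = monomial e s k *v (inverse ?c *s x)"
      unfolding act[OF y] vec.scale_scale right_inverse[OF nz] by (simp only: vec.scale_one)
    then show "x \<in> (*v) (monomial e s k) ` W" using y by blast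
  qed
  then have "W = {0} \<or> W = UNIV" using irr W unfolding irreducible_tuple_def by blast
  moreover have "(\<chi> i. 1) \<in> W" by (simp add: W_def)
  moreover have "(\<chi> i. 1) \<noteq> (0 :: complex^'p)" by (simp add: vec_eq_iff)
  ultimately have "axis (pos 0) 1 \<in> W" by auto
  then have "axis (pos 0) (1::complex) $ pos 0 = axis (pos 0) 1 $ pos 1" unfolding W_def by blast
  moreover have "pos 0 \<noteq> pos 1" using p_gt_1 by (simp add: pos_eq_iff)
  ultimately show False by (simp add: axis_def)
qed

text \<open>
  The kernel of the matrix with columns \<open>f j\<close> is stable under the diagonal matrix of the distinct
  eigenvalues; if it were non-zero it would contain a coordinate vector, that is, some \<open>f j\<close> would vanish.
\<close>

lemma det_eigenbasis_nz:
  fixes f :: "'p \<Rightarrow> complex^'p"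
  assumes f: "\<And>j. f j \<noteq> 0" and M: "\<And>j. M *v f j = (l * w ^ ix j) *s f j"
    and w: "w ^ CARD('p) = 1" "w \<noteq> 1" and l: "l \<noteq> 0"
  shows "det (\<chi> i j. f j $ i) \<noteq> 0"
proof
  let ?g = "\<chi> i j. f j $ i"
  assume "det ?g = 0"
  then have "\<not> invertible ?g" by (simp add: invertible_det_nz)
  then have "\<not> (\<forall>x. ?g *v x = 0 \<longrightarrow> x = 0)"
    using matrix_left_invertible_ker[of ?g] invertible_left_inverse[of ?g] by blast
  then obtain v where v: "v \<noteq> 0" "?g *v v = 0" by blast
  define W where "W = {x. ?g *v x = 0}"
  have W: "vec.subspace W"
    by (auto simp: vec.subspace_def W_def matrix_vector_right_distrib vector_scalar_commute)
  have Mg: "M ** ?g = ?g ** diag (\<lambda>j. l * w ^ ix j)"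
  proof -
    have "(M ** ?g) $ i $ j = (M *v f j) $ i" for i j
      by (simp add: matrix_matrix_mult_def matrix_vector_mult_def)
    then show ?thesis by (simp add: vec_eq_iff M)
  qed
  have "W \<noteq> {0}" using v by (auto simp: W_def)
  then obtain i where "axis i 1 \<in> W"
  proof (rule subspace_contains_axis[OF W])
    fix i j :: 'p assume ij: "i \<noteq> j"
    have "l * w ^ ix i \<noteq> l * w ^ ix j"
      using root_power_inj[OF prime w, of "ix i" "ix j"] ij l by (auto simp: ix_eq_iff)
    moreover have "diag (\<lambda>j. l * w ^ ix j) *v x \<in> W" if "x \<in> W" for x
    proof -
      have "?g *v (diag (\<lambda>j. l * w ^ ix j) *v x) = M *v (?g *v x)"
        by (simp only: matrix_vector_mul_assoc Mg)
      then show ?thesis using that by (simp add: W_def)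
    qed
    ultimately show "\<exists>t. t i \<noteq> t j \<and> (\<forall>x\<in>W. diag t *v x \<in> W)"
      by (intro exI[of _ "\<lambda>j. l * w ^ ix j"]) auto
  qed
  then have "?g *v axis i 1 = 0" by (simp add: W_def)
  moreover have "?g *v axis i 1 = f i"
    by (simp add: vec_eq_iff matrix_vector_mult_def axis_def if_distrib[of "\<lambda>x. _ * x"] cong: if_cong)
  ultimately show False using f[of i] by simp
qed

lemma commuting_diag:
  assumes w: "w ^ CARD('p) = 1" "w \<noteq> 1"
    and X: "diag (\<lambda>i. w ^ ix i) ** X = X ** diag (\<lambda>i. w ^ ix i)"
  shows "X = diag (\<lambda>i. X $ i $ i)"
proof -
  have "X $ i $ j = 0" if "i \<noteq> j" for i j
  proof -
    have "(diag (\<lambda>i. w ^ ix i) ** X) $ i $ j = (X ** diag (\<lambda>i. w ^ ix i)) $ i $ j" using X by simp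
    then have "(w ^ ix i - w ^ ix j) * X $ i $ j = 0" by (simp add: algebra_simps)
    moreover have "w ^ ix i \<noteq> w ^ ix j"
      using root_power_inj[OF prime w, of "ix i" "ix j"] that by (auto simp: ix_eq_iff)
    ultimately show ?thesis by simp
  qed
  then show ?thesis by (simp add: vec_eq_iff diag_def)
qed

text \<open>
  Starting with an eigenvector \<open>v\<close> of \<open>M\<close>, the vectors \<open>B^n v\<close> with \<open>B = A k0\<close> are eigenvectors for the
  eigenvalues \<open>l w^n\<close>, so the first \<open>p\<close> of them are a basis and \<open>B^p v\<close> is a multiple of \<open>v\<close>. Rescaled by powers of
  a constant, they turn \<open>B\<close> into a multiple of the cyclic matrix. Every other \<open>A k\<close>, times a power of the cyclic
  matrix, commutes with the diagonalized \<open>M\<close> and is therefore diagonal.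
\<close>

lemma normal_form:
  fixes A :: "'l::finite \<Rightarrow> complex^'p^'p"
  assumes A: "A \<in> SL_tuples" and M: "det M \<noteq> 0" "\<And>k. M ** A k = mat (w ^ e k) ** (A k ** M)"
    and w: "w ^ CARD('p) = 1" "w \<noteq> 1" and k0: "e k0 = 1"
  obtains s where "s k0 = (\<lambda>_. 1)" "\<And>k. (\<Prod>i\<in>UNIV. s k i) = 1"
    "conj_class (proj_tuple A) = conj_class (proj_tuple (monomial e s))"
proof -
  have w0: "w \<noteq> 0" using w(1) p_gt_1 by (auto simp: power_0_left)
  define B where "B = A k0"
  have MB: "M ** B = mat w ** (B ** M)" using M(2)[of k0] k0 by (simp add: B_def)
  obtain Mi where Mi: "M ** Mi = mat 1" "Mi ** M = mat 1" using M(1) by (rule det_nz_inverse)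
  have detB: "det B = 1" using SL_tuplesD[OF A] by (simp add: B_def)
  obtain Bi where Bi: "B ** Bi = mat 1" "Bi ** B = mat 1" using detB by (rule SL_inverse)
  obtain v l where v: "v \<noteq> 0" "M *v v = l *s v" by (rule complex_matrix_eigenvector)
  have l: "l \<noteq> 0"
  proof
    assume "l = 0"
    then have "Mi *v (M *v v) = 0" using v by simp
    then show False using v(1) by (simp add: matrix_vector_mul_assoc Mi)
  qed
  define f where "f n = ((\<lambda>x. B *v x) ^^ n) v" for n
  have f_Suc: "B *v f n = f (Suc n)" for n by (simp add: f_def)
  have f_nz: "f n \<noteq> 0" for n
  proof (induction n)
    case (Suc n)
    show ?case
    proof
      assume "f (Suc n) = 0"
      then have "Bi *v (B *v f n) = 0" by (simp add: f_Suc)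
      then show False using Suc by (simp add: matrix_vector_mul_assoc Bi)
    qed
  qed (use v in \<open>simp add: f_def\<close>)
  have f_eig: "M *v f n = (l * w ^ n) *s f n" for n
  proof (induction n)
    case (Suc n)
    have "M *v f (Suc n) = (M ** B) *v f n" by (simp add: f_Suc[symmetric] matrix_vector_mul_assoc)
    also have "\<dots> = w *s (B *v (M *v f n))" unfolding MB
      by (simp add: matrix_vector_mul_assoc[symmetric] mat_vector_mult)
    also have "\<dots> = (l * w ^ Suc n) *s f (Suc n)"
      by (simp add: Suc vector_scalar_commute f_Suc vec.scale_scale mult_ac)
    finally show ?case .
  qed (use v in \<open>simp add: f_def\<close>)
  \<comment> \<open>Any choice of non-zero eigenvectors gives a base change which diagonalizes \<open>M\<close>; it is used first for the
    vectors \<open>B^n v\<close> and then for their rescaled versions.\<close>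
  define D where "D = diag (\<lambda>i. w ^ ix i)"
  have Dl: "diag (\<lambda>j. l * w ^ ix j) = mat l ** D" by (simp add: D_def diag_scale)
  have basis: "det (\<chi> i j. h j $ i) \<noteq> 0 \<and> M ** (\<chi> i j. h j $ i) = (\<chi> i j. h j $ i) ** diag (\<lambda>j. l * w ^ ix j)"
    if h: "\<And>j. h j \<noteq> 0" "\<And>j. M *v h j = (l * w ^ ix j) *s h j" for h :: "'p \<Rightarrow> complex^'p"
  proof
    show "det (\<chi> i j. h j $ i) \<noteq> 0" by (rule det_eigenbasis_nz[OF h w l])
    have "(M ** (\<chi> i j. h j $ i)) $ i $ j = (M *v h j) $ i" for i j
      by (simp add: matrix_matrix_mult_def matrix_vector_mult_def)
    then show "M ** (\<chi> i j. h j $ i) = (\<chi> i j. h j $ i) ** diag (\<lambda>j. l * w ^ ix j)"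
      by (simp add: vec_eq_iff h(2))
  qed
  have "\<exists>m. m \<noteq> 0 \<and> f CARD('p) = m *s f 0"
  proof -
    define g where "g = (\<chi> i j. f (ix j) $ i)"
    have g: "det g \<noteq> 0" "M ** g = g ** diag (\<lambda>j. l * w ^ ix j)"
      unfolding g_def using basis[of "\<lambda>j. f (ix j)"] f_nz f_eig by blast+
    obtain h where h: "g ** h = mat 1" "h ** g = mat 1" using g(1) by (rule det_nz_inverse)
    define y where "y = h *v f CARD('p)"
    have gy: "g *v y = f CARD('p)" by (simp add: y_def matrix_vector_mul_assoc h)
    have "g *v (diag (\<lambda>j. l * w ^ ix j) *v y) = M *v (g *v y)"
      by (simp only: matrix_vector_mul_assoc g(2))
    also have "\<dots> = g *v (l *s y)" unfolding vector_scalar_commute gy f_eig using w(1) by simp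
    finally have "h *v (g *v (diag (\<lambda>j. l * w ^ ix j) *v y)) = h *v (g *v (l *s y))" by simp
    then have dy: "diag (\<lambda>j. l * w ^ ix j) *v y = l *s y"
      by (simp add: matrix_vector_mul_assoc h matrix_mul_assoc)
    have y0: "y $ j = 0" if "j \<noteq> pos 0" for j
    proof -
      have "(diag (\<lambda>j. l * w ^ ix j) *v y) $ j = (l *s y) $ j" using dy by simp
      then have "l * (w ^ ix j - 1) * y $ j = 0" by (simp add: algebra_simps)
      moreover have "w ^ ix j \<noteq> w ^ 0"
        using root_power_inj[OF prime w, of "ix j" 0] that p_gt_1 by (metis ix_less pos_ix order_less_trans zero_less_one)
      ultimately show ?thesis using l by simp
    qed
    have "f CARD('p) = y $ pos 0 *s f 0"
    proof -
      have "(g *v y) $ i = (\<Sum>j\<in>UNIV. if j = pos 0 then f (ix j) $ i * y $ pos 0 else 0)" for i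
        unfolding matrix_vector_mult_def g_def vec_lambda_beta
        by (rule sum.cong) (use y0 in auto)
      then have "g *v y = y $ pos 0 *s f 0" using p_gt_1 by (simp add: vec_eq_iff mult.commute)
      then show ?thesis by (simp add: gy)
    qed
    moreover from this have "y $ pos 0 \<noteq> 0" using f_nz[of "CARD('p)"] by auto
    ultimately show ?thesis by blast
  qed
  then obtain m where m: "m \<noteq> 0" "f CARD('p) = m *s f 0" by blast
  \<comment> \<open>Dividing the \<open>n\<close>-th vector by \<open>c1^n\<close> distributes the factor \<open>m\<close> evenly over the cycle.\<close>
  obtain c1 where c1: "m = c1 ^ CARD('p)"
    using exists_complex_root[of "CARD('p)" m] p_gt_1 by (metis not_one_less_zero)
  have c10: "c1 \<noteq> 0" using m(1) c1 p_gt_1 by (auto simp: power_0_left)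
  define h where "h n = inverse c1 ^ n *s f n" for n
  have hp: "h CARD('p) = h 0" using m c1 c10 by (simp add: h_def vec.scale_scale power_inverse)
  have h_Suc: "B *v h n = c1 *s h (Suc n)" for n
    using c10 by (simp add: h_def vector_scalar_commute f_Suc vec.scale_scale)
  have h_mod: "h (Suc (ix j)) = h (ix (pos (ix j + 1)))" for j
  proof (cases "Suc (ix j) = CARD('p)")
    case False
    then have "Suc (ix j) < CARD('p)" using ix_less[of j] by linarith
    then show ?thesis by simp
  qed (simp add: hp)
  define g where "g = (\<chi> i j. h (ix j) $ i)"
  have g: "det g \<noteq> 0" "M ** g = g ** diag (\<lambda>j. l * w ^ ix j)"
    unfolding g_def using basis[of "\<lambda>j. h (ix j)"] f_nz c10
    by (auto simp: h_def vector_scalar_commute f_eig vec.scale_scale mult_ac)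
  obtain gi where gi: "g ** gi = mat 1" "gi ** g = mat 1" using g(1) by (rule det_nz_inverse)
  have Bg: "B ** g = mat c1 ** (g ** shiftmat 1)"
  proof -
    have "(B ** g) $ i $ j = (B *v h (ix j)) $ i" for i j
      by (simp add: matrix_matrix_mult_def matrix_vector_mult_def g_def)
    then show ?thesis
      unfolding vec_eq_iff h_Suc h_mod by (simp add: mult_shiftmat_entry) (simp add: g_def)
  qed
  have gD: "gi ** M ** g = mat l ** D"
    by (simp only: matrix_mul_assoc[symmetric] g(2) Dl) (simp add: matrix_mul_assoc gi)
  have form: "\<exists>s c. (\<Prod>i\<in>UNIV. s i) = 1 \<and> g ** (diag s ** cyc (e k)) = mat c ** (A k ** g)" for k
  proof -
    define C where "C = gi ** A k ** g"
    have gC: "g ** C = A k ** g" by (simp add: C_def matrix_mul_assoc gi)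
    have "(gi ** M ** g) ** C = gi ** (M ** A k) ** g"
      unfolding C_def by (metis gi(1) matrix_mul_assoc matrix_mul_rid)
    also have "\<dots> = mat (w ^ e k) ** (gi ** A k ** M ** g)"
      unfolding M(2) by (metis mat_pull matrix_mul_assoc)
    also have "gi ** A k ** M ** g = C ** (gi ** M ** g)"
      unfolding C_def by (metis gi(1) matrix_mul_assoc matrix_mul_rid)
    finally have "mat l ** (D ** C) = mat l ** (mat (w ^ e k) ** (C ** D))"
      unfolding gD by (metis mat_pull matrix_mul_assoc)
    then have DC: "D ** C = mat (w ^ e k) ** (C ** D)" using l by (simp add: mat_mult_cancel)
    \<comment> \<open>Multiplication by \<open>cyc e'\<close> is, up to a scalar, division by \<open>cyc (e k)\<close>.\<close>
    define e' where "e' = CARD('p) * e k - e k"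
    have ee: "e k + e' = CARD('p) * e k" using p_gt_1 by (simp add: e'_def)
    define X where "X = C ** cyc e'"
    have "D ** X = mat (w ^ e k) ** (C ** (D ** cyc e'))"
      unfolding X_def by (metis DC matrix_mul_assoc)
    also have "D ** cyc e' = mat (w ^ e') ** (cyc e' ** D)"
      unfolding D_def by (rule root_diag_cyc[OF w(1)])
    also have "mat (w ^ e k) ** (C ** \<dots>) = mat (w ^ e k * w ^ e') ** (X ** D)"
      unfolding X_def by (metis mat_pull matrix_mul_assoc mat_mult_mat_assoc)
    also have "w ^ e k * w ^ e' = 1" using w(1) by (simp only: power_add[symmetric] ee power_mult power_one)
    finally have "D ** X = X ** D" by simp
    then have Xd: "X = diag (\<lambda>i. X $ i $ i)" unfolding D_def by (rule commuting_diag[OF w])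
    define x where "x i = X $ i $ i" for i
    have Xx: "X = diag x" using Xd unfolding x_def .
    have "X ** cyc (e k) = C ** cyc (CARD('p) * e k)"
      by (simp only: X_def matrix_mul_assoc[symmetric] cyc_add add.commute[of e'] ee)
    also have "\<dots> = mat (c0 ^ (CARD('p) * e k)) ** C" unfolding cyc_p by (rule mat_central[symmetric])
    finally have XC: "diag x ** cyc (e k) = mat (c0 ^ (CARD('p) * e k)) ** C" by (simp add: Xx)
    have "det gi * det g = 1" using gi(2) by (metis det_mul det_I)
    then have "det C = 1" using SL_tuplesD[OF A, of k] by (simp add: C_def det_mul mult.commute)
    then have detX: "(\<Prod>i\<in>UNIV. x i) \<noteq> 0"
      using arg_cong[OF XC, of det] c0_nz by (auto simp: det_mul det_diag det_mat)
    obtain d where d: "(\<Prod>i\<in>UNIV. x i) = d ^ CARD('p)"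
      using exists_complex_root[of "CARD('p)" "\<Prod>i\<in>UNIV. x i"] p_gt_1 by (metis not_one_less_zero)
    have d0: "d \<noteq> 0" using d detX p_gt_1 by (auto simp: power_0_left)
    define s where "s i = inverse d * x i" for i
    have "(\<Prod>i\<in>UNIV. s i) = 1"
      using d d0 by (simp add: s_def prod.distrib power_inverse)
    moreover have "diag s = mat (inverse d) ** diag x" unfolding s_def by (rule diag_scale)
    then have "g ** (diag s ** cyc (e k)) = mat (inverse d * c0 ^ (CARD('p) * e k)) ** (A k ** g)"
      by (metis XC gC mat_mult_mat_assoc mat_pull matrix_mul_assoc)
    ultimately show ?thesis by blast
  qed
  have "\<exists>s. (\<Prod>i\<in>UNIV. s i) = 1 \<and> (k = k0 \<longrightarrow> s = (\<lambda>_. 1)) \<and> (\<exists>c. g ** (diag s ** cyc (e k)) = mat c ** (A k ** g))" for k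
  proof (cases "k = k0")
    case True
    have "g ** cyc 1 = mat (c0 / c1) ** (A k0 ** g)"
    proof -
      have "mat (c0 / c1) ** (B ** g) = mat (c0 / c1 * c1) ** (g ** shiftmat 1)"
        by (simp add: Bg mat_mult_mat_assoc)
      also have "\<dots> = g ** cyc 1" using c10 by (simp add: cyc_def mat_pull)
      finally show ?thesis by (simp add: B_def)
    qed
    then show ?thesis using True k0 by (intro exI[of _ "\<lambda>_. 1"]) (auto simp: diag_const)
  next
    case False
    then show ?thesis using form[of k] by blast
  qed
  then obtain s where s: "\<And>k. (\<Prod>i\<in>UNIV. s k i) = 1" "s k0 = (\<lambda>_. 1)"
    and "\<And>k. \<exists>c. g ** (diag (s k) ** cyc (e k)) = mat c ** (A k ** g)" by metis
  then obtain c where c: "\<And>k. g ** monomial e s k = mat (c k) ** (A k ** g)"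
    unfolding monomial_def by metis
  have "conj_class (proj_tuple (monomial e s)) = conj_class (proj_tuple A)"
    by (rule conj_class_eqI[OF monomial_SL[OF s(1)] A g(1) c])
  then show ?thesis using s by (intro that[of s]) simp_all
qed

text \<open>
  All the roots of unity \<open>\<omega> k\<close> are powers of the non-trivial one at \<open>k0\<close>; their exponents are the \<open>e k\<close>.
\<close>

lemma bad_normal_form:
  fixes A :: "'l::finite \<Rightarrow> complex^'p^'p"
  assumes A: "A \<in> SL_tuples" and bad: "proj_tuple A \<in> bad_reps"
  obtains e k0 s where "e k0 = 1" "\<And>k. e k < CARD('p)" "s k0 = (\<lambda>_. 1)" "\<And>k. (\<Prod>i\<in>UNIV. s k i) = 1"
    "conj_class (proj_tuple A) = conj_class (proj_tuple (monomial e s))"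
proof (rule bad_repsD[OF _ A bad])
  show p2: "2 \<le> CARD('p)" using p_gt_1 by simp
  fix M \<omega> k0 assume M: "det M = 1" "\<And>k. M ** A k = mat (\<omega> k) ** (A k ** M)"
    and om: "\<And>k. \<omega> k ^ CARD('p) = 1" "\<omega> k0 \<noteq> 1"
  have "\<exists>n<CARD('p). \<omega> k = \<omega> k0 ^ n" for k
    using root_as_power[OF prime om(1)[of k0] om(2) om(1)[of k]] by blast
  then have "\<exists>e'. \<forall>k. e' k < CARD('p) \<and> \<omega> k = \<omega> k0 ^ e' k" by (intro choice) blast
  then obtain e' where e': "\<And>k. e' k < CARD('p)" "\<And>k. \<omega> k = \<omega> k0 ^ e' k" by blast
  define e where "e = e'(k0 := 1)"
  have e: "e k0 = 1" "e k < CARD('p)" for k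
    using e'(1) p_gt_1 by (simp_all add: e_def)
  have e3: "\<omega> k = \<omega> k0 ^ e k" for k
    using e'(2)[of k] by (cases "k = k0") (simp_all add: e_def)
  have M': "M ** A k = mat (\<omega> k0 ^ e k) ** (A k ** M)" for k
    unfolding e3[symmetric] by (rule M(2))
  have M0: "det M \<noteq> 0" using M(1) by simp
  show ?thesis
  proof (rule normal_form[where e = e and w = "\<omega> k0" and ?k0.0 = k0, OF A M0 M' om(1) om(2) e(1)])
    fix s assume s: "s k0 = (\<lambda>_. 1)" "\<And>k. (\<Prod>i\<in>UNIV. s k i) = 1"
      "conj_class (proj_tuple A) = conj_class (proj_tuple (monomial e s))"
    show ?thesis by (rule that[of e k0 s, OF e s])
  qed
qed

end

section \<open>The topologies and the structure sheaves\<close>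

lemma continuous_on_matrix_mult:
  fixes f :: "'a::topological_space \<Rightarrow> complex^'n^'m" and g :: "'a \<Rightarrow> complex^'k^'n"
  assumes "continuous_on S f" "continuous_on S g"
  shows "continuous_on S (\<lambda>x. f x ** g x)"
  unfolding matrix_matrix_mult_def
  by (intro continuous_intros assms)

text \<open>
  The projection is open: the preimage of the image of \<open>S\<close> is the union of the translates of \<open>S\<close> by the centre.
\<close>

lemma openin_to_PSL_image:
  fixes S :: "(complex^'p^'p) set"
  assumes S: "openin (top_of_set (carrier SL_group)) S"
  shows "openin PSL_topology (to_PSL ` S)"
proof -
  let ?SL = "carrier SL_group :: (complex^'p^'p) set"
  have sub: "S \<subseteq> ?SL" using openin_subset[OF S] by simp
  have "{A \<in> ?SL. to_PSL A \<in> to_PSL ` S} = (\<Union>c\<in>{c. c ^ CARD('p) = 1}. ?SL \<inter> (\<lambda>A. mat c ** A) -` S)"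
  proof (intro Set.set_eqI iffI)
    fix A assume "A \<in> {A \<in> ?SL. to_PSL A \<in> to_PSL ` S}"
    then obtain B where A: "A \<in> ?SL" and B: "B \<in> S" "to_PSL A = to_PSL B" by blast
    then obtain c where "c ^ CARD('p) = 1" "B = mat c ** A" by (auto simp: to_PSL_eq_iff)
    then show "A \<in> (\<Union>c\<in>{c. c ^ CARD('p) = 1}. ?SL \<inter> (\<lambda>A. mat c ** A) -` S)" using A B by auto
  next
    fix A assume "A \<in> (\<Union>c\<in>{c. c ^ CARD('p) = 1}. ?SL \<inter> (\<lambda>A. mat c ** A) -` S)"
    then obtain c where c: "c ^ CARD('p) = 1" "A \<in> ?SL" "mat c ** A \<in> S" by auto
    then have "to_PSL A = to_PSL (mat c ** A)" by (auto simp: to_PSL_eq_iff)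
    then show "A \<in> {A \<in> ?SL. to_PSL A \<in> to_PSL ` S}" using c by auto
  qed
  moreover have "openin (top_of_set ?SL) (?SL \<inter> (\<lambda>A. mat c ** A) -` S)" if "c ^ CARD('p) = 1" for c
  proof (rule continuous_openin_preimage[OF _ _ S])
    show "continuous_on ?SL (\<lambda>A. mat c ** A)"
      by (intro continuous_on_matrix_mult continuous_on_const continuous_on_id)
    show "(\<lambda>A. mat c ** A) \<in> ?SL \<rightarrow> ?SL" using that by (simp add: det_mul det_mat)
  qed
  ultimately have "openin (top_of_set ?SL) {A \<in> ?SL. to_PSL A \<in> to_PSL ` S}"
    by (simp only:) (intro openin_Union, auto)
  then show ?thesis
    using sub by (simp add: PSL_topology_def openin_quotient_topology image_mono)
qed

lemma topspace_PSL_topology: "topspace PSL_topology = carrier PSL_group"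
  by (simp add: PSL_topology_def topspace_quotient_topology carrier_PSL_group)

lemma topspace_Hom_topology:
  "topspace (Hom_topology :: ('l::finite \<Rightarrow> (complex^'p^'p) set) topology) = proj_tuple ` SL_tuples"
proof -
  have "topspace (Hom_topology :: ('l::finite \<Rightarrow> (complex^'p^'p) set) topology) = {\<rho>. range \<rho> \<subseteq> carrier PSL_group}"
    by (auto simp: Hom_topology_def topspace_PSL_topology)
  also have "\<dots> = proj_tuple ` SL_tuples"
  proof (intro equalityI subsetI)
    fix \<rho> :: "'l \<Rightarrow> (complex^'p^'p) set" assume "\<rho> \<in> {\<rho>. range \<rho> \<subseteq> carrier PSL_group}"
    then show "\<rho> \<in> proj_tuple ` SL_tuples" by (auto elim: proj_tuple_lift)
  qed (use range_proj_tuple in auto)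
  finally show ?thesis .
qed

lemma continuous_map_proj_tuple:
  "continuous_map (top_of_set SL_tuples) Hom_topology (proj_tuple :: ('l::finite \<Rightarrow> complex^'p^'p) \<Rightarrow> _)"
  unfolding Hom_topology_def continuous_map_componentwise_UNIV
proof
  fix k :: 'l
  have "continuous_map (top_of_set SL_tuples) (top_of_set (carrier SL_group)) (\<lambda>A. A k :: complex^'p^'p)"
    using continuous_on_subset[OF continuous_on_product_coordinates[of k] subset_UNIV]
    by (auto simp: continuous_map_in_subtopology SL_tuples_def)
  moreover have "continuous_map (top_of_set (carrier SL_group)) PSL_topology (to_PSL :: complex^'p^'p \<Rightarrow> _)"
    unfolding PSL_topology_def
    by (rule quotient_imp_continuous_map[OF quotient_map_quotient_topology])
  ultimately have "continuous_map (top_of_set SL_tuples) PSL_topology ((to_PSL :: complex^'p^'p \<Rightarrow> _) \<circ> (\<lambda>A. A k))"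
    by (rule continuous_map_compose)
  then show "continuous_map (top_of_set SL_tuples) PSL_topology (\<lambda>A :: 'l \<Rightarrow> complex^'p^'p. proj_tuple A k)"
    by (simp add: proj_tuple_def o_def)
qed

text \<open>
  Since the projection of each factor is open, the product of the quotient topologies is the quotient of the
  product topology. So open sets of representations may be tested on tuples of matrices.
\<close>

lemma openin_Hom_topology:
  fixes T :: "('l::finite \<Rightarrow> (complex^'p^'p) set) set"
  shows "openin Hom_topology T \<longleftrightarrow> T \<subseteq> proj_tuple ` SL_tuples \<and>
    openin (top_of_set SL_tuples) {A \<in> SL_tuples. proj_tuple A \<in> T}"
proof
  assume T: "openin Hom_topology T"
  then show "T \<subseteq> proj_tuple ` SL_tuples \<and> openin (top_of_set SL_tuples) {A \<in> SL_tuples. proj_tuple A \<in> T}"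
    using openin_subset[OF T] openin_continuous_map_preimage[OF continuous_map_proj_tuple T]
    by (simp add: topspace_Hom_topology)
next
  assume "T \<subseteq> proj_tuple ` SL_tuples \<and> openin (top_of_set SL_tuples) {A \<in> SL_tuples. proj_tuple A \<in> T}"
  then have sub: "T \<subseteq> proj_tuple ` SL_tuples"
    and op: "openin (top_of_set SL_tuples) {A \<in> SL_tuples. proj_tuple A \<in> T}" by auto
  obtain S where S: "open S" "{A \<in> SL_tuples. proj_tuple A \<in> T} = SL_tuples \<inter> S"
    using op by (auto simp: openin_open)
  have Sp: "openin (product_topology (\<lambda>_. euclidean) UNIV) S"
    using S(1) by (simp add: euclidean_product_topology)
  show "openin Hom_topology T"
  proof (subst openin_subopen, intro ballI)
    fix \<rho> assume \<rho>: "\<rho> \<in> T"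
    then obtain A where A: "A \<in> SL_tuples" "\<rho> = proj_tuple A" using sub by auto
    then have "A \<in> S" using \<rho> S(2) by auto
    with Sp[unfolded openin_product_topology_alt]
    have "\<exists>V. finite {k \<in> UNIV. V k \<noteq> topspace euclidean} \<and> (\<forall>k\<in>UNIV. openin euclidean (V k)) \<and>
        A \<in> Pi\<^sub>E UNIV V \<and> Pi\<^sub>E UNIV V \<subseteq> S" by (rule bspec)
    then obtain V where V: "\<And>k. open (V k)" "A \<in> Pi\<^sub>E UNIV V" "Pi\<^sub>E UNIV V \<subseteq> S" by auto
    define R where "R = Pi\<^sub>E UNIV (\<lambda>k. to_PSL ` (carrier SL_group \<inter> V k))"
    have "openin Hom_topology R"
      unfolding R_def Hom_topology_def
      by (intro openin_PiE_gen[THEN iffD2] disjI2 conjI ballI openin_to_PSL_image openin_open_Int V(1)) simp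
    moreover have "\<rho> \<in> R"
      using A V(2) by (auto simp: R_def proj_tuple_def SL_tuples_def)
    moreover have "R \<subseteq> T"
    proof
      fix \<sigma> assume "\<sigma> \<in> R"
      then have "\<sigma> k \<in> to_PSL ` (carrier SL_group \<inter> V k)" for k
        unfolding R_def by (rule PiE_mem) simp
      then have "\<forall>k. \<exists>B. B \<in> carrier SL_group \<inter> V k \<and> \<sigma> k = to_PSL B" by blast
      then obtain B where B: "\<And>k. B k \<in> carrier SL_group \<inter> V k" "\<And>k. \<sigma> k = to_PSL (B k)" by metis
      then have "B \<in> SL_tuples" "B \<in> S" "\<sigma> = proj_tuple B"
        using V(3) by (auto simp: SL_tuples_def proj_tuple_def)
      then show "\<sigma> \<in> T" using S(2) by blast
    qed
    ultimately show "\<exists>R. openin Hom_topology R \<and> \<rho> \<in> R \<and> R \<subseteq> T" by blast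
  qed
qed

definition tuple_class :: "('l \<Rightarrow> complex^'p^'p) \<Rightarrow> ('l \<Rightarrow> (complex^'p^'p) set) set" where
  "tuple_class A = conj_class (proj_tuple A)"

definition irr_tuples :: "('l::finite \<Rightarrow> complex^'p^'p) set" where
  "irr_tuples = {A \<in> SL_tuples. proj_tuple A \<in> irreducible_reps}"

definition bad_tuples :: "('l::finite \<Rightarrow> complex^'p^'p) set" where
  "bad_tuples = {A \<in> SL_tuples. proj_tuple A \<in> bad_reps}"

lemma bad_tuples_subset: "bad_tuples \<subseteq> irr_tuples"
  using bad_imp_irreducible by (auto simp: bad_tuples_def irr_tuples_def)

lemma irreducible_reps_eq: "(irreducible_reps :: ('l::finite \<Rightarrow> (complex^'p^'p) set) set) = proj_tuple ` irr_tuples"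
proof (intro equalityI subsetI)
  fix \<rho> :: "'l \<Rightarrow> (complex^'p^'p) set" assume r: "\<rho> \<in> irreducible_reps"
  then have "range \<rho> \<subseteq> carrier PSL_group" by (simp add: irreducible_reps_def)
  then obtain A where "A \<in> SL_tuples" "\<rho> = proj_tuple A" by (rule proj_tuple_lift)
  then show "\<rho> \<in> proj_tuple ` irr_tuples" using r by (auto simp: irr_tuples_def)
qed (auto simp: irr_tuples_def)

lemma bad_reps_eq: "(bad_reps :: ('l::finite \<Rightarrow> (complex^'p^'p) set) set) = proj_tuple ` bad_tuples"
proof (intro equalityI subsetI)
  fix \<rho> :: "'l \<Rightarrow> (complex^'p^'p) set" assume r: "\<rho> \<in> bad_reps"
  then have "range \<rho> \<subseteq> carrier PSL_group" by (simp add: bad_reps_def)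
  then obtain A where "A \<in> SL_tuples" "\<rho> = proj_tuple A" by (rule proj_tuple_lift)
  then show "\<rho> \<in> proj_tuple ` bad_tuples" using r by (auto simp: bad_tuples_def)
qed (auto simp: bad_tuples_def)

lemma conj_class_bad_reps: "conj_class ` (bad_reps :: ('l::finite \<Rightarrow> (complex^'p^'p) set) set) = tuple_class ` bad_tuples"
  by (simp add: bad_reps_eq image_image tuple_class_def)

lemma topspace_Hom_irr:
  "topspace (subtopology Hom_topology (irreducible_reps :: ('l::finite \<Rightarrow> (complex^'p^'p) set) set)) = irreducible_reps"
  using irreducible_reps_eq by (auto simp: topspace_Hom_topology irr_tuples_def)

lemma topspace_char_variety:
  "topspace (char_variety :: ('l::finite \<Rightarrow> (complex^'p^'p) set) set topology) = tuple_class ` irr_tuples"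
  by (simp add: char_variety_def topspace_quotient_topology topspace_Hom_irr del: topspace_subtopology)
     (simp add: irreducible_reps_eq image_image tuple_class_def)

lemma topspace_sing_locus:
  "topspace (sing_locus :: ('l::finite \<Rightarrow> (complex^'p^'p) set) set topology) = tuple_class ` bad_tuples"
  using bad_tuples_subset by (auto simp: sing_locus_def topspace_char_variety conj_class_bad_reps)

lemma continuous_map_sing_locus:
  fixes \<psi> :: "'x \<Rightarrow> 'l::finite \<Rightarrow> complex^'p^'p"
  assumes c: "continuous_map X (top_of_set SL_tuples) \<psi>" and b: "\<And>x. x \<in> topspace X \<Longrightarrow> \<psi> x \<in> bad_tuples"
  shows "continuous_map X sing_locus (\<lambda>x. tuple_class (\<psi> x))"
proof -
  have "continuous_map X Hom_topology (proj_tuple \<circ> \<psi>)"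
    by (rule continuous_map_compose[OF c continuous_map_proj_tuple])
  then have "continuous_map X (subtopology Hom_topology irreducible_reps) (proj_tuple \<circ> \<psi>)"
    using subsetD[OF bad_tuples_subset b]
    by (auto simp: continuous_map_in_subtopology irr_tuples_def)
  moreover have "continuous_map (subtopology Hom_topology irreducible_reps) char_variety conj_class"
    unfolding char_variety_def by (rule quotient_imp_continuous_map[OF quotient_map_quotient_topology])
  ultimately have "continuous_map X char_variety (conj_class \<circ> (proj_tuple \<circ> \<psi>))"
    by (rule continuous_map_compose)
  then show ?thesis
    using b by (auto simp: sing_locus_def continuous_map_in_subtopology conj_class_bad_reps tuple_class_def o_def)
qed

lemma complex_space_UNIV: "complex_space UNIV = euclidean"
  by (simp add: complex_space_def euclidean_product_topology)

definition flat_tuple :: "('l \<Rightarrow> complex^'p^'p) \<Rightarrow> 'l \<times> 'p \<times> 'p \<Rightarrow> complex" where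
  "flat_tuple A = (\<lambda>(k, i, j). A k $ i $ j)"

lemma matrix_tuple_flat [simp]: "matrix_tuple (flat_tuple A) = A"
  by (simp add: matrix_tuple_def flat_tuple_def fun_eq_iff vec_eq_iff)

lemma flat_matrix_tuple [simp]: "flat_tuple (matrix_tuple z) = z"
  by (auto simp: matrix_tuple_def flat_tuple_def fun_eq_iff)

lemma continuous_matrix_tuple: "continuous_on UNIV (matrix_tuple :: _ \<Rightarrow> 'l \<Rightarrow> complex^'p^'p)"
  unfolding matrix_tuple_def
  by (intro continuous_on_coordinatewise_then_product continuous_on_vec_lambda continuous_on_product_coordinates)

lemma holo_subset:
  assumes "holo I U f" "openin (complex_space I) U'" "U' \<subseteq> U"
  shows "holo I U' f"
  using assms continuous_map_from_subtopology_mono[of "complex_space I" U euclidean f U'] by (auto simp: holo_def)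

lemma matrix_sheaf_iff:
  "matrix_sheaf S f \<longleftrightarrow> holo UNIV {z. matrix_tuple z \<in> S} (\<lambda>z. f (matrix_tuple z))"
proof -
  have "S \<subseteq> range matrix_tuple" by (metis matrix_tuple_flat rangeI subsetI)
  then show ?thesis
    by (simp add: matrix_sheaf_def quotient_sheaf_def complex_space_UNIV o_def)
qed

text \<open>
  A section of the sheaf is, near every point, a holomorphic function of the matrix entries: this
  unwinds the four sheaves on the singular locus, the character variety, the representations
  and the tuples in SL. The open set \<open>U\<close> also records the neighbourhoods on which the successive local extensions agree.
\<close>

lemma sing_locus_sheafD:
  fixes A :: "'l::finite \<Rightarrow> complex^'p^'p"
  assumes f: "sing_locus_sheaf V f" and A: "A \<in> bad_tuples" "tuple_class A \<in> V"
  obtains U k where "holo UNIV U k" "flat_tuple A \<in> U"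
    "\<And>B. B \<in> bad_tuples \<Longrightarrow> tuple_class B \<in> V \<Longrightarrow> flat_tuple B \<in> U \<Longrightarrow> f (tuple_class B) = k (flat_tuple B)"
proof -
  have Ai: "A \<in> irr_tuples" using A bad_tuples_subset by blast
  then have Airr: "proj_tuple A \<in> irreducible_reps" and ASL: "A \<in> SL_tuples" by (auto simp: irr_tuples_def)
  obtain W g where W: "tuple_class A \<in> W" "openin char_variety W" "char_variety_sheaf W g"
    and fg: "\<forall>x\<in>W \<inter> V. f x = g x"
    using f A(2) unfolding sing_locus_sheaf_def sub_sheaf_def by blast
  let ?R = "{\<rho> \<in> irreducible_reps. conj_class \<rho> \<in> W}"
  have gs: "sub_sheaf Hom_topology Hom_sheaf irreducible_reps ?R (g \<circ> conj_class)"
    using W(3) unfolding char_variety_sheaf_def quotient_sheaf_def topspace_Hom_irr by blast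
  have AR: "proj_tuple A \<in> ?R" using Airr W(1) by (simp add: tuple_class_def)
  obtain W2 h where W2: "proj_tuple A \<in> W2" "openin Hom_topology W2" "Hom_sheaf W2 h"
    and gh: "\<forall>x\<in>W2 \<inter> ?R. (g \<circ> conj_class) x = h x"
    using gs AR unfolding sub_sheaf_def by blast
  have Rop: "openin (subtopology Hom_topology irreducible_reps) ?R" using gs unfolding sub_sheaf_def by blast
  then obtain T where T: "openin Hom_topology T" "?R = T \<inter> irreducible_reps" by (auto simp: openin_subtopology)
  let ?S = "{A \<in> SL_tuples. proj_tuple A \<in> W2}"
  have hs: "sub_sheaf euclidean matrix_sheaf SL_tuples ?S (h \<circ> proj_tuple)"
    using W2(3) unfolding Hom_sheaf_def quotient_sheaf_def by (simp add: proj_tuple_def[abs_def])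
  obtain W3 k where W3: "A \<in> W3" "open W3" "matrix_sheaf W3 k" and hk: "\<forall>x\<in>W3 \<inter> ?S. (h \<circ> proj_tuple) x = k x"
    using hs ASL W2(1) unfolding sub_sheaf_def by auto
  obtain O2 where O2: "open O2" "?S = SL_tuples \<inter> O2"
    using hs by (auto simp: sub_sheaf_def openin_open)
  obtain O1 where O1: "open O1" "{A \<in> SL_tuples. proj_tuple A \<in> T} = SL_tuples \<inter> O1"
    using T(1) by (auto simp: openin_Hom_topology openin_open)
  define U where "U = matrix_tuple -` (W3 \<inter> O2 \<inter> O1)"
  have "open (W3 \<inter> O2 \<inter> O1)" using W3 O2 O1 by blast
  then have Uo: "open U" unfolding U_def by (rule open_vimage[OF _ continuous_matrix_tuple])
  have "holo UNIV U (\<lambda>z. k (matrix_tuple z))"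
    by (rule holo_subset[OF W3(3)[unfolded matrix_sheaf_iff]]) (use Uo in \<open>auto simp: complex_space_UNIV U_def\<close>)
  moreover have "flat_tuple A \<in> U"
    using W3(1) ASL O1 O2 W2(1) T(2) AR by (auto simp: U_def)
  moreover have "f (tuple_class B) = k (matrix_tuple (flat_tuple B))"
    if B: "B \<in> bad_tuples" "tuple_class B \<in> V" "flat_tuple B \<in> U" for B
  proof -
    have Bi: "proj_tuple B \<in> irreducible_reps" "B \<in> SL_tuples"
      using B bad_tuples_subset by (auto simp: irr_tuples_def)
    have BU: "B \<in> W3" "B \<in> O2" "B \<in> O1" using B(3) by (auto simp: U_def)
    have BT: "proj_tuple B \<in> T" using BU O1(2) Bi by blast
    then have BR: "proj_tuple B \<in> ?R" using T(2) Bi by blast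
    have BS: "B \<in> ?S" using BU O2(2) Bi by blast
    have "f (tuple_class B) = g (tuple_class B)" using fg B(2) BR by (auto simp: tuple_class_def)
    also have "\<dots> = h (proj_tuple B)" using gh BR BS by (auto simp: tuple_class_def)
    also have "\<dots> = k B" using hk BU BS by auto
    finally show ?thesis by simp
  qed
  ultimately show ?thesis by (rule that)
qed

text \<open>
  Conversely, a conjugation-invariant holomorphic function \<open>k\<close> on an invariant open set of tuples of matrices
  descends to a section on the character variety.
\<close>

lemma char_variety_sheafI:
  fixes S :: "('l::finite \<Rightarrow> complex^'p^'p) set"
  assumes S: "open S" and k: "matrix_sheaf S k"
    and inv: "\<And>A B. A \<in> S \<Longrightarrow> A \<in> SL_tuples \<Longrightarrow> B \<in> SL_tuples \<Longrightarrow> tuple_class A = tuple_class B \<Longrightarrow> B \<in> S \<and> k B = k A"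
    and g: "\<And>A. A \<in> S \<Longrightarrow> A \<in> irr_tuples \<Longrightarrow> g (tuple_class A) = k A"
  shows "openin char_variety (tuple_class ` (S \<inter> irr_tuples))" "char_variety_sheaf (tuple_class ` (S \<inter> irr_tuples)) g"
proof -
  let ?T = "proj_tuple ` (S \<inter> SL_tuples)"
  have pre: "{A \<in> SL_tuples. proj_tuple A \<in> ?T} = SL_tuples \<inter> S"
    using inv by (auto simp: tuple_class_def)
  have T: "openin Hom_topology ?T"
    unfolding openin_Hom_topology pre using S by auto
  define h where "h \<rho> = k (SOME A. A \<in> S \<inter> SL_tuples \<and> proj_tuple A = \<rho>)" for \<rho>
  have h: "h (proj_tuple A) = k A" if "A \<in> S" "A \<in> SL_tuples" for A
  proof -
    define B where "B = (SOME B. B \<in> S \<inter> SL_tuples \<and> proj_tuple B = proj_tuple A)"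
    have "B \<in> S \<inter> SL_tuples \<and> proj_tuple B = proj_tuple A"
      unfolding B_def by (rule someI[of _ A]) (use that in simp)
    then have "k B = k A" using inv[of A B] that by (simp add: tuple_class_def)
    then show ?thesis by (simp add: h_def B_def)
  qed
  have hs: "Hom_sheaf ?T h"
    unfolding Hom_sheaf_def quotient_sheaf_def
  proof (intro conjI)
    show "?T \<subseteq> (\<lambda>A k. to_PSL (A k)) ` topspace (top_of_set SL_tuples)"
      by (auto simp: proj_tuple_def[abs_def])
    have "sub_sheaf euclidean matrix_sheaf SL_tuples (SL_tuples \<inter> S) (h \<circ> proj_tuple)"
      unfolding sub_sheaf_def
    proof (intro conjI ballI)
      show "openin (top_of_set SL_tuples) (SL_tuples \<inter> S)" using S by auto
      fix A assume "A \<in> SL_tuples \<inter> S"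
      then show "\<exists>W g. A \<in> W \<and> openin euclidean W \<and> matrix_sheaf W g \<and> (\<forall>x\<in>W \<inter> (SL_tuples \<inter> S). (h \<circ> proj_tuple) x = g x)"
        using S k h by (intro exI[of _ S] exI[of _ k]) auto
    qed
    then show "sub_sheaf euclidean matrix_sheaf SL_tuples {x \<in> topspace (top_of_set SL_tuples). (\<lambda>k. to_PSL (x k)) \<in> ?T} (h \<circ> (\<lambda>A k. to_PSL (A k)))"
      using pre by (simp add: proj_tuple_def[abs_def])
  qed
  let ?W = "tuple_class ` (S \<inter> irr_tuples)"
  have R: "{\<rho> \<in> irreducible_reps. conj_class \<rho> \<in> ?W} = ?T \<inter> irreducible_reps"
  proof (intro equalityI subsetI)
    fix \<rho> :: "'l \<Rightarrow> (complex^'p^'p) set" assume r: "\<rho> \<in> {\<rho> \<in> irreducible_reps. conj_class \<rho> \<in> ?W}"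
    then obtain B A where B: "B \<in> irr_tuples" "\<rho> = proj_tuple B" and A: "A \<in> S" "A \<in> irr_tuples" "conj_class \<rho> = tuple_class A"
      by (auto simp: irreducible_reps_eq)
    then have "B \<in> S" using inv[of A B] by (auto simp: tuple_class_def irr_tuples_def)
    then show "\<rho> \<in> ?T \<inter> irreducible_reps" using B r by (auto simp: irr_tuples_def)
  qed (auto simp: irr_tuples_def tuple_class_def)
  have op: "openin (subtopology Hom_topology irreducible_reps) (?T \<inter> irreducible_reps)"
    using T by (auto simp: openin_subtopology)
  have W: "?W \<subseteq> conj_class ` irreducible_reps" by (auto simp: irreducible_reps_eq tuple_class_def)
  show "openin char_variety ?W"
    unfolding char_variety_def openin_quotient_topology topspace_Hom_irr R using op W by simp
  have "sub_sheaf Hom_topology Hom_sheaf irreducible_reps (?T \<inter> irreducible_reps) (g \<circ> conj_class)"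
    unfolding sub_sheaf_def
  proof (intro conjI ballI op)
    fix \<rho> assume \<rho>: "\<rho> \<in> ?T \<inter> irreducible_reps"
    have "g (conj_class x) = h x" if x: "x \<in> ?T \<inter> irreducible_reps" for x
    proof -
      obtain B where "B \<in> S" "B \<in> SL_tuples" "x = proj_tuple B" using x by auto
      then show ?thesis using g[of B] h[of B] x by (simp add: irr_tuples_def tuple_class_def)
    qed
    then show "\<exists>W h. \<rho> \<in> W \<and> openin Hom_topology W \<and> Hom_sheaf W h \<and> (\<forall>x\<in>W \<inter> (?T \<inter> irreducible_reps). (g \<circ> conj_class) x = h x)"
      using \<rho> T hs by (intro exI[of _ ?T] exI[of _ h]) auto
  qed
  then show "char_variety_sheaf ?W g"
    unfolding char_variety_sheaf_def quotient_sheaf_def topspace_Hom_irr R using W by simp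
qed

lemma sing_locus_sheafI:
  fixes S :: "('l::finite \<Rightarrow> complex^'p^'p) set"
  assumes S: "open S" and k: "matrix_sheaf S k"
    and inv: "\<And>A B. A \<in> S \<Longrightarrow> A \<in> SL_tuples \<Longrightarrow> B \<in> SL_tuples \<Longrightarrow> tuple_class A = tuple_class B \<Longrightarrow> B \<in> S \<and> k B = k A"
    and g: "\<And>A. A \<in> S \<Longrightarrow> A \<in> bad_tuples \<Longrightarrow> g (tuple_class A) = k A"
  shows "openin sing_locus (tuple_class ` (S \<inter> bad_tuples))" "sing_locus_sheaf (tuple_class ` (S \<inter> bad_tuples)) g"
proof -
  define g' where "g' x = k (SOME A. A \<in> S \<inter> irr_tuples \<and> tuple_class A = x)" for x
  have g': "g' (tuple_class A) = k A" if "A \<in> S" "A \<in> irr_tuples" for A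
  proof -
    define B where "B = (SOME B. B \<in> S \<inter> irr_tuples \<and> tuple_class B = tuple_class A)"
    have "B \<in> S \<inter> irr_tuples \<and> tuple_class B = tuple_class A"
      unfolding B_def by (rule someI[of _ A]) (use that in simp)
    then have "k B = k A" using inv[of A B] that by (simp add: irr_tuples_def)
    then show ?thesis by (simp add: g'_def B_def)
  qed
  let ?W = "tuple_class ` (S \<inter> irr_tuples)" and ?V = "tuple_class ` (S \<inter> bad_tuples)"
  note W = char_variety_sheafI[where g = g', OF S k inv g']
  have V: "?V = ?W \<inter> tuple_class ` bad_tuples"
  proof (intro equalityI subsetI)
    fix x assume "x \<in> ?W \<inter> tuple_class ` bad_tuples"
    then obtain A B where "A \<in> S" "A \<in> irr_tuples" "B \<in> bad_tuples" "tuple_class A = tuple_class B" "x = tuple_class B" by auto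
    then show "x \<in> ?V" using inv[of A B] by (auto simp: irr_tuples_def bad_tuples_def)
  qed (use bad_tuples_subset in auto)
  show op: "openin sing_locus ?V"
    unfolding V sing_locus_def conj_class_bad_reps openin_subtopology using W(1) by blast
  show "sing_locus_sheaf ?V g"
    unfolding sing_locus_sheaf_def sub_sheaf_def
  proof (intro conjI ballI)
    show "openin (subtopology char_variety (conj_class ` bad_reps)) ?V" using op by (simp add: sing_locus_def)
    fix y assume y: "y \<in> ?V"
    have "g x = g' x" if x: "x \<in> ?V" for x
    proof -
      obtain B where "B \<in> S" "B \<in> bad_tuples" "x = tuple_class B" using x by auto
      then show ?thesis using g[of B] g'[of B] bad_tuples_subset by auto
    qed
    then show "\<exists>W h. y \<in> W \<and> openin char_variety W \<and> char_variety_sheaf W h \<and> (\<forall>x\<in>W \<inter> ?V. g x = h x)"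
      using W y bad_tuples_subset by (intro exI[of _ ?W] exI[of _ g'] conjI ballI) blast+
  qed
qed

section \<open>Connectedness\<close>

lemma irr_tuples_iff:
  fixes A :: "'l::finite \<Rightarrow> complex^'p^'p"
  assumes "CARD('p) \<ge> 2"
  shows "A \<in> irr_tuples \<longleftrightarrow> A \<in> SL_tuples \<and> irreducible_tuple A"
  using irreducible_reps_iff[OF assms, of A] by (auto simp: irr_tuples_def)

lemma irr_tuples_class:
  fixes A B :: "'l::finite \<Rightarrow> complex^'p^'p"
  assumes p: "CARD('p) \<ge> 2" and A: "A \<in> irr_tuples" and B: "B \<in> SL_tuples" and eq: "tuple_class A = tuple_class B"
  shows "B \<in> irr_tuples"
proof -
  have A': "A \<in> SL_tuples" "irreducible_tuple A" using A irr_tuples_iff[OF p] by blast+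
  obtain g c where g: "det g = 1" "\<forall>k. c k ^ CARD('p) = 1" "\<forall>k. g ** A k = mat (c k) ** (B k ** g)"
    using conj_class_eqD[OF A'(1) B eq[unfolded tuple_class_def]] by blast
  have "c k \<noteq> 0" for k using g(2)[rule_format, of k] by (auto simp: power_0_left)
  then have "irreducible_tuple B"
    using g A'(2) by (intro irreducible_tuple_conj[where g = g and A = A and c = c and B = B]) auto
  then show ?thesis using B irr_tuples_iff[OF p] by blast
qed

text \<open>
  The exponential map onto the diagonal matrices of determinant 1; it is defined on all of \<open>C^p\<close> and depends
  only on the differences of the coordinates.
\<close>

definition normalized_exp :: "('n::finite \<Rightarrow> complex) \<Rightarrow> 'n \<Rightarrow> complex" where
  "normalized_exp u i = exp (u i - (\<Sum>j\<in>UNIV. u j) / of_nat CARD('n))"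

lemma prod_normalized_exp: "(\<Prod>i\<in>UNIV. normalized_exp u i) = 1"
proof -
  have "(\<Prod>i\<in>UNIV. normalized_exp u i) = exp (\<Sum>i\<in>UNIV. u i - (\<Sum>j\<in>UNIV. u j) / of_nat CARD('n))"
    for u :: "'n::finite \<Rightarrow> complex"
    unfolding normalized_exp_def by (simp only: exp_sum[OF finite])
  then show ?thesis by (simp add: sum_subtractf)
qed

lemma normalized_exp_eq_iff: "normalized_exp u i = normalized_exp u j \<longleftrightarrow> exp (u i - u j) = 1"
  unfolding normalized_exp_def by (simp add: exp_diff)

context cyclic_index
begin

text \<open>
  The parametrization of one piece by the logarithms \<open>u $ k\<close> of the diagonals with \<open>k \<noteq> k0\<close>; the generator \<open>k0\<close> is
  the cyclic matrix itself.
\<close>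

definition param :: "'l::finite \<Rightarrow> ('l \<Rightarrow> nat) \<Rightarrow> complex^'p^'l \<Rightarrow> 'l \<Rightarrow> complex^'p^'p" where
  "param k0 e u = monomial e (\<lambda>k. if k = k0 then (\<lambda>_. 1) else normalized_exp (\<lambda>i. u $ k $ i))"

lemma p_ge_2: "CARD('p) \<ge> 2"
  using p_gt_1 by simp

lemma param_SL: "param k0 e u \<in> SL_tuples"
  unfolding param_def by (rule monomial_SL) (simp add: prod_normalized_exp)

lemma monomial_bad_tuples:
  fixes e :: "'l::finite \<Rightarrow> nat"
  assumes "e k0 = 1" "\<And>k. (\<Prod>i\<in>UNIV. s k i) = 1" "irreducible_tuple (monomial e s)"
  shows "monomial e s \<in> bad_tuples"
  using monomial_bad[of s e k0] monomial_SL[of s e] assms by (simp add: bad_tuples_def)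

lemma param_bad_iff:
  fixes k0 :: "'l::finite"
  assumes e: "e k0 = 1"
  shows "param k0 e u \<in> bad_tuples \<longleftrightarrow> (\<exists>k i j. k \<noteq> k0 \<and> exp (u $ k $ i - u $ k $ j) \<noteq> 1)"
proof
  assume "param k0 e u \<in> bad_tuples"
  then have irr: "irreducible_tuple (param k0 e u)"
    using bad_tuples_subset irr_tuples_iff[OF p_ge_2] by blast
  show "\<exists>k i j. k \<noteq> k0 \<and> exp (u $ k $ i - u $ k $ j) \<noteq> 1"
  proof (rule monomial_irreducible_nonscalar[OF _ irr[unfolded param_def]])
    fix k i j assume "(if k = k0 then (\<lambda>_. 1) else normalized_exp (\<lambda>i. u $ k $ i)) i \<noteq>
        (if k = k0 then (\<lambda>_. 1) else normalized_exp (\<lambda>i. u $ k $ i)) j"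
    then show ?thesis by (auto simp: normalized_exp_eq_iff split: if_splits)
  qed (simp add: prod_normalized_exp)
next
  assume "\<exists>k i j. k \<noteq> k0 \<and> exp (u $ k $ i - u $ k $ j) \<noteq> 1"
  then obtain k i j where k: "k \<noteq> k0" "exp (u $ k $ i - u $ k $ j) \<noteq> 1" by blast
  have "irreducible_tuple (param k0 e u)"
    unfolding param_def
    by (rule monomial_irreducible[where ?k0.0 = k0 and ?k1.0 = k and a = i and b = j])
       (use e k in \<open>simp_all add: normalized_exp_eq_iff\<close>)
  then show "param k0 e u \<in> bad_tuples"
    using e by (auto simp: param_def prod_normalized_exp intro!: monomial_bad_tuples)
qed

text \<open>
  Logarithms of the entries, divided by the entry at \<open>i0\<close>, are parameters; the determinant condition leaves
  an ambiguity by a scalar only, which PSL ignores. The normalization at \<open>i0\<close> and \<open>k0\<close> leaves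
  \<open>(p - 1) * (l - 1)\<close> free parameters.
\<close>

lemma monomial_as_param:
  fixes e :: "'l::finite \<Rightarrow> nat"
  assumes e: "e k0 = 1" and s: "s k0 = (\<lambda>_. 1)" "\<And>k. (\<Prod>i\<in>UNIV. s k i) = 1"
    and irr: "irreducible_tuple (monomial e s)"
  obtains u where "\<And>k i. k = k0 \<or> i = i0 \<Longrightarrow> u $ k $ i = 0" "param k0 e u \<in> bad_tuples"
    "tuple_class (monomial e s) = tuple_class (param k0 e u)"
proof -
  have s0: "s k i \<noteq> 0" for k i using s(2)[of k] by (metis UNIV_I finite prod_zero zero_neq_one)
  have SL: "monomial e s \<in> SL_tuples" by (rule monomial_SL) (rule s(2))
  define u :: "complex^'p^'l" where "u = (\<chi> k i. if k = k0 \<or> i = i0 then 0 else Ln (s k i / s k i0))"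
  define c where "c k = (if k = k0 then 1 else exp (- (\<Sum>j\<in>UNIV. u $ k $ j) / of_nat CARD('p)) / s k i0)" for k
  have "normalized_exp (\<lambda>i. u $ k $ i) i = c k * s k i" if "k \<noteq> k0" for k i
  proof -
    have "exp (u $ k $ i) = s k i / s k i0" using that s0 by (auto simp: u_def)
    moreover have "normalized_exp (\<lambda>i. u $ k $ i) i = exp (u $ k $ i) / exp ((\<Sum>j\<in>UNIV. u $ k $ j) / of_nat CARD('p))"
      by (simp only: normalized_exp_def exp_diff)
    moreover have "c k = inverse (exp ((\<Sum>j\<in>UNIV. u $ k $ j) / of_nat CARD('p))) / s k i0"
      using that by (simp only: c_def if_False exp_minus minus_divide_left[symmetric])
    ultimately show ?thesis by (simp only: divide_inverse mult_ac)
  qed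
  then have "(if k = k0 then (\<lambda>_. 1) else normalized_exp (\<lambda>i. u $ k $ i)) = (\<lambda>i. c k * s k i)" for k
    using s(1) by (auto simp: c_def fun_eq_iff)
  then have "param k0 e u k = mat (c k) ** monomial e s k" for k
    by (simp add: param_def monomial_def diag_scale matrix_mul_assoc)
  then have "mat 1 ** param k0 e u k = mat (c k) ** (monomial e s k ** mat 1)" for k by simp
  then have eq: "tuple_class (param k0 e u) = tuple_class (monomial e s)"
    unfolding tuple_class_def
    by (intro conj_class_eqI[OF param_SL SL, where g = "mat 1" and c = c]) auto
  have "monomial e s \<in> irr_tuples" using irr SL irr_tuples_iff[OF p_ge_2] by blast
  then have "param k0 e u \<in> irr_tuples"
    by (rule irr_tuples_class[OF p_ge_2 _ param_SL eq[symmetric]])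
  then have "irreducible_tuple (param k0 e u)" using irr_tuples_iff[OF p_ge_2] by blast
  then have "param k0 e u \<in> bad_tuples"
    using e by (auto simp: param_def prod_normalized_exp intro!: monomial_bad_tuples)
  then show ?thesis using eq by (intro that[of u]) (auto simp: u_def)
qed

lemma bad_tuple_as_param:
  fixes A :: "'l::finite \<Rightarrow> complex^'p^'p"
  assumes "A \<in> bad_tuples"
  obtains k0 e u where "e k0 = 1" "\<And>k. e k < CARD('p)" "\<And>k i. k = k0 \<or> i = i0 \<Longrightarrow> u $ k $ i = 0"
    "param k0 e u \<in> bad_tuples" "tuple_class A = tuple_class (param k0 e u)"
proof -
  have A: "A \<in> SL_tuples" "proj_tuple A \<in> bad_reps" "A \<in> irr_tuples"
    using assms bad_tuples_subset by (auto simp: bad_tuples_def)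
  show ?thesis
  proof (rule bad_normal_form[OF A(1,2)])
    fix e k0 s assume e: "e k0 = 1" "\<And>k. e k < CARD('p)" and s: "s k0 = (\<lambda>_. 1)" "\<And>k. (\<Prod>i\<in>UNIV. s k i) = 1"
      and eq: "conj_class (proj_tuple A) = conj_class (proj_tuple (monomial e s))"
    have eq: "tuple_class A = tuple_class (monomial e s)" using eq by (simp add: tuple_class_def)
    have SL: "monomial e s \<in> SL_tuples" by (rule monomial_SL) (rule s(2))
    have "irreducible_tuple (monomial e s)"
      using irr_tuples_class[OF p_ge_2 A(3) SL eq] irr_tuples_iff[OF p_ge_2] by blast
    with e(1) s show ?thesis
    proof (rule monomial_as_param[where e = e and s = s and ?k0.0 = k0 and ?i0.0 = i0])
      fix u assume u: "\<And>k i. k = k0 \<or> i = i0 \<Longrightarrow> u $ k $ i = 0" "param k0 e u \<in> bad_tuples"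
        "tuple_class (monomial e s) = tuple_class (param k0 e u)"
      show ?thesis
      proof (rule that[of e k0 u])
        show "tuple_class A = tuple_class (param k0 e u)" using eq u(3) by simp
      qed (fact e u)+
    qed
  qed
qed

lemma continuous_param: "continuous_on UNIV (param k0 e)"
proof -
  have "continuous_on UNIV (\<lambda>u. param k0 e u k $ i $ j)" for k i j
    by (cases "k = k0")
       (auto simp: param_def monomial_def normalized_exp_def intro!: continuous_intros)
  then have "continuous_on UNIV (\<lambda>u. \<chi> i j. param k0 e u k $ i $ j)" for k
    by (intro continuous_on_vec_lambda)
  then show ?thesis
    by (intro continuous_on_coordinatewise_then_product) simp
qed

definition piece :: "'l::finite \<Rightarrow> ('l \<Rightarrow> nat) \<Rightarrow> ('l \<Rightarrow> (complex^'p^'p) set) set set" where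
  "piece k0 e = (\<lambda>u. tuple_class (param k0 e u)) ` {u. param k0 e u \<in> bad_tuples}"

lemma continuous_map_param_class:
  fixes f :: "'a::topological_space \<Rightarrow> complex^'p^'l::finite"
  assumes f: "continuous_on S f" and b: "\<And>x. x \<in> S \<Longrightarrow> param k0 e (f x) \<in> bad_tuples"
  shows "continuous_map (top_of_set S) sing_locus (\<lambda>x. tuple_class (param k0 e (f x)))"
proof (rule continuous_map_sing_locus)
  have "continuous_on S (\<lambda>x. param k0 e (f x))"
    using continuous_on_compose2[OF continuous_param f] by simp
  then show "continuous_map (top_of_set S) (top_of_set SL_tuples) (\<lambda>x. param k0 e (f x))"
    by (auto simp: continuous_map_in_subtopology param_SL)
qed (use b in simp)

text \<open>
  The line \<open>(1 - w) u + w v\<close> joins two admissible parameters. A pair of entries of \<open>u\<close> with different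
  exponentials gives a function \<open>exp (a + b w)\<close> which is not constantly 1, and the inadmissible \<open>w\<close> are among
  the countably many places where it is 1.
\<close>

lemma connectedin_piece:
  fixes k0 :: "'l::finite"
  assumes e: "e k0 = 1"
  shows "connectedin sing_locus (piece k0 e)"
proof (cases "{u. param k0 e u \<in> bad_tuples} = {}")
  case True
  then show ?thesis by (simp add: piece_def connectedin_empty)
next
  case False
  then obtain u where u: "param k0 e u \<in> bad_tuples" by blast
  define line where "line v w = (\<chi> k i. (1 - w) * u $ k $ i + w * v $ k $ i)" for v :: "complex^'p^'l" and w
  define G where "G v = {w. param k0 e (line v w) \<in> bad_tuples}" for v
  define L where "L v = (\<lambda>w. tuple_class (param k0 e (line v w))) ` G v" for v
  have l01: "line v 0 = u" "line v 1 = v" for v by (simp_all add: line_def vec_eq_iff)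
  obtain k i j where k: "k \<noteq> k0" "exp (u $ k $ i - u $ k $ j) \<noteq> 1"
    using u param_bad_iff[where u = u and e = e and ?k0.0 = k0, OF e] by blast
  have conn: "connectedin sing_locus (L v)" for v
  proof -
    define a b where "a = u $ k $ i - u $ k $ j" and "b = (v $ k $ i - v $ k $ j) - a"
    have ex: "line v w $ k $ i - line v w $ k $ j = a + b * w" for w
      by (simp add: line_def a_def b_def algebra_simps)
    have "- G v \<subseteq> range (\<lambda>n::int. (\<i> * (2 * of_int n * of_real pi) - a) / b)"
    proof
      fix w assume "w \<in> - G v"
      then have "param k0 e (line v w) \<notin> bad_tuples" by (simp add: G_def)
      then have "exp (line v w $ k $ i - line v w $ k $ j) = 1"
        using param_bad_iff[of e k0 "line v w", OF e] k(1) by blast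
      then have w: "exp (a + b * w) = 1" by (simp add: ex)
      then obtain n :: int where n: "Re (a + b * w) = 0" "Im (a + b * w) = of_int (2 * n) * pi"
        unfolding exp_eq_1 by blast
      have n: "a + b * w = \<i> * (2 * of_int n * of_real pi)"
        using n by (intro complex_eqI) (simp_all only: n, simp_all)
      have "b \<noteq> 0" using w k(2) by (auto simp: a_def)
      then have "w = (\<i> * (2 * of_int n * of_real pi) - a) / b" unfolding n[symmetric] by simp
      then show "w \<in> range (\<lambda>n::int. (\<i> * (2 * of_int n * of_real pi) - a) / b)" by (rule range_eqI)
    qed
    then have "countable (- G v)" by (rule countable_subset) simp
    then have "path_connected (- (- G v))" by (intro path_connected_complement_countable) simp_all
    then have "connected (G v)" by (simp add: path_connected_imp_connected)
    then have c: "connectedin (top_of_set (G v)) (G v)"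
      by (simp add: connectedin_subtopology connectedin_iff_connected)
    have "continuous_map (top_of_set (G v)) sing_locus (\<lambda>w. tuple_class (param k0 e (line v w)))"
    proof (rule continuous_map_param_class)
      show "continuous_on (G v) (line v)" unfolding line_def by (intro continuous_intros)
    qed (simp add: G_def)
    then show ?thesis unfolding L_def using c by (rule connectedin_continuous_map_image)
  qed
  let ?F = "L ` {v. param k0 e v \<in> bad_tuples}"
  have "connectedin sing_locus (\<Union>?F)"
  proof (rule connectedin_Union)
    have "tuple_class (param k0 e u) \<in> L v" for v
      unfolding L_def by (rule image_eqI[of _ _ 0]) (use u in \<open>simp_all add: G_def l01\<close>)
    then show "\<Inter>?F \<noteq> {}" by blast
  qed (use conn in blast)
  moreover have "\<Union>?F = piece k0 e"
  proof (intro equalityI subsetI)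
    fix x assume "x \<in> piece k0 e"
    then obtain v where v: "param k0 e v \<in> bad_tuples" "x = tuple_class (param k0 e v)"
      by (auto simp: piece_def)
    have "x \<in> L v" unfolding L_def by (rule image_eqI[of _ _ 1]) (use v in \<open>simp_all add: G_def l01\<close>)
    then show "x \<in> \<Union>?F" using v by blast
  qed (auto simp: L_def G_def piece_def)
  ultimately show ?thesis by simp
qed

lemma monomial_class_in_piece:
  fixes e :: "'l::finite \<Rightarrow> nat"
  assumes "e k0 = 1" "s k0 = (\<lambda>_. 1)" "\<And>k. (\<Prod>i\<in>UNIV. s k i) = 1" "irreducible_tuple (monomial e s)"
  shows "tuple_class (monomial e s) \<in> piece k0 e"
proof -
  obtain u where "param k0 e u \<in> bad_tuples" "tuple_class (monomial e s) = tuple_class (param k0 e u)"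
    by (rule monomial_as_param[of e k0 s, OF assms])
  then show ?thesis by (auto simp: piece_def)
qed

text \<open>
  The witness sends each generator to a power of the cyclic matrix, and \<open>k2\<close> to such a power times a
  diagonal matrix \<open>t\<close> of order \<open>p\<close> in PSL. By construction its class lies in the piece of \<open>e\<close>. But the cyclic
  matrix commutes with all these generators except \<open>k2\<close>, where a root of unity appears; the
  normal form with respect to the cyclic matrix therefore belongs to the piece in which \<open>k2\<close> has exponent 1 and the others
  have exponent 0.
\<close>

lemma piece_meets_hub:
  fixes e :: "'l::finite \<Rightarrow> nat"
  assumes e: "e k0 = 1" and k2: "k2 \<noteq> k0"
  shows "piece k0 e \<inter> piece k2 (\<lambda>k. if k = k2 then 1 else 0) \<noteq> {}"
proof -
  define z where "z = cis (2 * pi / CARD('p))"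
  have z: "z ^ CARD('p) = 1" "z \<noteq> 1" using zeta by (simp_all add: z_def)
  have z0: "z \<noteq> 0" by (simp add: z_def)
  obtain d where d: "1 / (\<Prod>i\<in>UNIV. z ^ ix i) = d ^ CARD('p)"
    using exists_complex_root[of "CARD('p)" "1 / (\<Prod>i\<in>UNIV. z ^ ix i)"] p_gt_1 by (metis not_one_less_zero)
  have d1: "d ^ CARD('p) * (\<Prod>i\<in>UNIV. z ^ ix i) = 1" unfolding d[symmetric] using z0 by simp
  then have d0: "d \<noteq> 0" using p_gt_1 by (auto simp: power_0_left)
  define t where "t i = d * z ^ ix i" for i
  define s where "s k = (if k = k2 then t else (\<lambda>_. 1))" for k :: 'l
  have s: "s k0 = (\<lambda>_. 1)" "(\<Prod>i\<in>UNIV. s k i) = 1" for k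
    using k2 d1 by (auto simp: s_def t_def prod.distrib)
  have "s k2 (pos 0) \<noteq> s k2 (pos 1)" using z(2) d0 p_gt_1 by (simp add: s_def t_def)
  then have irr: "irreducible_tuple (monomial e s)"
    by (rule monomial_irreducible[where e = e and s = s and ?k0.0 = k0, OF e s(1)])
  then have in1: "tuple_class (monomial e s) \<in> piece k0 e" by (intro monomial_class_in_piece e s)
  let ?e = "\<lambda>k. if k = k2 then 1 else 0 :: nat"
  \<comment> \<open>Moving the cyclic matrix past \<open>t\<close> from the left produces the inverse of \<open>z\<close>.\<close>
  define w where "w = inverse z"
  have w: "w ^ CARD('p) = 1" "w \<noteq> 1" using z by (simp_all add: w_def power_inverse)
  have ts: "t (pos (Suc (ix j))) = z * t j" for j
    unfolding t_def root_shift[OF z(1)] by simp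
  have ct: "cyc 1 ** diag t = mat w ** (diag t ** cyc 1)"
    unfolding diag_cyc by (simp add: vec_eq_iff ts) (simp add: w_def z0)
  have cc: "cyc 1 ** cyc n = cyc n ** cyc 1" for n by (simp only: cyc_add add.commute)
  have "cyc 1 ** monomial e s k = mat (w ^ ?e k) ** (monomial e s k ** cyc 1)" for k
  proof (cases "k = k2")
    case True
    have m: "monomial e s k = diag t ** cyc (e k)" by (simp add: monomial_def s_def True)
    have "cyc 1 ** monomial e s k = (cyc 1 ** diag t) ** cyc (e k)"
      unfolding m by (rule matrix_mul_assoc)
    also have "\<dots> = mat w ** (diag t ** (cyc 1 ** cyc (e k)))"
      unfolding ct by (simp only: matrix_mul_assoc)
    also have "\<dots> = mat w ** (monomial e s k ** cyc 1)"
      unfolding cc m by (simp only: matrix_mul_assoc)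
    finally show ?thesis by (simp add: True)
  next
    case False
    have m: "monomial e s k = cyc (e k)" by (simp add: monomial_def s_def False diag_const)
    show ?thesis unfolding m cc by (simp add: False)
  qed
  note M = this
  have dc: "det (cyc 1) \<noteq> 0" by simp
  have SL: "monomial e s \<in> SL_tuples" by (rule monomial_SL) (rule s)
  show ?thesis
  proof (rule normal_form[where e = ?e and ?k0.0 = k2, OF SL dc M w])
    fix s' assume s': "s' k2 = (\<lambda>_. 1)" "\<And>k. (\<Prod>i\<in>UNIV. s' k i) = 1"
      and eq: "conj_class (proj_tuple (monomial e s)) = conj_class (proj_tuple (monomial ?e s'))"
    have eq: "tuple_class (monomial e s) = tuple_class (monomial ?e s')" using eq by (simp add: tuple_class_def)
    have "monomial e s \<in> irr_tuples" using irr SL irr_tuples_iff[OF p_ge_2] by blast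
    then have "monomial ?e s' \<in> irr_tuples"
      by (rule irr_tuples_class[OF p_ge_2 _ monomial_SL eq]) (rule s')
    then have "irreducible_tuple (monomial ?e s')" using irr_tuples_iff[OF p_ge_2] by blast
    then have "tuple_class (monomial ?e s') \<in> piece k2 ?e" by (intro monomial_class_in_piece s') simp
    then show ?thesis using in1 eq by auto
  qed simp
qed

text \<open>
  Any two hubs meet, and every piece meets a hub; with at least two generators there is always an
  index different from \<open>k0\<close>.
\<close>

theorem connected_space_sing_locus:
  assumes l: "2 \<le> CARD('l::finite)"
  shows "connected_space (sing_locus :: ('l \<Rightarrow> (complex^'p^'p) set) set topology)"
proof -
  define hub :: "'l \<Rightarrow> ('l \<Rightarrow> (complex^'p^'p) set) set set" where
    "hub k = piece k (\<lambda>j. if j = k then 1 else 0)" for k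
  have hub: "connectedin sing_locus (hub k)" for k unfolding hub_def by (rule connectedin_piece) simp
  have meet: "piece k0 e \<inter> hub k2 \<noteq> {}" if "e k0 = 1" "k2 \<noteq> k0" for k0 k2 :: 'l and e
    unfolding hub_def by (rule piece_meets_hub[where e = e and ?k0.0 = k0, OF that])
  fix a :: 'l
  have other: "\<exists>k2. k2 \<noteq> k0" for k0 :: 'l
  proof (rule ccontr)
    assume "\<nexists>k2. k2 \<noteq> k0"
    then have "(UNIV :: 'l set) = {k0}" by auto
    then have "CARD('l) = 1" by (metis card_1_singleton_iff One_nat_def)
    then show False using l by simp
  qed
  define K where "K = (\<Union>k. hub a \<union> hub k)"
  have ne: "hub k \<noteq> {}" for k :: 'l
  proof -
    obtain k0 where "k0 \<noteq> k" using other by blast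
    then show ?thesis using meet[of "\<lambda>_. 1" k0 k] by auto
  qed
  have "connectedin sing_locus (hub a \<union> hub k)" for k
  proof (cases "k = a")
    case False
    have "hub a \<inter> hub k \<noteq> {}" using meet[of "\<lambda>j. if j = a then 1 else 0" a k] False by (simp add: hub_def)
    then show ?thesis using hub by (intro connectedin_Un)
  qed (simp add: hub)
  then have K: "connectedin sing_locus K"
    unfolding K_def using ne[of a] by (intro connectedin_Union) auto
  have P: "connectedin sing_locus (piece k0 e \<union> K)" if "e k0 = 1" for k0 :: 'l and e
  proof -
    obtain k2 where "k2 \<noteq> k0" using other by blast
    then have "piece k0 e \<inter> K \<noteq> {}" using meet[of e k0 k2, OF that] by (auto simp: K_def)
    then show ?thesis using K connectedin_piece[of e k0, OF that] by (intro connectedin_Un)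
  qed
  let ?F = "{piece k0 e \<union> K |k0 e. e k0 = 1}"
  have Kne: "K \<noteq> {}" using ne[of a] by (auto simp: K_def)
  have "connectedin sing_locus (\<Union>?F)"
    by (rule connectedin_Union) (use P Kne in auto)
  moreover have "\<Union>?F = topspace sing_locus"
  proof (intro equalityI subsetI)
    fix x :: "('l \<Rightarrow> (complex^'p^'p) set) set" assume "x \<in> topspace sing_locus"
    then obtain A :: "'l \<Rightarrow> complex^'p^'p" where A: "A \<in> bad_tuples" "x = tuple_class A" by (auto simp: topspace_sing_locus)
    obtain k0 e u where "e k0 = 1" "param k0 e u \<in> bad_tuples" "tuple_class A = tuple_class (param k0 e u)"
      using A(1) by (rule bad_tuple_as_param)
    then have "x \<in> piece k0 e" "e k0 = 1" using A(2) by (auto simp: piece_def)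
    then show "x \<in> \<Union>?F" by blast
  next
    fix x assume "x \<in> \<Union>?F"
    then show "x \<in> topspace sing_locus"
      using connectedin_subset_topspace[OF K] by (auto simp: piece_def topspace_sing_locus)
  qed
  ultimately show ?thesis by (simp add: connectedin_topspace)
qed

end

section \<open>The upper bound for the dimension\<close>

lemma differentiable_exp:
  fixes f :: "'a::real_normed_vector \<Rightarrow> complex"
  assumes "f differentiable (at x within S)"
  shows "(\<lambda>x. exp (f x)) differentiable (at x within S)"
proof -
  obtain D where "(f has_derivative D) (at x within S)" using assms by (auto simp: differentiable_def)
  from has_derivative_compose[OF this DERIV_exp[unfolded has_field_derivative_def]]
  show ?thesis by (auto simp: differentiable_def)
qed

lemma bounded_linear_axis: "bounded_linear (axis i :: 'b::euclidean_space \<Rightarrow> 'b^'n)"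
proof (rule bounded_linear_intro)
  show "norm (axis i x :: 'b^'n) \<le> norm x * 1" for x by (simp add: norm_eq_sqrt_inner inner_axis_axis)
qed (simp_all add: vec_eq_iff axis_def)

lemma differentiable_vec:
  fixes f :: "'a::real_normed_vector \<Rightarrow> 'b::euclidean_space^'n"
  assumes "\<And>i. (\<lambda>x. f x $ i) differentiable (at x within S)"
  shows "f differentiable (at x within S)"
proof -
  have "(\<lambda>x. \<Sum>i\<in>UNIV. axis i (f x $ i)) differentiable (at x within S)"
  proof (intro differentiable_sum ballI finite)
    fix i
    obtain D where "((\<lambda>x. f x $ i) has_derivative D) (at x within S)"
      using assms[of i] by (auto simp: differentiable_def)
    from bounded_linear.has_derivative[OF bounded_linear_axis this]
    show "(\<lambda>x. axis i (f x $ i) :: 'b^'n) differentiable (at x within S)" by (auto simp: differentiable_def)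
  qed
  moreover have "(\<lambda>x. \<Sum>i\<in>UNIV. axis i (f x $ i)) = f"
    by (auto simp: fun_eq_iff vec_eq_iff axis_def if_distrib cong: if_cong)
  ultimately show ?thesis by simp
qed

lemma differentiable_component2: "(\<lambda>u :: complex^'p^'l. u $ k $ i) differentiable (at x within S)"
proof -
  have "bounded_linear (\<lambda>u :: complex^'p^'l. u $ k $ i)"
    by (intro bounded_linear_compose[OF bounded_linear_vec_nth bounded_linear_vec_nth])
  then show ?thesis by (rule bounded_linear_imp_differentiable)
qed

lemma holo_comp_differentiable:
  fixes F :: "'e::real_normed_vector \<Rightarrow> 'i \<Rightarrow> complex"
  assumes "finite I" "holo I U f" "F x \<in> U" "\<And>y i. i \<notin> I \<Longrightarrow> F y i = 0"
    and "\<And>i. i \<in> I \<Longrightarrow> (\<lambda>y. F y i) differentiable (at x within S)"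
  shows "(\<lambda>y. f (F y)) differentiable (at x within S)"
proof -
  have "\<forall>i\<in>I. \<exists>D. ((\<lambda>y. F y i) has_derivative D) (at x within S)"
    using assms(5) unfolding differentiable_def by blast
  then obtain D where "\<forall>i\<in>I. ((\<lambda>y. F y i) has_derivative D i) (at x within S)"
    by (rule bchoice[THEN exE])
  then have D: "\<And>i. i \<in> I \<Longrightarrow> ((\<lambda>y. F y i) has_derivative D i) (at x within S)" by blast
  show ?thesis
    by (rule holo_chain[OF assms(1,2,3,4) D]) (auto simp: differentiable_def)
qed

context cyclic_index
begin

lemma param_differentiable:
  fixes f :: "'a::real_normed_vector \<Rightarrow> complex^'p^'l::finite"
  assumes "\<And>k i. (\<lambda>x. f x $ k $ i) differentiable (at x within S)"
  shows "(\<lambda>x. flat_tuple (param k0 e (f x)) m) differentiable (at x within S)"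
proof -
  obtain k i j where m: "m = (k, i, j)" by (cases m)
  have "(\<lambda>x. normalized_exp (\<lambda>i. f x $ k $ i) i) differentiable (at x within S)"
    unfolding normalized_exp_def divide_inverse
    by (intro differentiable_exp differentiable_diff differentiable_mult differentiable_sum assms differentiable_const ballI finite)
  then have "(\<lambda>x. normalized_exp (\<lambda>i. f x $ k $ i) i * cyc (e k) $ i $ j) differentiable (at x within S)"
    by (intro differentiable_mult differentiable_const)
  then show ?thesis by (cases "k = k0") (simp_all add: m flat_tuple_def param_def monomial_def)
qed

text \<open>
  Relabels the parameters so that, for every \<open>k0\<close>, the free ones are those outside the row \<open>l0\<close> and the column
  \<open>pos 0\<close>: all pieces can then be compared in one and the same space.
\<close>

definition normalized_source :: "'l::finite \<Rightarrow> 'l \<Rightarrow> complex^'p^'l \<Rightarrow> complex^'p^'l" where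
  "normalized_source l0 k0 u = (\<chi> k i. if k = k0 \<or> i = pos 0 then 0 else u $ (Transposition.transpose k0 l0 k) $ i)"

text \<open>
  If \<open>d\<close> were larger than the number of free parameters, \<open>d\<close> coordinates of the chart would outnumber them
  by at least one. The map \<open>F\<close> replaces the free parameters, and one more coordinate which is 0 on the source, by
  coordinates of the chart and keeps the remaining coordinates; this is a differentiable map from a
  hyperplane to the space containing it, so its image is a null set. But the images of the finitely many pieces cover
  an open set.
\<close>

lemma chart_dim_le:
  fixes V :: "('l::finite \<Rightarrow> (complex^'p^'p) set) set set"
  assumes V: "V \<noteq> {}" and chart: "complex_chart sing_locus sing_locus_sheaf d V U \<phi>"
  shows "d \<le> (CARD('p) - 1) * (CARD('l) - 1)"
proof (rule ccontr)
  assume "\<not> ?thesis"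
  then have d: "d > (CARD('p) - 1) * (CARD('l) - 1)" by simp
  have Vop: "openin sing_locus V" and Uop: "openin (complex_space {..<d}) U"
    and hom: "homeomorphic_map (subtopology sing_locus V) (subtopology (complex_space {..<d}) U) \<phi>"
    and sh: "\<And>U' f. openin (complex_space {..<d}) U' \<Longrightarrow> U' \<subseteq> U \<Longrightarrow>
      holo {..<d} U' f \<longleftrightarrow> sing_locus_sheaf {x \<in> V. \<phi> x \<in> U'} (f \<circ> \<phi>)"
    using chart by (auto simp: complex_chart_def)
  have Vsub: "V \<subseteq> tuple_class ` bad_tuples" using openin_subset[OF Vop] by (simp add: topspace_sing_locus)
  have \<phi>V: "\<phi> ` V = U"
    using homeomorphic_imp_surjective_map[OF hom] openin_subset[OF Vop] openin_subset[OF Uop]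
    by (simp add: Int_absorb1)
  have coord: "sing_locus_sheaf V (\<lambda>x. \<phi> x m)" for m
  proof -
    have "{x \<in> V. \<phi> x \<in> U} = V" using \<phi>V by auto
    then show ?thesis using sh[OF Uop order_refl, of "\<lambda>z. z m"] holo_coordinate[OF Uop, of m] by (simp add: o_def)
  qed
  fix l0 :: 'l
  \<comment> \<open>The free parameters have their positions in \<open>J\<close>; the additional position is \<open>(l0, pos 0)\<close>.\<close>
  define J where "J = {(k::'l, i::'p). k \<noteq> l0 \<and> i \<noteq> pos 0}"
  define J' where "J' = insert (l0, pos 0) J"
  have "J = (UNIV - {l0}) \<times> (UNIV - {pos 0})" by (auto simp: J_def)
  then have "card J = (CARD('l) - 1) * (CARD('p) - 1)" by (simp add: card_cartesian_product card_Diff_singleton)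
  moreover have "(l0, pos 0) \<notin> J" by (simp add: J_def)
  ultimately have "card J' \<le> d" using d by (simp add: J'_def mult.commute)
  then have "\<exists>\<beta>. inj_on \<beta> J' \<and> \<beta> ` J' \<subseteq> {..<d}" by (subst inj_on_iff_card_le) simp_all
  then obtain \<beta> where \<beta>: "inj_on \<beta> J'" "\<beta> ` J' \<subseteq> {..<d}" by blast
  define src where "src = (normalized_source l0 :: 'l \<Rightarrow> _)"
  define F where "F = (\<lambda>(k0, e) u. \<chi> k i. if (k, i) \<in> J' then \<phi> (tuple_class (param k0 e (src k0 u))) (\<beta> (k, i)) else u $ k $ i)"
  define D where "D = (\<lambda>(k0, e). {u :: complex^'p^'l. u $ l0 $ pos 0 = 0 \<and> param k0 e (src k0 u) \<in> bad_tuples \<and> tuple_class (param k0 e (src k0 u)) \<in> V})"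
  define I where "I = {(k0, e) |(k0::'l) e. e k0 = 1 \<and> (\<forall>k. e k < CARD('p))}"
  have "I \<subseteq> UNIV \<times> (Pi\<^sub>E UNIV (\<lambda>_. {..<CARD('p)}))" by (auto simp: I_def)
  then have finI: "finite I" by (rule finite_subset) (intro finite_cartesian_product finite_PiE finite finite_lessThan)
  have src_diff: "(\<lambda>u. src k0 u $ k $ i) differentiable (at x within S)" for k0 k i x S
    by (cases "k = k0 \<or> i = pos 0") (auto simp: src_def normalized_source_def differentiable_component2)
  have src_cont: "continuous_on UNIV (src k0)" for k0
    unfolding differentiable_imp_continuous_on
    by (rule differentiable_imp_continuous_on) (auto simp: differentiable_on_def intro!: differentiable_vec src_diff)
  have comp_diff: "(\<lambda>u. \<phi> (tuple_class (param k0 e (src k0 u))) m) differentiable (at u within D (k0, e))"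
    if u: "u \<in> D (k0, e)" for k0 e u m
  proof -
    have u': "param k0 e (src k0 u) \<in> bad_tuples" "tuple_class (param k0 e (src k0 u)) \<in> V"
      using u by (auto simp: D_def)
    obtain U1 k where k: "holo UNIV U1 k" "flat_tuple (param k0 e (src k0 u)) \<in> U1"
      and eq: "\<And>B. B \<in> bad_tuples \<Longrightarrow> tuple_class B \<in> V \<Longrightarrow> flat_tuple B \<in> U1 \<Longrightarrow> \<phi> (tuple_class B) m = k (flat_tuple B)"
      using sing_locus_sheafD[OF coord u'] by metis
    have "open U1" using k(1) by (simp add: holo_def complex_space_UNIV)
    moreover have "continuous_on UNIV (\<lambda>v. flat_tuple (param k0 e (src k0 v)))"
      by (intro continuous_on_coordinatewise_then_product differentiable_imp_continuous_on)
         (auto simp: differentiable_on_def intro!: param_differentiable src_diff)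
    ultimately have "open ((\<lambda>v. flat_tuple (param k0 e (src k0 v))) -` U1)" by (rule open_vimage)
    then obtain \<delta> where \<delta>: "\<delta> > 0" "ball u \<delta> \<subseteq> (\<lambda>v. flat_tuple (param k0 e (src k0 v))) -` U1"
      using k(2) by (meson open_contains_ball vimageI)
    have "(\<lambda>v. k (flat_tuple (param k0 e (src k0 v)))) differentiable (at u within D (k0, e))"
      by (rule holo_comp_differentiable[where F = "\<lambda>v. flat_tuple (param k0 e (src k0 v))", OF _ k(1) k(2)])
         (auto intro: param_differentiable src_diff)
    then show ?thesis
    proof (rule differentiable_transform_within[OF _ \<delta>(1) u])
      fix v assume "v \<in> D (k0, e)" "dist v u < \<delta>"
      then show "k (flat_tuple (param k0 e (src k0 v))) = \<phi> (tuple_class (param k0 e (src k0 v))) m"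
        using \<delta>(2) eq[of "param k0 e (src k0 v)"] by (auto simp: D_def dist_commute subset_iff)
    qed
  qed
  have "F ke differentiable_on D ke" for ke
  proof -
    obtain k0 e where ke: "ke = (k0, e)" by (cases ke)
    show ?thesis
      unfolding differentiable_on_def
    proof (intro ballI differentiable_vec)
      fix u k i assume "u \<in> D ke"
      then show "(\<lambda>u. F ke u $ k $ i) differentiable (at u within D ke)"
        using comp_diff[of u k0 e] differentiable_component2[of k i u "D ke"]
        by (cases "(k, i) \<in> J'") (simp_all add: ke F_def)
    qed
  qed
  moreover have "negligible (D ke)" for ke
  proof (rule negligible_subset)
    show "negligible {u :: complex^'p^'l. axis l0 (axis (pos 0) 1) \<bullet> u = 0}"
      by (rule negligible_hyperplane) (simp add: axis_eq_0_iff)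
    show "D ke \<subseteq> {u. axis l0 (axis (pos 0) 1) \<bullet> u = 0}"
      by (auto simp: D_def inner_axis inner_commute)
  qed
  ultimately have "negligible (F ke ` D ke)" for ke
    by (intro negligible_differentiable_image_negligible[OF order_refl])
  then have neg: "negligible (\<Union>ke\<in>I. F ke ` D ke)" using finI by (intro negligible_Union) auto
  obtain z0 where z0: "z0 \<in> U" using V \<phi>V by auto
  obtain r where r: "r > 0" "polydisc {..<d} z0 r \<subseteq> U"
    using Uop z0 openin_complex_space_iff[of "{..<d}" U] by auto
  define Q where "Q = {t :: complex^'p^'l. \<forall>(k, i)\<in>J'. t $ k $ i \<in> ball (z0 (\<beta> (k, i))) r}"
  have "Q = (\<Inter>(k, i)\<in>J'. (\<lambda>t. t $ k $ i) -` ball (z0 (\<beta> (k, i))) r)" by (auto simp: Q_def)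
  moreover have "open ((\<lambda>t :: complex^'p^'l. t $ k $ i) -` ball (z0 (\<beta> (k, i))) r)" for k i
    by (intro open_vimage open_ball continuous_intros)
  ultimately have "open Q" by (simp only:) (intro open_INT finite ballI, auto)
  moreover have "(\<chi> k i. z0 (\<beta> (k, i))) \<in> Q" using r(1) by (auto simp: Q_def)
  ultimately have "\<not> negligible Q" by (intro open_not_negligible) auto
  moreover have "Q \<subseteq> (\<Union>ke\<in>I. F ke ` D ke)"
  proof
    fix t assume t: "t \<in> Q"
    define z where "z m = (if m \<in> \<beta> ` J' then (let ki = inv_into J' \<beta> m in t $ fst ki $ snd ki) else z0 m)" for m
    have z\<beta>: "z (\<beta> (k, i)) = t $ k $ i" if "(k, i) \<in> J'" for k i
      using that \<beta>(1) by (simp add: z_def)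
    have "z \<in> polydisc {..<d} z0 r"
      unfolding polydisc_def
    proof (intro CollectI conjI allI impI ballI)
      fix m assume "m \<notin> {..<d}"
      then have "m \<notin> \<beta> ` J'" using \<beta>(2) by blast
      moreover have "z0 m = 0" using z0 openin_subset[OF Uop] \<open>m \<notin> {..<d}\<close> by (auto simp: topspace_complex_space)
      ultimately show "z m = 0" by (simp add: z_def)
    next
      fix m assume "m \<in> {..<d}"
      show "cmod (z m - z0 m) < r"
      proof (cases "m \<in> \<beta> ` J'")
        case True
        then obtain k i where ki: "(k, i) \<in> J'" "m = \<beta> (k, i)" by auto
        then have "t $ k $ i \<in> ball (z0 m) r" using t by (auto simp: Q_def)
        then show ?thesis using z\<beta>[OF ki(1)] ki(2) by (simp add: dist_norm norm_minus_commute)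
      qed (use r(1) in \<open>simp add: z_def\<close>)
    qed
    then have "z \<in> \<phi> ` V" using r(2) \<phi>V by blast
    then obtain x where x: "x \<in> V" "\<phi> x = z" by blast
    then obtain A where A: "A \<in> bad_tuples" "x = tuple_class A" using Vsub by auto
    show "t \<in> (\<Union>ke\<in>I. F ke ` D ke)"
    proof (rule bad_tuple_as_param[OF A(1), of "pos 0"])
    fix e k0 u assume e: "e k0 = 1" "\<And>k. e k < CARD('p)" and u: "\<And>k i. k = k0 \<or> i = pos 0 \<Longrightarrow> u $ k $ i = 0"
      and b: "param k0 e u \<in> bad_tuples" "tuple_class A = tuple_class (param k0 e u)"
    \<comment> \<open>The source point \<open>v\<close> carries the parameters \<open>u\<close> in \<open>J\<close> and agrees with \<open>t\<close> where \<open>F\<close> is the identity.\<close>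
    define v where "v = (\<chi> k i. if (k, i) = (l0, pos 0) then 0 else if (k, i) \<in> J
      then u $ (Transposition.transpose k0 l0 k) $ i else t $ k $ i)"
    have src_v: "src k0 v = u"
    proof -
      have "src k0 v $ k $ i = u $ k $ i" for k i
      proof (cases "k = k0 \<or> i = pos 0")
        case True
        then show ?thesis using u by (simp add: src_def normalized_source_def)
      next
        case False
        then have "Transposition.transpose k0 l0 k \<noteq> l0" by (metis transpose_apply_first transpose_eq_iff)
        then show ?thesis using False by (auto simp: src_def normalized_source_def v_def J_def)
      qed
      then show ?thesis by (simp add: vec_eq_iff)
    qed
    have "v $ l0 $ pos 0 = 0" by (simp add: v_def)
    then have "v \<in> D (k0, e)" using b A x by (simp add: D_def src_v)
    moreover have "F (k0, e) v = t"
    proof -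
      have "F (k0, e) v $ k $ i = t $ k $ i" for k i
      proof (cases "(k, i) \<in> J'")
        case True
        then show ?thesis using z\<beta>[OF True] b A x by (simp add: F_def src_v)
      next
        case False
        then show ?thesis by (auto simp: F_def v_def J'_def)
      qed
      then show ?thesis by (simp add: vec_eq_iff)
    qed
    moreover have "(k0, e) \<in> I" using e by (auto simp: I_def)
    ultimately show "t \<in> (\<Union>ke\<in>I. F ke ` D ke)" by blast
    qed
  qed
  ultimately show False using neg negligible_subset by blast
qed

end

section \<open>Invariant functions on the representations\<close>

lemma scalar_mult_left: "(mat a ** X) ** Y = mat a ** (X ** Y)" for X :: "complex^'n^'n"
  by (rule matrix_mul_assoc[symmetric])

lemma scalar_mult_scalar: "(mat a ** X) ** (mat b ** Y) = mat (a * b) ** (X ** Y)" for X Y :: "complex^'n^'n"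
proof -
  have "(mat a ** X) ** (mat b ** Y) = mat b ** ((mat a ** X) ** Y)" by (rule mat_pull)
  also have "\<dots> = mat b ** (mat a ** (X ** Y))" by (simp only: scalar_mult_left)
  also have "\<dots> = mat (b * a) ** (X ** Y)" by (rule mat_mult_mat_assoc)
  finally show ?thesis by (simp only: mult.commute[of b])
qed

lemma scalar_conj: "h ** (mat c ** X) ** g = mat c ** (h ** X ** g)" for h X g :: "complex^'n^'n"
  by (simp only: mat_pull scalar_mult_left)

primrec mpow :: "complex^'n^'n \<Rightarrow> nat \<Rightarrow> complex^'n^'n" where
  "mpow B 0 = mat 1"
| "mpow B (Suc n) = B ** mpow B n"

text \<open>
  The representative of trace 1 of a class in PGL; unlike a matrix of determinant 1 it is determined by
  the class, not only up to a root of unity.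
\<close>

definition trace_normalized :: "complex^'n^'n \<Rightarrow> complex^'n^'n" where
  "trace_normalized X = mat (1 / trace X) ** X"

lemma trace_mat_mult: "trace (mat c ** X) = c * trace (X :: complex^'n^'n)"
  by (simp add: trace_def sum_distrib_left)

lemma trace_mat: "trace (mat c :: complex^'n^'n) = c * of_nat CARD('n)"
  by (simp add: trace_def mat_def)

lemma trace_conj:
  assumes "g ** h = mat 1"
  shows "trace (h ** X ** g) = trace (X :: complex^'n^'n)"
proof -
  have "trace ((h ** X) ** g) = trace (g ** (h ** X))" by (rule trace_mul_sym)
  then show ?thesis by (simp add: matrix_mul_assoc assms)
qed

lemma mpow_conj:
  fixes B :: "complex^'n^'n"
  assumes "g ** h = mat 1" "h ** g = mat 1"
  shows "mpow (mat c ** (h ** B ** g)) n = mat (c ^ n) ** (h ** mpow B n ** g)"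
proof (induction n)
  case 0
  then show ?case using assms by simp
next
  case (Suc n)
  have "mpow (mat c ** (h ** B ** g)) (Suc n) = (mat c ** (h ** B ** g)) ** (mat (c ^ n) ** (h ** mpow B n ** g))"
    using Suc by simp
  also have "\<dots> = mat (c * c ^ n) ** ((h ** B ** g) ** (h ** mpow B n ** g))"
    by (rule scalar_mult_scalar)
  also have "(h ** B ** g) ** (h ** mpow B n ** g) = h ** B ** (g ** h) ** mpow B n ** g"
    by (simp only: matrix_mul_assoc)
  finally show ?case by (simp add: assms matrix_mul_assoc)
qed

lemma trace_normalized_conj:
  fixes g h X :: "complex^'n^'n"
  assumes "g ** h = mat 1" "c \<noteq> 0"
  shows "trace_normalized (mat c ** (h ** X ** g)) = h ** trace_normalized X ** g"
proof -
  have "trace_normalized (mat c ** (h ** X ** g)) = mat (1 / (c * trace X) * c) ** (h ** X ** g)"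
    by (simp add: trace_normalized_def trace_mat_mult trace_conj[OF assms(1)] mat_mult_mat_assoc)
  also have "1 / (c * trace X) * c = 1 / trace X" using assms(2) by simp
  also have "mat (1 / trace X) ** (h ** X ** g) = h ** (mat (1 / trace X) ** X) ** g"
    by (rule scalar_conj[symmetric])
  finally show ?thesis by (simp add: trace_normalized_def)
qed

lemma matrix_sum_left: "(\<Sum>a\<in>I. F a) ** X = (\<Sum>a\<in>I. F a ** X)" for X :: "complex^'n^'n"
proof -
  have "0 ** X = 0" by (simp add: vec_eq_iff matrix_matrix_mult_def)
  then show ?thesis by (induction I rule: infinite_finite_induct) (simp_all add: matrix_mult_add_left)
qed

lemma matrix_sum_right: "X ** (\<Sum>a\<in>I. F a) = (\<Sum>a\<in>I. X ** F a)" for X :: "complex^'n^'n"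
proof -
  have "X ** 0 = 0" by (simp add: vec_eq_iff matrix_matrix_mult_def)
  then show ?thesis by (induction I rule: infinite_finite_induct) (simp_all add: matrix_add_ldistrib)
qed

text \<open>
  The enumeration \<open>\<beta>\<close> numbers the coordinates: one for each \<open>k \<noteq> k0\<close> and each non-zero frequency \<open>j\<close>. The index
  \<open>k1\<close> carries the coordinate from which a \<open>p\<close>-th root is taken.
\<close>

locale chart_setup = cyclic_index ix for ix :: "'p::finite \<Rightarrow> nat" +
  fixes k0 k1 :: "'l::finite" and n :: nat and \<beta> :: "nat \<Rightarrow> 'l \<times> nat"
  assumes k1: "k1 \<noteq> k0" and \<beta>: "bij_betw \<beta> {..<n} {(k, j). k \<noteq> k0 \<and> 0 < j \<and> j < CARD('p)}"
begin

definition \<zeta> :: complex where "\<zeta> = cis (2 * pi / CARD('p))"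

lemma \<zeta>: "\<zeta> ^ CARD('p) = 1" "\<zeta> \<noteq> 1" "\<zeta> \<noteq> 0"
  using zeta by (simp_all add: \<zeta>_def)

lemma \<zeta>_inverse: "\<zeta> ^ a * inverse \<zeta> ^ a = 1"
  by (simp only: power_mult_distrib[symmetric] right_inverse[OF \<zeta>(3)] power_one)

lemma \<zeta>_inverse_power: "(inverse \<zeta> ^ j) ^ CARD('p) = 1"
proof -
  have "(inverse \<zeta> ^ j) ^ CARD('p) = (inverse \<zeta> ^ CARD('p)) ^ j"
    by (simp only: power_mult[symmetric] mult.commute)
  then show ?thesis by (simp only: power_inverse \<zeta>(1) inverse_1 power_one)
qed

text \<open>
  The Fourier transform on the integers modulo \<open>p\<close>, transported to the matrix indices.
\<close>

definition dft :: "('p \<Rightarrow> complex) \<Rightarrow> nat \<Rightarrow> complex" where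
  "dft s j = (\<Sum>m\<in>UNIV. inverse \<zeta> ^ (j * ix m) * s m)"

lemma sum_UNIV_ix: "(\<Sum>m\<in>UNIV. f (ix m)) = (\<Sum>a<CARD('p). f a)" for f :: "nat \<Rightarrow> 'b::comm_monoid_add"
  by (rule sum.reindex_bij_betw[OF ix_bij])

lemma orthogonality:
  assumes "j < CARD('p)" "j' < CARD('p)"
  shows "(\<Sum>m\<in>UNIV. inverse \<zeta> ^ (j * ix m) * \<zeta> ^ (j' * ix m)) = (if j = j' then of_nat CARD('p) else 0)"
proof -
  define w where "w = inverse \<zeta> ^ j * \<zeta> ^ j'"
  have "(\<Sum>m\<in>UNIV. inverse \<zeta> ^ (j * ix m) * \<zeta> ^ (j' * ix m)) = (\<Sum>m\<in>UNIV. w ^ ix m)"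
    by (simp add: w_def power_mult power_mult_distrib)
  also have "\<dots> = (\<Sum>a<CARD('p). w ^ a)" by (rule sum_UNIV_ix)
  also have "\<dots> = (if j = j' then of_nat CARD('p) else 0)"
  proof (cases "j = j'")
    case True
    then have "w = 1" using \<zeta>(3) by (simp add: w_def power_inverse)
    then show ?thesis using True by simp
  next
    case False
    have "w \<noteq> 1"
    proof
      assume "w = 1"
      then have "\<zeta> ^ j' = \<zeta> ^ j" using \<zeta>(3) by (simp add: w_def power_inverse field_simps)
      then show False using root_power_inj[OF prime \<zeta>(1,2) assms(2,1)] False by simp
    qed
    moreover have "w ^ CARD('p) = 1"
    proof -
      have "w ^ CARD('p) = inverse (\<zeta> ^ CARD('p)) ^ j * (\<zeta> ^ CARD('p)) ^ j'"
        by (simp only: w_def power_mult_distrib power_mult[symmetric] mult.commute power_inverse)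
      then show ?thesis by (simp add: \<zeta>(1))
    qed
    ultimately show ?thesis using False by (simp add: geometric_sum)
  qed
  finally show ?thesis .
qed

definition idft :: "(nat \<Rightarrow> complex) \<Rightarrow> 'p \<Rightarrow> complex" where
  "idft c m = (\<Sum>j<CARD('p). \<zeta> ^ (j * ix m) * c j) / of_nat CARD('p)"

lemma dft_idft:
  assumes "j < CARD('p)"
  shows "dft (idft c) j = c j"
proof -
  have "dft (idft c) j = (\<Sum>m\<in>UNIV. \<Sum>j'<CARD('p). inverse \<zeta> ^ (j * ix m) * \<zeta> ^ (j' * ix m) * c j' / of_nat CARD('p))"
    by (simp add: dft_def idft_def sum_divide_distrib sum_distrib_left mult.assoc)
  also have "\<dots> = (\<Sum>j'<CARD('p). (\<Sum>m\<in>UNIV. inverse \<zeta> ^ (j * ix m) * \<zeta> ^ (j' * ix m)) * c j' / of_nat CARD('p))"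
    by (subst sum.swap) (simp add: sum_divide_distrib sum_distrib_right)
  also have "\<dots> = (\<Sum>j'<CARD('p). if j = j' then c j' else 0)"
    by (rule sum.cong) (use assms orthogonality[of j] in auto)
  finally show ?thesis using assms by simp
qed

lemma idft_dft: "idft (dft s) m = s m"
proof -
  have orth: "(\<Sum>j<CARD('p). inverse \<zeta> ^ (j * ix m') * \<zeta> ^ (j * ix m)) = (if m' = m then of_nat CARD('p) else 0)" for m'
  proof -
    have "(\<Sum>j<CARD('p). inverse \<zeta> ^ (j * ix m') * \<zeta> ^ (j * ix m)) =
      (\<Sum>i\<in>UNIV. inverse \<zeta> ^ (ix m' * ix i) * \<zeta> ^ (ix m * ix i))"
      unfolding sum_UNIV_ix[of "\<lambda>j. inverse \<zeta> ^ (ix m' * j) * \<zeta> ^ (ix m * j)"] by (simp only: mult.commute)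
    also have "\<dots> = (if ix m' = ix m then of_nat CARD('p) else 0)" by (rule orthogonality) simp_all
    finally show ?thesis by (simp add: ix_eq_iff)
  qed
  have "idft (dft s) m = (\<Sum>j<CARD('p). \<Sum>m'\<in>UNIV. inverse \<zeta> ^ (j * ix m') * \<zeta> ^ (j * ix m) * s m' / of_nat CARD('p))"
    by (simp add: dft_def idft_def sum_divide_distrib sum_distrib_left mult_ac)
  also have "\<dots> = (\<Sum>m'\<in>UNIV. (\<Sum>j<CARD('p). inverse \<zeta> ^ (j * ix m') * \<zeta> ^ (j * ix m)) * s m' / of_nat CARD('p))"
    by (subst sum.swap) (simp add: sum_divide_distrib sum_distrib_right)
  also have "\<dots> = (\<Sum>m'\<in>UNIV. if m' = m then s m' else 0)"
    by (rule sum.cong) (auto simp: orth)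
  finally show ?thesis by simp
qed

lemma pos_shift_bij: "bij_betw (\<lambda>m. pos (ix m + t)) UNIV UNIV"
proof -
  have "inj (\<lambda>m. pos (ix m + t))"
  proof (rule injI)
    fix a b assume "pos (ix a + t) = pos (ix b + t)"
    then have "[ix a + t = ix b + t] (mod CARD('p))" by (simp add: pos_eq_iff cong_def)
    then have "[ix a = ix b] (mod CARD('p))" by (simp only: cong_add_rcancel_nat)
    then show "a = b" by (simp add: cong_def ix_eq_iff)
  qed
  then show ?thesis by (simp add: bij_betw_def finite_UNIV_inj_surj)
qed

lemma dft_shift: "dft (\<lambda>m. s (pos (ix m + t))) j = \<zeta> ^ (j * t) * dft s j"
proof -
  have z: "inverse \<zeta> ^ (j * ix m) = \<zeta> ^ (j * t) * inverse \<zeta> ^ (j * ix (pos (ix m + t)))" for m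
  proof -
    have e: "(inverse \<zeta> ^ j) ^ CARD('p) = 1"
      by (rule \<zeta>_inverse_power)
    have "inverse \<zeta> ^ (j * ix (pos (ix m + t))) = (inverse \<zeta> ^ j) ^ (ix m + t)"
      unfolding power_mult by (rule root_shift[OF e])
    also have "\<dots> = inverse \<zeta> ^ (j * ix m) * inverse \<zeta> ^ (j * t)" by (simp add: power_add power_mult)
    finally have e2: "inverse \<zeta> ^ (j * ix (pos (ix m + t))) = inverse \<zeta> ^ (j * ix m) * inverse \<zeta> ^ (j * t)" .
    have "inverse \<zeta> ^ (j * ix m) = inverse \<zeta> ^ (j * ix m) * (\<zeta> ^ (j * t) * inverse \<zeta> ^ (j * t))"
      by (simp only: \<zeta>_inverse mult_1_right)
    also have "\<dots> = \<zeta> ^ (j * t) * inverse \<zeta> ^ (j * ix (pos (ix m + t)))"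
      unfolding e2 by (rule mult.left_commute)
    finally show ?thesis .
  qed
  have "dft (\<lambda>m. s (pos (ix m + t))) j = \<zeta> ^ (j * t) * (\<Sum>m\<in>UNIV. inverse \<zeta> ^ (j * ix (pos (ix m + t))) * s (pos (ix m + t)))"
    unfolding dft_def sum_distrib_left
  proof (rule sum.cong[OF refl])
    fix m
    show "inverse \<zeta> ^ (j * ix m) * s (pos (ix m + t)) =
      \<zeta> ^ (j * t) * (inverse \<zeta> ^ (j * ix (pos (ix m + t))) * s (pos (ix m + t)))"
      by (simp only: z[of m] mult.assoc)
  qed
  also have "(\<Sum>m\<in>UNIV. inverse \<zeta> ^ (j * ix (pos (ix m + t))) * s (pos (ix m + t))) = dft s j"
    unfolding dft_def by (rule sum.reindex_bij_betw[OF pos_shift_bij])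
  finally show ?thesis .
qed

text \<open>
  The eigenprojection, up to a factor, of conjugation by \<open>B\<close>. Writing \<open>B^(p - a)\<close> instead of \<open>B^(-a)\<close> keeps it
  polynomial; for the cyclic matrix \<open>B^p\<close> is scalar, so the difference is a constant, and a factor \<open>c\<close> of \<open>B\<close> with
  \<open>c^p = 1\<close> cancels.
\<close>

definition twisted_sum :: "nat \<Rightarrow> complex^'p^'p \<Rightarrow> complex^'p^'p \<Rightarrow> complex^'p^'p" where
  "twisted_sum j B X = (\<Sum>a<CARD('p). mat (\<zeta> ^ (j * a)) ** (mpow B a ** X ** mpow B (CARD('p) - a)))"

lemma twisted_sum_conj:
  assumes g: "g ** h = mat 1" "h ** g = mat 1" and c: "c ^ CARD('p) = 1"
  shows "twisted_sum j (mat c ** (h ** B ** g)) (h ** X ** g) = h ** twisted_sum j B X ** g"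
proof -
  have "mpow (mat c ** (h ** B ** g)) a ** (h ** X ** g) ** mpow (mat c ** (h ** B ** g)) (CARD('p) - a)
      = h ** (mpow B a ** X ** mpow B (CARD('p) - a)) ** g" if "a < CARD('p)" for a
  proof -
    have "mpow (mat c ** (h ** B ** g)) a ** (h ** X ** g) ** mpow (mat c ** (h ** B ** g)) (CARD('p) - a)
        = mat (c ^ a * c ^ (CARD('p) - a)) ** ((h ** mpow B a ** g) ** (h ** X ** g) ** (h ** mpow B (CARD('p) - a) ** g))"
      unfolding mpow_conj[OF g] by (subst scalar_mult_left) (rule scalar_mult_scalar)
    also have "c ^ a * c ^ (CARD('p) - a) = 1" using that c by (simp add: power_add[symmetric])
    also have "(h ** mpow B a ** g) ** (h ** X ** g) ** (h ** mpow B (CARD('p) - a) ** g) =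
        h ** mpow B a ** (g ** h) ** X ** (g ** h) ** mpow B (CARD('p) - a) ** g"
      by (simp only: matrix_mul_assoc)
    finally show ?thesis by (simp add: g matrix_mul_assoc)
  qed
  then have "twisted_sum j (mat c ** (h ** B ** g)) (h ** X ** g) =
      (\<Sum>a<CARD('p). mat (\<zeta> ^ (j * a)) ** (h ** (mpow B a ** X ** mpow B (CARD('p) - a)) ** g))"
    unfolding twisted_sum_def by (intro sum.cong) auto
  also have "\<dots> = (\<Sum>a<CARD('p). h ** (mat (\<zeta> ^ (j * a)) ** (mpow B a ** X ** mpow B (CARD('p) - a))) ** g)"
    by (simp only: scalar_conj)
  also have "\<dots> = h ** twisted_sum j B X ** g"
    by (simp add: twisted_sum_def matrix_sum_left matrix_sum_right)
  finally show ?thesis .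
qed

lemma mpow_cyc: "mpow (cyc 1) a = cyc a"
  by (induction a) (simp_all add: cyc_add)

text \<open>
  For the cyclic matrix and a diagonal matrix the sum is the \<open>j\<close>-th Fourier coefficient times a fixed diagonal
  matrix.
\<close>

lemma twisted_sum_diag:
  "twisted_sum j (cyc 1) (diag s) = mat (c0 ^ CARD('p) * dft s j) ** diag (\<lambda>i. \<zeta> ^ (j * ix i))"
proof -
  have t: "cyc a ** diag s ** cyc (CARD('p) - a) = mat (c0 ^ CARD('p)) ** diag (\<lambda>i. s (pos (ix i + (CARD('p) - a))))"
    if a: "a < CARD('p)" for a
  proof -
    have "pos (ix (pos (ix j + a)) + (CARD('p) - a)) = j" for j
    proof -
      have "pos (ix (pos (ix j + a)) + (CARD('p) - a)) = pos ((ix j + a) + (CARD('p) - a))"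
        by (simp only: ix_pos pos_add_mod)
      also have "(ix j + a) + (CARD('p) - a) = ix j + CARD('p)" using a by simp
      also have "pos (ix j + CARD('p)) = pos (ix j)" by (simp only: pos_eq_iff mod_add_self2)
      finally show ?thesis by (simp only: pos_ix)
    qed
    then have "diag (\<lambda>i. s (pos (ix i + (CARD('p) - a)))) ** cyc a = cyc a ** diag s"
      unfolding diag_cyc by simp
    then have "cyc a ** diag s ** cyc (CARD('p) - a) = diag (\<lambda>i. s (pos (ix i + (CARD('p) - a)))) ** (cyc a ** cyc (CARD('p) - a))"
      by (simp add: matrix_mul_assoc)
    also have "cyc a ** cyc (CARD('p) - a) = mat (c0 ^ CARD('p))" using a cyc_p[of 1] by (simp add: cyc_add)
    finally show ?thesis by (simp add: mat_central)
  qed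
  have d: "dft s j * \<zeta> ^ (j * ix i) = (\<Sum>a<CARD('p). \<zeta> ^ (j * a) * s (pos (ix i + (CARD('p) - a))))" for i
  proof -
    have sh: "\<zeta> ^ (j * a) = \<zeta> ^ (j * ix i) * inverse \<zeta> ^ (j * ix (pos (ix i + (CARD('p) - a))))" if a: "a < CARD('p)" for a
    proof -
      have e: "(inverse \<zeta> ^ j) ^ CARD('p) = 1"
        by (rule \<zeta>_inverse_power)
      have "inverse \<zeta> ^ (j * ix (pos (ix i + (CARD('p) - a)))) = (inverse \<zeta> ^ j) ^ (ix i + (CARD('p) - a))"
        unfolding power_mult by (rule root_shift[OF e])
      then have "inverse \<zeta> ^ (j * ix (pos (ix i + (CARD('p) - a)))) * (inverse \<zeta> ^ j) ^ a = (inverse \<zeta> ^ j) ^ (ix i + CARD('p))"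
        using a by (simp add: power_add[symmetric])
      also have "\<dots> = inverse \<zeta> ^ (j * ix i)" using e by (simp add: power_add power_mult)
      finally have w: "inverse \<zeta> ^ (j * ix (pos (ix i + (CARD('p) - a)))) * inverse \<zeta> ^ (j * a) = inverse \<zeta> ^ (j * ix i)"
        by (simp only: power_mult)
      have "\<zeta> ^ (j * a) = \<zeta> ^ (j * a) * (\<zeta> ^ (j * ix i) * inverse \<zeta> ^ (j * ix i))"
        by (simp only: \<zeta>_inverse mult_1_right)
      also have "\<dots> = \<zeta> ^ (j * ix i) * inverse \<zeta> ^ (j * ix (pos (ix i + (CARD('p) - a)))) * (\<zeta> ^ (j * a) * inverse \<zeta> ^ (j * a))"
        unfolding w[symmetric] by (simp only: mult_ac)
      finally show ?thesis by (simp only: \<zeta>_inverse mult_1_right)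
    qed
    have "(\<Sum>a<CARD('p). \<zeta> ^ (j * a) * s (pos (ix i + (CARD('p) - a)))) =
        \<zeta> ^ (j * ix i) * (\<Sum>a<CARD('p). inverse \<zeta> ^ (j * ix (pos (ix i + (CARD('p) - a)))) * s (pos (ix i + (CARD('p) - a))))"
      unfolding sum_distrib_left
    proof (rule sum.cong[OF refl])
      fix a assume "a \<in> {..<CARD('p)}"
      then have "\<zeta> ^ (j * a) = \<zeta> ^ (j * ix i) * inverse \<zeta> ^ (j * ix (pos (ix i + (CARD('p) - a))))"
        by (intro sh) simp
      then show "\<zeta> ^ (j * a) * s (pos (ix i + (CARD('p) - a))) = \<zeta> ^ (j * ix i) *
          (inverse \<zeta> ^ (j * ix (pos (ix i + (CARD('p) - a)))) * s (pos (ix i + (CARD('p) - a))))"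
        by (simp only: mult.assoc)
    qed
    also have "(\<Sum>a<CARD('p). inverse \<zeta> ^ (j * ix (pos (ix i + (CARD('p) - a)))) * s (pos (ix i + (CARD('p) - a)))) = dft s j"
      unfolding dft_def
    proof (rule sum.reindex_bij_betw)
      have "inj_on (\<lambda>a. pos (ix i + (CARD('p) - a))) {..<CARD('p)}"
      proof (rule inj_onI)
        fix a b assume ab: "a \<in> {..<CARD('p)}" "b \<in> {..<CARD('p)}" "pos (ix i + (CARD('p) - a)) = pos (ix i + (CARD('p) - b))"
        then have "[ix i + (CARD('p) - a) = ix i + (CARD('p) - b)] (mod CARD('p))" by (simp add: pos_eq_iff cong_def)
        then have "[CARD('p) - a = CARD('p) - b] (mod CARD('p))" by (simp only: cong_add_lcancel_nat)
        then have "[CARD('p) - a + (a + b) = CARD('p) - b + (a + b)] (mod CARD('p))" by (simp only: cong_add_rcancel_nat)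
        moreover have "CARD('p) - a + (a + b) = b + CARD('p)" "CARD('p) - b + (a + b) = a + CARD('p)" using ab(1,2) by auto
        ultimately have "[b = a] (mod CARD('p))" by (simp add: cong_def)
        then show "a = b" using ab(1,2) by (simp add: cong_def)
      qed
      then show "bij_betw (\<lambda>a. pos (ix i + (CARD('p) - a))) {..<CARD('p)} UNIV"
        unfolding bij_betw_def using card_image[of "\<lambda>a. pos (ix i + (CARD('p) - a))" "{..<CARD('p)}"]
        by (intro conjI card_subset_eq) simp_all
    qed
    finally show ?thesis by (simp add: mult.commute)
  qed
  have "twisted_sum j (cyc 1) (diag s) =
    (\<Sum>a<CARD('p). mat (\<zeta> ^ (j * a)) ** (mat (c0 ^ CARD('p)) ** diag (\<lambda>i. s (pos (ix i + (CARD('p) - a))))))"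
    unfolding twisted_sum_def mpow_cyc by (rule sum.cong) (simp_all add: t)
  also have "\<dots> = mat (c0 ^ CARD('p) * dft s j) ** diag (\<lambda>i. \<zeta> ^ (j * ix i))"
  proof -
    have "(\<Sum>a<CARD('p). mat (\<zeta> ^ (j * a)) ** (mat (c0 ^ CARD('p)) ** diag (\<lambda>i. s (pos (ix i + (CARD('p) - a)))))) $ i $ k
      = c0 ^ CARD('p) * (if i = k then \<Sum>a<CARD('p). \<zeta> ^ (j * a) * s (pos (ix i + (CARD('p) - a))) else 0)" for i k
      by (simp add: mat_mult_mat_assoc sum_distrib_left del: mult_diag_entry) (simp add: diag_def mult_ac)
    then show ?thesis unfolding vec_eq_iff d[symmetric] by (simp del: mult_diag_entry) (simp add: diag_def)
  qed
  finally show ?thesis .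
qed

text \<open>
  On tuples in normal form this is the Fourier coefficient at \<open>(k, j)\<close> times the \<open>j\<close>-th power of the one at
  \<open>(k1, p - 1)\<close>, that is at frequency \<open>-1\<close>: a cyclic shift multiplies them by \<open>\<zeta>^(j t)\<close> and \<open>\<zeta>^(-t)\<close>.
\<close>

definition inv_coord :: "('l \<Rightarrow> complex^'p^'p) \<Rightarrow> 'l \<times> nat \<Rightarrow> complex" where
  "inv_coord A = (\<lambda>(k, j). trace (twisted_sum j (A k0) (trace_normalized (A k)) **
      mpow (twisted_sum (CARD('p) - 1) (A k0) (trace_normalized (A k1))) j) / (of_nat CARD('p) * c0 ^ (CARD('p) * (1 + j))))"

definition coords :: "('l \<Rightarrow> complex^'p^'p) \<Rightarrow> nat \<Rightarrow> complex" where
  "coords A m = (if m < n then inv_coord A (\<beta> m) else 0)"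

definition nonzero_traces :: "('l \<Rightarrow> complex^'p^'p) set" where
  "nonzero_traces = {A. \<forall>k. k \<noteq> k0 \<longrightarrow> trace (A k) \<noteq> 0}"

lemma coords_class:
  fixes A B :: "'l \<Rightarrow> complex^'p^'p"
  assumes A: "A \<in> SL_tuples" and B: "B \<in> SL_tuples" and eq: "tuple_class A = tuple_class B"
  shows "A \<in> nonzero_traces \<Longrightarrow> B \<in> nonzero_traces" "coords A = coords B"
proof -
  obtain g c where g: "det g = 1" "\<forall>k. c k ^ CARD('p) = 1" "\<forall>k. g ** A k = mat (c k) ** (B k ** g)"
    using conj_class_eqD[OF A B eq[unfolded tuple_class_def]] by blast
  obtain h where h: "g ** h = mat 1" "h ** g = mat 1" "det h = 1" using g(1) by (rule SL_inverse)
  have c0: "c k \<noteq> 0" for k using g(2)[rule_format, of k] by (auto simp: power_0_left)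
  have Ak: "A k = mat (c k) ** (h ** B k ** g)" for k
  proof -
    have "A k = h ** (g ** A k)" by (simp add: matrix_mul_assoc h)
    also have "\<dots> = mat (c k) ** (h ** (B k ** g))" using g(3) by (simp only: mat_pull)
    finally show ?thesis by (simp only: matrix_mul_assoc)
  qed
  have tr: "trace (A k) = c k * trace (B k)" for k
    by (simp only: Ak trace_mat_mult trace_conj[OF h(1)])
  show "B \<in> nonzero_traces" if "A \<in> nonzero_traces"
    using that tr by (auto simp: nonzero_traces_def)
  have tn: "trace_normalized (A k) = h ** trace_normalized (B k) ** g" for k
    unfolding Ak[of k] by (rule trace_normalized_conj[OF h(1) c0])
  have ts: "twisted_sum j (A k0) (trace_normalized (A k)) = h ** twisted_sum j (B k0) (trace_normalized (B k)) ** g" for j k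
    unfolding tn Ak[of k0] by (rule twisted_sum_conj[OF h(1,2) g(2)[rule_format]])
  have "inv_coord A (k, j) = inv_coord B (k, j)" for k j
  proof -
    let ?X = "twisted_sum j (B k0) (trace_normalized (B k))" and ?Y = "twisted_sum (CARD('p) - 1) (B k0) (trace_normalized (B k1))"
    have "mpow (h ** ?Y ** g) j = h ** mpow ?Y j ** g"
      using mpow_conj[OF h(1,2), of 1 ?Y j] by simp
    then have "(h ** ?X ** g) ** mpow (h ** ?Y ** g) j = h ** ?X ** (g ** h) ** mpow ?Y j ** g"
      by (simp only: matrix_mul_assoc)
    also have "\<dots> = h ** (?X ** mpow ?Y j) ** g" by (simp add: h matrix_mul_assoc)
    finally have "trace ((h ** ?X ** g) ** mpow (h ** ?Y ** g) j) = trace (?X ** mpow ?Y j)"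
      by (simp only: trace_conj[OF h(1)])
    then show ?thesis by (simp only: inv_coord_def prod.case ts)
  qed
  then show "coords A = coords B" by (auto simp: coords_def fun_eq_iff) (metis surj_pair)
qed

lemma mpow_diag_scalar: "mpow (mat c ** diag t) j = mat (c ^ j) ** diag (\<lambda>i. t i ^ j)"
proof (induction j)
  case 0
  then show ?case by (simp add: diag_const)
next
  case (Suc j)
  have "(mat c ** diag t) ** (mat (c ^ j) ** diag (\<lambda>i. t i ^ j)) = mat (c * c ^ j) ** (diag t ** diag (\<lambda>i. t i ^ j))"
    by (rule scalar_mult_scalar)
  also have "diag t ** diag (\<lambda>i. t i ^ j) = diag (\<lambda>i. t i * t i ^ j)"
    by (simp add: vec_eq_iff) (simp add: diag_def)
  finally show ?case using Suc by simp
qed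

lemma inv_coord_diag:
  assumes A0: "A k0 = cyc 1" and tk: "trace_normalized (A k) = diag s" and tk1: "trace_normalized (A k1) = diag s1"
  shows "inv_coord A (k, j) = dft s j * dft s1 (CARD('p) - 1) ^ j"
proof -
  let ?c = "c0 ^ CARD('p)"
  have c: "?c \<noteq> 0" using c0_nz by simp
  have z: "\<zeta> ^ (j * ix i) * (\<zeta> ^ ((CARD('p) - 1) * ix i)) ^ j = 1" for i
  proof -
    have "j * ix i + (CARD('p) - 1) * ix i * j = CARD('p) * (ix i * j)"
      using p_gt_1 by (cases "CARD('p)") (simp_all add: algebra_simps)
    then show ?thesis by (simp only: power_mult[symmetric] power_add[symmetric]) (simp add: power_mult \<zeta>(1))
  qed
  have "twisted_sum j (A k0) (trace_normalized (A k)) ** mpow (twisted_sum (CARD('p) - 1) (A k0) (trace_normalized (A k1))) j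
     = (mat (?c * dft s j) ** diag (\<lambda>i. \<zeta> ^ (j * ix i))) **
       (mat ((?c * dft s1 (CARD('p) - 1)) ^ j) ** diag (\<lambda>i. (\<zeta> ^ ((CARD('p) - 1) * ix i)) ^ j))"
    by (simp only: A0 tk tk1 twisted_sum_diag mpow_diag_scalar)
  also have "\<dots> = mat ((?c * dft s j) * (?c * dft s1 (CARD('p) - 1)) ^ j) ** (diag (\<lambda>i. \<zeta> ^ (j * ix i)) ** diag (\<lambda>i. (\<zeta> ^ ((CARD('p) - 1) * ix i)) ^ j))"
    by (rule scalar_mult_scalar)
  also have "diag (\<lambda>i. \<zeta> ^ (j * ix i)) ** diag (\<lambda>i. (\<zeta> ^ ((CARD('p) - 1) * ix i)) ^ j) = mat 1"
    by (simp add: vec_eq_iff) (simp add: diag_def mat_def z[simplified])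
  finally have "trace (twisted_sum j (A k0) (trace_normalized (A k)) ** mpow (twisted_sum (CARD('p) - 1) (A k0) (trace_normalized (A k1))) j)
     = (?c * dft s j) * (?c * dft s1 (CARD('p) - 1)) ^ j * of_nat CARD('p)"
    by (simp add: trace_mat)
  then show ?thesis
    using c p_gt_1 by (simp add: inv_coord_def power_mult power_mult_distrib power_add)
qed

definition entry :: "(nat \<Rightarrow> complex) \<Rightarrow> 'l \<times> nat \<Rightarrow> complex" where
  "entry z kj = z (inv_into {..<n} \<beta> kj)"

text \<open>
  On the chart this is the Fourier coefficient of index \<open>k1\<close> and frequency \<open>p - 1\<close>, whose \<open>p\<close>-th power is the
  coordinate at \<open>(k1, p - 1)\<close>.
\<close>

definition root :: "(nat \<Rightarrow> complex) \<Rightarrow> complex" where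
  "root z = exp (Ln (entry z (k1, CARD('p) - 1)) / of_nat CARD('p))"

text \<open>
  The value 1 at frequency 0 is the trace.
\<close>

definition section_dft :: "(nat \<Rightarrow> complex) \<Rightarrow> 'l \<Rightarrow> nat \<Rightarrow> complex" where
  "section_dft z k j = (if j = 0 then 1 else entry z (k, j) / root z ^ j)"

definition section_diag :: "(nat \<Rightarrow> complex) \<Rightarrow> 'l \<Rightarrow> 'p \<Rightarrow> complex" where
  "section_diag z k = idft (section_dft z k)"

text \<open>
  The slit makes the \<open>p\<close>-th root holomorphic, and the positive real parts make the logarithms of the diagonal entries
  holomorphic.
\<close>

definition chart_image :: "(nat \<Rightarrow> complex) set" where
  "chart_image = {z. (\<forall>m. m \<notin> {..<n} \<longrightarrow> z m = 0) \<and> entry z (k1, CARD('p) - 1) \<notin> \<real>\<^sub>\<le>\<^sub>0 \<and>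
    (\<forall>k. k \<noteq> k0 \<longrightarrow> (\<forall>i. Re (section_diag z k i) > 0))}"

abbreviation hub_exponent :: "'l \<Rightarrow> nat" where "hub_exponent \<equiv> (\<lambda>k. if k = k0 then 1 else 0)"

text \<open>
  The diagonals are brought to determinant 1 by passing through the exponential parametrization.
\<close>

definition chart_section :: "(nat \<Rightarrow> complex) \<Rightarrow> 'l \<Rightarrow> complex^'p^'p" where
  "chart_section z = param k0 hub_exponent (\<chi> k i. Ln (section_diag z k i))"

lemma index_in: "k \<noteq> k0 \<Longrightarrow> 0 < j \<Longrightarrow> j < CARD('p) \<Longrightarrow> (k, j) \<in> \<beta> ` {..<n}"
  using \<beta> by (simp add: bij_betw_def)

lemma coords_entry:
  assumes "k \<noteq> k0" "0 < j" "j < CARD('p)"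
  shows "entry (coords A) (k, j) = inv_coord A (k, j)"
proof -
  have "inv_into {..<n} \<beta> (k, j) < n" using inv_into_into[OF index_in[OF assms]] by simp
  moreover have "\<beta> (inv_into {..<n} \<beta> (k, j)) = (k, j)" using index_in[OF assms] by (rule f_inv_into_f)
  ultimately show ?thesis by (simp add: entry_def coords_def)
qed

lemma coords_eqI:
  assumes z: "\<And>m. m \<notin> {..<n} \<Longrightarrow> z m = 0"
    and eq: "\<And>k j. k \<noteq> k0 \<Longrightarrow> 0 < j \<Longrightarrow> j < CARD('p) \<Longrightarrow> inv_coord A (k, j) = entry z (k, j)"
  shows "coords A = z"
proof
  fix m
  show "coords A m = z m"
  proof (cases "m < n")
    case True
    obtain k j where kj: "\<beta> m = (k, j)" by (cases "\<beta> m")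
    have "\<beta> m \<in> {(k, j). k \<noteq> k0 \<and> 0 < j \<and> j < CARD('p)}" using \<beta> True by (auto simp: bij_betw_def)
    then have "inv_coord A (k, j) = entry z (k, j)" using kj eq by simp
    moreover have "inv_into {..<n} \<beta> (k, j) = m"
      using \<beta> True unfolding kj[symmetric] by (intro inv_into_f_f) (auto simp: bij_betw_def)
    ultimately show ?thesis using True kj by (simp add: coords_def entry_def)
  next
    case False
    then show ?thesis using z by (simp add: coords_def)
  qed
qed

lemma root_power:
  assumes "entry z (k1, CARD('p) - 1) \<noteq> 0"
  shows "root z ^ CARD('p) = entry z (k1, CARD('p) - 1)" "root z \<noteq> 0"
proof -
  have "root z ^ CARD('p) = exp (of_nat CARD('p) * (Ln (entry z (k1, CARD('p) - 1)) / of_nat CARD('p)))"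
    unfolding root_def by (rule exp_of_nat_mult[symmetric])
  also have "\<dots> = entry z (k1, CARD('p) - 1)" using p_gt_1 assms by simp
  finally show "root z ^ CARD('p) = entry z (k1, CARD('p) - 1)" .
qed (simp add: root_def)

lemma sum_section_diag: "(\<Sum>i\<in>UNIV. section_diag z k i) = 1"
proof -
  have "dft (section_diag z k) 0 = section_dft z k 0"
    unfolding section_diag_def using p_gt_1 by (intro dft_idft) simp
  then show ?thesis by (simp add: dft_def section_dft_def)
qed

lemma chart_imageD:
  assumes "z \<in> chart_image"
  shows "entry z (k1, CARD('p) - 1) \<noteq> 0" "k \<noteq> k0 \<Longrightarrow> section_diag z k i \<noteq> 0" "k \<noteq> k0 \<Longrightarrow> section_diag z k i \<notin> \<real>\<^sub>\<le>\<^sub>0"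
    "m \<notin> {..<n} \<Longrightarrow> z m = 0" "entry z (k1, CARD('p) - 1) \<notin> \<real>\<^sub>\<le>\<^sub>0"
proof -
  have pos: "Re (section_diag z k i) > 0" if "k \<noteq> k0" using assms that by (simp add: chart_image_def)
  show "section_diag z k i \<noteq> 0" "section_diag z k i \<notin> \<real>\<^sub>\<le>\<^sub>0" if "k \<noteq> k0"
    using pos[OF that] by (auto simp: complex_nonpos_Reals_iff)
qed (use assms in \<open>auto simp: chart_image_def\<close>)

lemma chart_section_entries:
  assumes z: "z \<in> chart_image"
  shows "chart_section z k0 = cyc 1"
    "\<And>k. k \<noteq> k0 \<Longrightarrow> \<exists>c. c \<noteq> 0 \<and> chart_section z k = mat c ** diag (section_diag z k)"
proof -
  show "chart_section z k0 = cyc 1"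
    by (simp add: chart_section_def param_def monomial_def diag_const)
next
  fix k assume k: "k \<noteq> k0"
  define c where "c = inverse (exp ((\<Sum>j\<in>UNIV. Ln (section_diag z k j)) / of_nat CARD('p)))"
  have "normalized_exp (($) (\<chi> i. Ln (section_diag z k i))) = (\<lambda>i. c * section_diag z k i)"
    using chart_imageD(2)[OF z k]
    by (simp add: fun_eq_iff normalized_exp_def exp_diff c_def divide_inverse mult.commute)
  then have "chart_section z k = mat c ** diag (section_diag z k)"
    using k by (simp add: chart_section_def param_def monomial_def diag_scale)
  then show "\<exists>c. c \<noteq> 0 \<and> chart_section z k = mat c ** diag (section_diag z k)"
    by (intro exI[of _ c]) (simp add: c_def)
qed

lemma trace_diag: "trace (diag s) = (\<Sum>i\<in>UNIV. s i)"
  by (simp add: trace_def diag_def)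

lemma trace_normalized_diag:
  assumes "c \<noteq> 0" "(\<Sum>i\<in>UNIV. s i) \<noteq> 0"
  shows "trace_normalized (mat c ** diag s) = diag (\<lambda>i. s i / (\<Sum>i\<in>UNIV. s i))"
proof -
  have "trace_normalized (mat c ** diag s) = mat (1 / (c * (\<Sum>i\<in>UNIV. s i)) * c) ** diag s"
    by (simp add: trace_normalized_def trace_mat_mult trace_diag mat_mult_mat_assoc)
  also have "1 / (c * (\<Sum>i\<in>UNIV. s i)) * c = inverse (\<Sum>i\<in>UNIV. s i)" using assms by (simp add: field_simps)
  finally show ?thesis by (simp add: diag_scale[symmetric] divide_inverse mult.commute)
qed

text \<open>
  A constant diagonal has no Fourier coefficient at frequency \<open>p - 1\<close>, whereas here this coefficient is a
  \<open>p\<close>-th root of a non-zero coordinate.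
\<close>

lemma chart_section_bad:
  assumes z: "z \<in> chart_image"
  shows "chart_section z \<in> bad_tuples" "chart_section z \<in> nonzero_traces"
proof -
  have "\<exists>i j. section_diag z k1 i \<noteq> section_diag z k1 j"
  proof (rule ccontr)
    assume "\<not> ?thesis"
    then have con: "section_diag z k1 m = section_diag z k1 (pos 0)" for m by blast
    have p1: "CARD('p) - 1 < CARD('p)" "0 < CARD('p)" "CARD('p) - 1 \<noteq> 0" using p_gt_1 by auto
    have "dft (section_diag z k1) (CARD('p) - 1) =
        (\<Sum>m\<in>UNIV. inverse \<zeta> ^ ((CARD('p) - 1) * ix m) * \<zeta> ^ (0 * ix m)) * section_diag z k1 (pos 0)"
      unfolding dft_def sum_distrib_right by (rule sum.cong) (use con in auto)
    also have "\<dots> = 0" unfolding orthogonality[OF p1(1,2)] using p1(3) by simp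
    finally have "section_dft z k1 (CARD('p) - 1) = 0"
      unfolding section_diag_def dft_idft[OF p1(1)] .
    then show False using p1(3) chart_imageD(1)[OF z] root_power(2)[of z] by (simp add: section_dft_def)
  qed
  then obtain i j where ij: "section_diag z k1 i \<noteq> section_diag z k1 j" by blast
  have "exp (Ln (section_diag z k1 i) - Ln (section_diag z k1 j)) \<noteq> 1"
    using chart_imageD(2)[OF z k1] ij by (simp add: exp_diff)
  then show "chart_section z \<in> bad_tuples"
    unfolding chart_section_def using k1 by (subst param_bad_iff) auto
  show "chart_section z \<in> nonzero_traces"
    unfolding nonzero_traces_def
  proof (intro CollectI allI impI)
    fix k assume "k \<noteq> k0"
    then obtain c where "c \<noteq> 0" "chart_section z k = mat c ** diag (section_diag z k)"
      using chart_section_entries(2)[OF z] by blast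
    then show "trace (chart_section z k) \<noteq> 0" by (simp add: trace_mat_mult trace_diag sum_section_diag)
  qed
qed

lemma coords_chart_section:
  assumes z: "z \<in> chart_image"
  shows "coords (chart_section z) = z"
proof (rule coords_eqI)
  show "z m = 0" if "m \<notin> {..<n}" for m using chart_imageD(4)[OF z that] .
  have tn: "trace_normalized (chart_section z k) = diag (section_diag z k)" if k: "k \<noteq> k0" for k
  proof -
    obtain c where "c \<noteq> 0" "chart_section z k = mat c ** diag (section_diag z k)"
      using chart_section_entries(2)[OF z k] by blast
    then show ?thesis by (simp add: trace_normalized_diag sum_section_diag)
  qed
  fix k j assume kj: "k \<noteq> k0" "0 < j" "j < CARD('p)"
  have p1: "CARD('p) - 1 < CARD('p)" "CARD('p) - 1 \<noteq> 0" using p_gt_1 by auto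
  have r: "root z ^ CARD('p) = entry z (k1, CARD('p) - 1)" "root z \<noteq> 0"
    using root_power[OF chart_imageD(1)[OF z]] by blast+
  have "root z * root z ^ (CARD('p) - 1) = root z ^ CARD('p)"
    using p_gt_1 by (simp add: power_eq_if)
  then have "dft (section_diag z k1) (CARD('p) - 1) = root z"
    unfolding section_diag_def dft_idft[OF p1(1)] section_dft_def
    using p1(2) r by (simp add: nonzero_divide_eq_eq)
  moreover have "dft (section_diag z k) j = entry z (k, j) / root z ^ j"
    unfolding section_diag_def dft_idft[OF kj(3)] section_dft_def using kj(2) by simp
  ultimately show "inv_coord (chart_section z) (k, j) = entry z (k, j)"
    using r(2) by (simp add: inv_coord_diag[OF chart_section_entries(1)[OF z] tn[OF kj(1)] tn[OF k1]])
qed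

text \<open>
  Conjugate matrices have the same trace; so a non-zero trace excludes a non-trivial root of unity in the
  commutation relation.
\<close>

lemma trace_conj_scalar:
  fixes M X :: "complex^'n^'n"
  assumes M: "det M = 1" and eq: "M ** X = mat w ** (X ** M)" and tr: "trace X \<noteq> 0"
  shows "w = 1"
proof -
  obtain h where h: "M ** h = mat 1" "h ** M = mat 1" using M by (rule SL_inverse)
  have "X = h ** (M ** X)" by (simp add: matrix_mul_assoc h)
  also have "\<dots> = mat w ** (h ** X ** M)" unfolding eq by (subst mat_pull) (simp only: matrix_mul_assoc)
  finally have "trace X = w * trace X"
    using trace_conj[OF h(1), of X] by (metis trace_mat_mult)
  then show ?thesis using tr by simp
qed

lemma section_dft_eqI:
  assumes "\<And>j. j < CARD('p) \<Longrightarrow> dft s j = section_dft z k j"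
  shows "s = section_diag z k"
proof
  fix m
  have "section_diag z k m = idft (dft s) m"
    unfolding section_diag_def idft_def using assms by (intro arg_cong2[where f = "(/)"] sum.cong) auto
  then show "s m = section_diag z k m" by (simp add: idft_dft)
qed

text \<open>
  The traces force the exponents to be 0 outside \<open>k0\<close>. In the normal form the Fourier coefficient \<open>\<rho>\<close> at
  \<open>(k1, p - 1)\<close> and the chosen root of its \<open>p\<close>-th power differ by some \<open>\<zeta>^t\<close>; the cyclic shift by \<open>t\<close>, that is
  conjugation by a power of the cyclic matrix, removes this difference and then all Fourier coefficients agree.
\<close>

lemma class_chart_section_coords:
  fixes A :: "'l \<Rightarrow> complex^'p^'p"
  assumes A: "A \<in> bad_tuples" "A \<in> nonzero_traces" and z: "coords A \<in> chart_image"
  shows "tuple_class (chart_section (coords A)) = tuple_class A"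
proof (rule bad_repsD)
  show "2 \<le> CARD('p)" by (rule p_ge_2)
  show ASL: "A \<in> SL_tuples" and "proj_tuple A \<in> bad_reps" using A(1) by (auto simp: bad_tuples_def)
  fix M \<omega> k assume M: "det M = 1" "\<And>k. M ** A k = mat (\<omega> k) ** (A k ** M)"
    and om: "\<And>k. \<omega> k ^ CARD('p) = 1" "\<omega> k \<noteq> 1"
  have om1: "\<omega> k' = 1" if "k' \<noteq> k0" for k'
    by (rule trace_conj_scalar[OF M(1) M(2)]) (use A(2) that in \<open>simp add: nonzero_traces_def\<close>)
  then have kk0: "k = k0" using om(2) by blast
  define w where "w = \<omega> k0"
  have w: "w ^ CARD('p) = 1" "w \<noteq> 1" using om kk0 by (auto simp: w_def)
  have "\<omega> k' = w ^ hub_exponent k'" for k' using om1 by (simp add: w_def)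
  then have M': "M ** A k' = mat (w ^ hub_exponent k') ** (A k' ** M)" for k' using M(2)[of k'] by metis
  have M0: "det M \<noteq> 0" using M(1) by simp
  have h1: "hub_exponent k0 = 1" by simp
  show ?thesis
  proof (rule normal_form[where e = hub_exponent and ?k0.0 = k0, OF ASL M0 M' w h1])
    fix s assume s: "s k0 = (\<lambda>_. 1)" "\<And>k. (\<Prod>i\<in>UNIV. s k i) = 1"
      and cl: "conj_class (proj_tuple A) = conj_class (proj_tuple (monomial hub_exponent s))"
    define C where "C = monomial hub_exponent s"
    have CSL: "C \<in> SL_tuples" unfolding C_def by (rule monomial_SL) (rule s(2))
    have cl: "tuple_class A = tuple_class C" using cl by (simp add: tuple_class_def C_def)
    have Ctr: "C \<in> nonzero_traces" and Cco: "coords A = coords C" using coords_class[OF ASL CSL cl] A(2) by blast+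
    have C0: "C k0 = cyc 1" by (simp add: C_def monomial_def s(1) diag_const)
    have Ck: "C k = diag (s k)" if "k \<noteq> k0" for k using that by (simp add: C_def monomial_def)
    define \<sigma> where "\<sigma> k = (\<Sum>i\<in>UNIV. s k i)" for k
    have \<sigma>: "\<sigma> k \<noteq> 0" if "k \<noteq> k0" for k
      using Ctr that by (simp add: nonzero_traces_def Ck trace_diag \<sigma>_def)
    define x where "x k i = s k i / \<sigma> k" for k i
    have tn: "trace_normalized (C k) = diag (x k)" if "k \<noteq> k0" for k
      using trace_normalized_diag[of 1 "s k"] \<sigma>[OF that] that by (simp add: Ck x_def[abs_def] \<sigma>_def)
    define z where "z = coords A"
    have zi: "z \<in> chart_image" using \<open>coords A \<in> chart_image\<close> by (simp add: z_def)
    define \<rho> where "\<rho> = dft (x k1) (CARD('p) - 1)"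
    have ent: "entry z (k, j) = dft (x k) j * \<rho> ^ j" if "k \<noteq> k0" "0 < j" "j < CARD('p)" for k j
      unfolding z_def Cco coords_entry[OF that] inv_coord_diag[OF C0 tn[OF that(1)] tn[OF k1]] \<rho>_def ..
    have p1: "CARD('p) - 1 < CARD('p)" "0 < CARD('p) - 1" using p_gt_1 by auto
    have r: "root z ^ CARD('p) = entry z (k1, CARD('p) - 1)" "root z \<noteq> 0"
      using root_power[OF chart_imageD(1)[OF zi]] by blast+
    have "\<rho> ^ CARD('p) = entry z (k1, CARD('p) - 1)"
      unfolding ent[OF k1 p1(2,1)] \<rho>_def[symmetric] using p_gt_1 by (simp add: power_eq_if)
    then have "(\<rho> / root z) ^ CARD('p) = 1"
      using r chart_imageD(1)[OF zi] by (simp add: power_divide)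
    then obtain t where t: "\<rho> / root z = \<zeta> ^ t"
      using root_as_power[OF prime \<zeta>(1,2)] by metis
    then have \<rho>: "\<rho> = root z * \<zeta> ^ t" using r(2) by (simp add: nonzero_divide_eq_eq mult.commute)
    \<comment> \<open>Shifting by \<open>t\<close> multiplies the coefficient at frequency \<open>p - 1\<close> by \<open>\<zeta>^(-t)\<close>, turning \<open>\<rho>\<close> into the chosen root.\<close>
    have xs: "(\<lambda>m. x k (pos (ix m + t))) = section_diag z k" if k: "k \<noteq> k0" for k
    proof (rule section_dft_eqI)
      fix j assume j: "j < CARD('p)"
      show "dft (\<lambda>m. x k (pos (ix m + t))) j = section_dft z k j"
      proof (cases "j = 0")
        case True
        have "dft (x k) 0 = 1" using \<sigma>[OF k] by (simp add: dft_def x_def sum_divide_distrib[symmetric] \<sigma>_def)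
        then show ?thesis using True by (simp add: dft_shift section_dft_def)
      next
        case False
        then have "entry z (k, j) = dft (x k) j * (root z ^ j * \<zeta> ^ (j * t))"
          using ent[OF k _ j] by (simp add: \<rho> power_mult_distrib power_mult[symmetric] mult.commute[of t])
        then show ?thesis using False r(2) by (simp add: dft_shift section_dft_def)
      qed
    qed
    have rel: "\<exists>c. cyc t ** chart_section z k = mat c ** (C k ** cyc t)" for k
    proof (cases "k = k0")
      case True
      have "cyc t ** cyc 1 = cyc 1 ** cyc t" by (simp only: cyc_add add.commute)
      then show ?thesis unfolding True chart_section_entries(1)[OF zi] C0 by (intro exI[of _ 1]) simp
    next
      case False
      obtain c where c: "chart_section z k = mat c ** diag (section_diag z k)"
        using chart_section_entries(2)[OF zi False] by blast
      have "diag (s k) = mat (\<sigma> k) ** diag (x k)"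
        unfolding diag_scale[symmetric] using \<sigma>[OF False] by (simp add: x_def)
      then have "C k ** cyc t = mat (\<sigma> k) ** (diag (x k) ** cyc t)" by (simp only: Ck[OF False] scalar_mult_left)
      also have "diag (x k) ** cyc t = cyc t ** diag (section_diag z k)"
        unfolding diag_cyc xs[OF False] ..
      finally have "mat (c / \<sigma> k) ** (C k ** cyc t) = mat (c / \<sigma> k * \<sigma> k) ** (cyc t ** diag (section_diag z k))"
        by (simp only: mat_mult_mat_assoc)
      then have "cyc t ** chart_section z k = mat (c / \<sigma> k) ** (C k ** cyc t)"
        unfolding c using \<sigma>[OF False] by (simp add: mat_pull)
      then show ?thesis by blast
    qed
    then obtain c where c: "\<And>k. cyc t ** chart_section z k = mat (c k) ** (C k ** cyc t)" by metis
    have dct: "det (cyc t) \<noteq> 0" by simp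
    have "tuple_class (chart_section z) = tuple_class C"
      unfolding tuple_class_def
      by (rule conj_class_eqI[OF _ CSL dct c]) (use chart_section_bad(1)[OF zi] in \<open>simp add: bad_tuples_def\<close>)
    then show ?thesis using cl by (simp add: z_def)
  qed
qed

end

section \<open>A chart of the singular locus\<close>

lemma field_differentiable_exp_comp:
  fixes f :: "complex \<Rightarrow> complex"
  assumes "f field_differentiable at x"
  shows "(\<lambda>w. exp (f w)) field_differentiable at x"
  using field_differentiable_compose[OF assms field_differentiable_within_exp] by (simp add: o_def)

lemma field_differentiable_Ln_comp:
  fixes f :: "complex \<Rightarrow> complex"
  assumes "f field_differentiable at x" "f x \<notin> \<real>\<^sub>\<le>\<^sub>0"
  shows "(\<lambda>w. Ln (f w)) field_differentiable at x"
  using field_differentiable_compose[OF assms(1) field_differentiable_at_Ln[OF assms(2)]] by (simp add: o_def)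

lemma field_differentiable_sum_finite:
  fixes f :: "'i \<Rightarrow> complex \<Rightarrow> complex"
  assumes "\<And>i. i \<in> I \<Longrightarrow> f i field_differentiable at x"
  shows "(\<lambda>w. \<Sum>i\<in>I. f i w) field_differentiable at x"
  using assms by (induction I rule: infinite_finite_induct) (auto intro: field_differentiable_add)

lemma field_differentiable_fun_upd: "(\<lambda>w. (z(i := w)) j) field_differentiable at (x::complex)"
  by (cases "i = j") (auto simp: field_differentiable_ident field_differentiable_const)

definition matrix_differentiable :: "(complex \<Rightarrow> complex^'n^'n) \<Rightarrow> complex \<Rightarrow> bool" where
  "matrix_differentiable F x \<longleftrightarrow> (\<forall>i j. (\<lambda>w. F w $ i $ j) field_differentiable at x)"

lemma matrix_differentiable_const: "matrix_differentiable (\<lambda>_. A) x"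
  by (simp add: matrix_differentiable_def)

lemma matrix_differentiable_mult:
  "matrix_differentiable F x \<Longrightarrow> matrix_differentiable G x \<Longrightarrow> matrix_differentiable (\<lambda>w. F w ** G w) x"
  unfolding matrix_differentiable_def matrix_matrix_mult_def
  by (auto intro!: field_differentiable_sum_finite field_differentiable_mult)

lemma matrix_differentiable_scalar:
  "c field_differentiable at x \<Longrightarrow> matrix_differentiable F x \<Longrightarrow> matrix_differentiable (\<lambda>w. mat (c w) ** F w) x"
  unfolding matrix_differentiable_def by (auto intro!: field_differentiable_mult)

lemma matrix_differentiable_mpow: "matrix_differentiable F x \<Longrightarrow> matrix_differentiable (\<lambda>w. mpow (F w) n) x"
  by (induction n) (auto intro: matrix_differentiable_const matrix_differentiable_mult)

lemma matrix_differentiable_sum: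
  "(\<And>a. a \<in> I \<Longrightarrow> matrix_differentiable (F a) x) \<Longrightarrow> matrix_differentiable (\<lambda>w. \<Sum>a\<in>I. F a w) x"
  unfolding matrix_differentiable_def by (auto intro!: field_differentiable_sum_finite)

lemma field_differentiable_trace: "matrix_differentiable F x \<Longrightarrow> (\<lambda>w. trace (F w)) field_differentiable at x"
  unfolding matrix_differentiable_def trace_def by (auto intro!: field_differentiable_sum_finite)

lemma matrix_differentiable_trace_normalized:
  assumes "matrix_differentiable F x" "trace (F x) \<noteq> 0"
  shows "matrix_differentiable (\<lambda>w. trace_normalized (F w)) x"
  unfolding trace_normalized_def
  by (intro matrix_differentiable_scalar field_differentiable_divide field_differentiable_const field_differentiable_trace assms)

lemma continuous_on_trace:
  fixes F :: "'a::topological_space \<Rightarrow> complex^'n^'n"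
  shows "continuous_on S F \<Longrightarrow> continuous_on S (\<lambda>x. trace (F x))"
  unfolding trace_def by (intro continuous_intros)

lemma continuous_on_mat:
  fixes f :: "'a::topological_space \<Rightarrow> complex"
  shows "continuous_on S f \<Longrightarrow> continuous_on S (\<lambda>x. mat (f x) :: complex^'n^'n)"
  unfolding mat_def
proof (intro continuous_on_vec_lambda)
  fix i j :: 'n
  assume "continuous_on S f"
  then show "continuous_on S (\<lambda>x. if i = j then f x else 0)" by (cases "i = j") auto
qed

lemma continuous_on_mpow:
  fixes F :: "'a::topological_space \<Rightarrow> complex^'n^'n"
  shows "continuous_on S F \<Longrightarrow> continuous_on S (\<lambda>x. mpow (F x) n)"
  by (induction n) (auto intro: continuous_on_const continuous_on_matrix_mult)

lemma continuous_on_trace_normalized: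
  fixes F :: "'a::topological_space \<Rightarrow> complex^'n^'n"
  assumes "continuous_on S F" "\<And>x. x \<in> S \<Longrightarrow> trace (F x) \<noteq> 0"
  shows "continuous_on S (\<lambda>x. trace_normalized (F x))"
  unfolding trace_normalized_def
  by (intro continuous_on_matrix_mult continuous_on_mat continuous_on_divide continuous_on_const continuous_on_trace assms)
     (use assms in auto)

lemma subtopology_complex_space:
  assumes "U \<subseteq> topspace (complex_space I)"
  shows "subtopology (complex_space I) U = top_of_set U"
  using assms
  by (simp add: complex_space_def euclidean_product_topology subtopology_subtopology Int_absorb1)

lemma holo_iff:
  "holo I U f \<longleftrightarrow> openin (complex_space I) U \<and> continuous_on U f \<and>
    (\<forall>z\<in>U. \<forall>i\<in>I. (\<lambda>w. f (z(i := w))) field_differentiable at (z i))"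
proof (cases "openin (complex_space I) U")
  case True
  show ?thesis
    unfolding holo_def subtopology_complex_space[OF openin_subset[OF True]] continuous_map_iff_continuous ..
qed (simp add: holo_def)

lemma holo_const: "openin (complex_space I) U \<Longrightarrow> holo I U (\<lambda>_. c)"
  by (simp add: holo_iff)

context chart_setup
begin

lemma matrix_differentiable_twisted_sum:
  assumes "matrix_differentiable F x" "matrix_differentiable G x"
  shows "matrix_differentiable (\<lambda>w. twisted_sum j (F w) (G w)) x"
  unfolding twisted_sum_def
  by (intro matrix_differentiable_sum matrix_differentiable_scalar field_differentiable_const
      matrix_differentiable_mult matrix_differentiable_mpow assms)

lemma continuous_on_twisted_sum:
  fixes F G :: "'a::topological_space \<Rightarrow> complex^'p^'p"
  assumes "continuous_on S F" "continuous_on S G"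
  shows "continuous_on S (\<lambda>x. twisted_sum j (F x) (G x))"
  unfolding twisted_sum_def
  by (intro continuous_on_sum continuous_on_matrix_mult continuous_on_const continuous_on_mpow assms)

lemma \<beta>_fst: "m < n \<Longrightarrow> fst (\<beta> m) \<noteq> k0"
  using bij_betwE[OF \<beta>] by (cases "\<beta> m") force

lemma coords_differentiable:
  assumes F: "\<And>k. matrix_differentiable (\<lambda>w. F w k) x" and x: "F x \<in> nonzero_traces"
  shows "(\<lambda>w. coords (F w) m) field_differentiable at x"
proof (cases "m < n")
  case True
  obtain k j where kj: "\<beta> m = (k, j)" by (cases "\<beta> m")
  then have k: "k \<noteq> k0" using \<beta>_fst[OF True] by simp
  have tr: "matrix_differentiable (\<lambda>w. trace_normalized (F w k')) x" if "k' \<noteq> k0" for k'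
    by (rule matrix_differentiable_trace_normalized[OF F]) (use x that in \<open>simp add: nonzero_traces_def\<close>)
  have "(\<lambda>w. trace (twisted_sum j (F w k0) (trace_normalized (F w k)) **
      mpow (twisted_sum (CARD('p) - 1) (F w k0) (trace_normalized (F w k1))) j)
      / (of_nat CARD('p) * c0 ^ (CARD('p) * (1 + j)))) field_differentiable at x"
    by (intro field_differentiable_divide field_differentiable_const field_differentiable_trace
        matrix_differentiable_mult matrix_differentiable_mpow matrix_differentiable_twisted_sum F tr k k1)
       (use c0_nz p_gt_1 in auto)
  then show ?thesis using True by (simp add: coords_def inv_coord_def kj)
qed (simp add: coords_def)

lemma continuous_coords: "continuous_on nonzero_traces coords"
proof (rule continuous_on_coordinatewise_then_product)
  fix m
  have comp: "continuous_on S (\<lambda>A :: 'l \<Rightarrow> complex^'p^'p. A k)" for S k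
    by (rule continuous_on_subset[OF continuous_on_product_coordinates subset_UNIV])
  show "continuous_on nonzero_traces (\<lambda>A. coords A m)"
  proof (cases "m < n")
    case True
    obtain k j where kj: "\<beta> m = (k, j)" by (cases "\<beta> m")
    then have k: "k \<noteq> k0" using \<beta>_fst[OF True] by simp
    have tr: "continuous_on nonzero_traces (\<lambda>A. trace_normalized (A k'))" if "k' \<noteq> k0" for k'
      by (rule continuous_on_trace_normalized[OF comp]) (use that in \<open>simp add: nonzero_traces_def\<close>)
    have "continuous_on nonzero_traces (\<lambda>A. trace (twisted_sum j (A k0) (trace_normalized (A k)) **
        mpow (twisted_sum (CARD('p) - 1) (A k0) (trace_normalized (A k1))) j)
        / (of_nat CARD('p) * c0 ^ (CARD('p) * (1 + j))))"
      by (intro continuous_on_divide continuous_on_const continuous_on_trace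
          continuous_on_matrix_mult continuous_on_mpow continuous_on_twisted_sum comp tr k k1)
         (use c0_nz p_gt_1 in auto)
    then show ?thesis using True by (simp add: coords_def inv_coord_def kj)
  qed (simp add: coords_def)
qed

lemma open_nonzero_traces: "open nonzero_traces"
proof -
  have "nonzero_traces = (\<Inter>k\<in>{k. k \<noteq> k0}. (\<lambda>A. trace (A k)) -` (- {0}))"
    by (auto simp: nonzero_traces_def)
  moreover have "open ((\<lambda>A :: 'l \<Rightarrow> complex^'p^'p. trace (A k)) -` (- {0}))" for k
    by (rule open_vimage) (auto intro: continuous_on_trace)
  ultimately show ?thesis by (simp only:) (intro open_INT ballI, auto)
qed

lemma coords_in_topspace: "coords A \<in> topspace (complex_space {..<n})"
  by (simp add: topspace_complex_space coords_def)

definition coords_preimage :: "(nat \<Rightarrow> complex) set \<Rightarrow> ('l \<Rightarrow> complex^'p^'p) set" where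
  "coords_preimage U = {A \<in> nonzero_traces. coords A \<in> U}"

lemma open_coords_preimage:
  assumes "openin (complex_space {..<n}) U"
  shows "open (coords_preimage U)"
proof -
  obtain S where S: "open S" "U = S \<inter> {z. \<forall>i. i \<notin> {..<n} \<longrightarrow> z i = 0}"
    using assms by (auto simp: complex_space_def euclidean_product_topology openin_subtopology)
  have "coords_preimage U = nonzero_traces \<inter> coords -` S"
    using coords_in_topspace by (auto simp: coords_preimage_def S(2) topspace_complex_space)
  then show ?thesis using continuous_open_preimage[OF continuous_coords open_nonzero_traces S(1)] by simp
qed

lemma coords_preimage_class:
  assumes "A \<in> coords_preimage U" "A \<in> SL_tuples" "B \<in> SL_tuples" "tuple_class A = tuple_class B"
  shows "B \<in> coords_preimage U" "coords B = coords A"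
  using coords_class[OF assms(2-4)] assms(1) by (auto simp: coords_preimage_def)

definition chart_map :: "('l \<Rightarrow> (complex^'p^'p) set) set \<Rightarrow> nat \<Rightarrow> complex" where
  "chart_map x = coords (SOME A. A \<in> bad_tuples \<inter> nonzero_traces \<and> tuple_class A = x)"

lemma chart_map_class:
  assumes "A \<in> bad_tuples" "A \<in> nonzero_traces"
  shows "chart_map (tuple_class A) = coords A"
proof -
  define B where "B = (SOME B. B \<in> bad_tuples \<inter> nonzero_traces \<and> tuple_class B = tuple_class A)"
  have B: "B \<in> bad_tuples \<inter> nonzero_traces \<and> tuple_class B = tuple_class A"
    unfolding B_def by (rule someI[of _ A]) (use assms in simp)
  then have "coords B = coords A"
    using coords_class(2)[of B A] assms(1) by (simp add: bad_tuples_def)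
  then show ?thesis by (simp add: chart_map_def B_def)
qed

definition chart_domain :: "(nat \<Rightarrow> complex) set \<Rightarrow> ('l \<Rightarrow> (complex^'p^'p) set) set set" where
  "chart_domain U = tuple_class ` (coords_preimage U \<inter> bad_tuples)"

lemma chart_domain_subset: "U' \<subseteq> U \<Longrightarrow> {x \<in> chart_domain U. chart_map x \<in> U'} = chart_domain U'"
proof (intro equalityI subsetI)
  fix x assume "x \<in> {x \<in> chart_domain U. chart_map x \<in> U'}"
  then obtain A where A: "A \<in> nonzero_traces" "A \<in> bad_tuples" "x = tuple_class A" "chart_map x \<in> U'"
    by (auto simp: chart_domain_def coords_preimage_def)
  then have "coords A \<in> U'" using chart_map_class by simp
  then show "x \<in> chart_domain U'" using A by (auto simp: chart_domain_def coords_preimage_def)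
next
  fix x assume "x \<in> chart_domain U'" and U: "U' \<subseteq> U"
  then obtain A where A: "A \<in> nonzero_traces" "A \<in> bad_tuples" "x = tuple_class A" "coords A \<in> U'"
    by (auto simp: chart_domain_def coords_preimage_def)
  then show "x \<in> {x \<in> chart_domain U. chart_map x \<in> U'}"
    using U by (auto simp: chart_domain_def coords_preimage_def chart_map_class)
qed

text \<open>
  Any holomorphic function of the coordinates extends to an invariant holomorphic function on all tuples
  with these non-zero traces, because the coordinates themselves do. For a constant function this gives the openness
  of the domain.
\<close>

lemma chart_domain_sheaf:
  assumes U: "openin (complex_space {..<n}) U" and f: "holo {..<n} U f"
  shows "openin sing_locus (chart_domain U)" "sing_locus_sheaf (chart_domain U) (f \<circ> chart_map)"
proof -
  have ms: "matrix_sheaf (coords_preimage U) (f \<circ> coords)"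
    unfolding matrix_sheaf_iff holo_iff
  proof (intro conjI ballI)
    show "openin (complex_space UNIV) {z. matrix_tuple z \<in> coords_preimage U}"
      using open_vimage[OF open_coords_preimage[OF U] continuous_matrix_tuple]
      by (simp add: complex_space_UNIV vimage_def)
    have "continuous_on {z. matrix_tuple z \<in> coords_preimage U} (\<lambda>z. coords (matrix_tuple z))"
      by (rule continuous_on_compose2[OF continuous_coords continuous_on_subset[OF continuous_matrix_tuple subset_UNIV]])
         (auto simp: coords_preimage_def)
    then show "continuous_on {z. matrix_tuple z \<in> coords_preimage U} (\<lambda>z. (f \<circ> coords) (matrix_tuple z))"
      unfolding o_def
      by (rule continuous_on_compose2[rotated, where g = f and t = U]) (use f in \<open>auto simp: holo_iff coords_preimage_def\<close>)
    fix z :: "'l \<times> 'p \<times> 'p \<Rightarrow> complex" and i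
    assume z: "z \<in> {z. matrix_tuple z \<in> coords_preimage U}"
    have mt: "matrix_tuple (z(i := z i)) = matrix_tuple z" by simp
    have "(\<lambda>w. f (coords (matrix_tuple (z(i := w))))) field_differentiable at (z i)"
    proof (rule holo_chain_field[OF finite_lessThan f, where F = "\<lambda>w. coords (matrix_tuple (z(i := w)))"])
      show "coords (matrix_tuple (z(i := z i))) \<in> U" using z unfolding mt by (simp add: coords_preimage_def)
      show "coords (matrix_tuple (z(i := y))) m = 0" if "m \<notin> {..<n}" for y m using that by (simp add: coords_def)
      show "(\<lambda>w. coords (matrix_tuple (z(i := w))) m) field_differentiable at (z i)" for m
      proof (rule coords_differentiable)
        show "matrix_differentiable (\<lambda>w. matrix_tuple (z(i := w)) k) (z i)" for k
          unfolding matrix_differentiable_def matrix_tuple_def vec_lambda_beta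
          by (intro allI field_differentiable_fun_upd)
        show "matrix_tuple (z(i := z i)) \<in> nonzero_traces" using z unfolding mt by (simp add: coords_preimage_def)
      qed
    qed
    then show "(\<lambda>w. (f \<circ> coords) (matrix_tuple (z(i := w)))) field_differentiable at (z i)" by (simp add: o_def)
  qed
  have inv: "B \<in> coords_preimage U \<and> (f \<circ> coords) B = (f \<circ> coords) A"
    if "A \<in> coords_preimage U" "A \<in> SL_tuples" "B \<in> SL_tuples" "tuple_class A = tuple_class B" for A B
    using coords_preimage_class[OF that] by simp
  have g: "(f \<circ> chart_map) (tuple_class A) = (f \<circ> coords) A" if "A \<in> coords_preimage U" "A \<in> bad_tuples" for A
    using that by (simp add: chart_map_class coords_preimage_def)
  show "openin sing_locus (chart_domain U)" "sing_locus_sheaf (chart_domain U) (f \<circ> chart_map)"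
    unfolding chart_domain_def
    using sing_locus_sheafI[where g = "f \<circ> chart_map", OF open_coords_preimage[OF U] ms inv g] by blast+
qed

lemma continuous_section_diag:
  "continuous_on {z. entry z (k1, CARD('p) - 1) \<notin> \<real>\<^sub>\<le>\<^sub>0} (\<lambda>z. section_diag z k i)"
proof -
  have e: "continuous_on S (\<lambda>z. entry z kj)" for S kj
    unfolding entry_def by (rule continuous_on_subset[OF continuous_on_product_coordinates subset_UNIV])
  have r: "continuous_on {z. entry z (k1, CARD('p) - 1) \<notin> \<real>\<^sub>\<le>\<^sub>0} root"
    unfolding root_def by (intro continuous_on_exp continuous_on_divide continuous_on_Ln' e continuous_on_const) auto
  have "continuous_on {z. entry z (k1, CARD('p) - 1) \<notin> \<real>\<^sub>\<le>\<^sub>0} (\<lambda>z. section_dft z k j)" for j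
  proof (cases "j = 0")
    case False
    have "continuous_on {z. entry z (k1, CARD('p) - 1) \<notin> \<real>\<^sub>\<le>\<^sub>0} (\<lambda>z. entry z (k, j) / root z ^ j)"
      by (intro continuous_on_divide continuous_on_power e r) (simp add: root_def)
    then show ?thesis using False by (simp add: section_dft_def)
  qed (simp add: section_dft_def)
  then show ?thesis
    unfolding section_diag_def idft_def
    by (intro continuous_on_divide continuous_on_sum continuous_on_mult continuous_on_const) auto
qed

lemma openin_chart_image: "openin (complex_space {..<n}) chart_image"
proof -
  let ?E = "{z. entry z (k1, CARD('p) - 1) \<notin> \<real>\<^sub>\<le>\<^sub>0}"
  have "continuous_on UNIV (\<lambda>z. entry z (k1, CARD('p) - 1))"
    unfolding entry_def by (rule continuous_on_product_coordinates)
  then have "open ((\<lambda>z. entry z (k1, CARD('p) - 1)) -` (- \<real>\<^sub>\<le>\<^sub>0))"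
    by (intro open_vimage) (auto intro: closed_nonpos_Reals_complex)
  then have E: "open ?E" by (simp add: vimage_def)
  have "open (?E \<inter> (\<lambda>z. section_diag z k i) -` {w. Re w > 0})" for k i
    by (rule continuous_open_preimage[OF continuous_section_diag E open_halfspace_Re_gt])
  then have "open (?E \<inter> (\<Inter>(k, i)\<in>{k. k \<noteq> k0} \<times> UNIV. ?E \<inter> (\<lambda>z. section_diag z k i) -` {w. Re w > 0}))"
    by (intro open_Int E open_INT ballI) auto
  moreover have "chart_image = (?E \<inter> (\<Inter>(k, i)\<in>{k. k \<noteq> k0} \<times> UNIV. ?E \<inter> (\<lambda>z. section_diag z k i) -` {w. Re w > 0}))
      \<inter> {z. \<forall>i. i \<notin> {..<n} \<longrightarrow> z i = 0}"
    by (auto simp: chart_image_def)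
  ultimately show ?thesis
    unfolding complex_space_def euclidean_product_topology openin_subtopology by (auto intro!: exI)
qed

lemma flat_chart_section:
  "flat_tuple (chart_section z) (k, a, b) = (if k = k0 then cyc 1 $ a $ b else
    exp (Ln (section_diag z k a) - (\<Sum>i\<in>UNIV. Ln (section_diag z k i)) / of_nat CARD('p)) * cyc 0 $ a $ b)"
  by (simp add: flat_tuple_def chart_section_def param_def monomial_def normalized_exp_def diag_const)

lemma continuous_flat_chart_section: "continuous_on chart_image (\<lambda>z. flat_tuple (chart_section z))"
proof (rule continuous_on_coordinatewise_then_product)
  fix m :: "'l \<times> 'p \<times> 'p"
  obtain k a b where m: "m = (k, a, b)" by (cases m)
  have "continuous_on chart_image (\<lambda>z. section_diag z k i)" for i
    by (rule continuous_on_subset[OF continuous_section_diag]) (auto simp: chart_image_def)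
  then have L: "continuous_on chart_image (\<lambda>z. Ln (section_diag z k i))" if "k \<noteq> k0" for i
    using that by (intro continuous_on_Ln' chart_imageD(3))
  show "continuous_on chart_image (\<lambda>z. flat_tuple (chart_section z) m)"
  proof (cases "k = k0")
    case True
    then show ?thesis unfolding m flat_chart_section by (simp add: continuous_on_const)
  next
    case False
    have "continuous_on chart_image (\<lambda>z. exp (Ln (section_diag z k a) - (\<Sum>i\<in>UNIV. Ln (section_diag z k i)) / of_nat CARD('p)) * cyc 0 $ a $ b)"
      by (intro continuous_on_mult continuous_on_exp continuous_on_diff continuous_on_divide continuous_on_sum
          continuous_on_const L False) auto
    then show ?thesis unfolding m flat_chart_section using False by simp
  qed
qed

lemma flat_chart_section_differentiable:
  assumes z: "z \<in> chart_image"
  shows "(\<lambda>w. flat_tuple (chart_section (z(m := w))) kab) field_differentiable at (z m)"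
proof -
  obtain k a b where kab: "kab = (k, a, b)" by (cases kab)
  have e: "(\<lambda>w. entry (z(m := w)) kj) field_differentiable at (z m)" for kj
    unfolding entry_def by (rule field_differentiable_fun_upd)
  have zz: "z(m := z m) = z" by simp
  have r: "(\<lambda>w. root (z(m := w))) field_differentiable at (z m)"
    unfolding root_def
    by (intro field_differentiable_exp_comp field_differentiable_divide field_differentiable_Ln_comp e field_differentiable_const)
       (use chart_imageD(5)[OF z] p_gt_1 zz in auto)
  have r0: "root (z(m := z m)) \<noteq> 0" by (simp add: root_def)
  have "(\<lambda>w. section_dft (z(m := w)) k j) field_differentiable at (z m)" for j
  proof (cases "j = 0")
    case False
    have "(\<lambda>w. entry (z(m := w)) (k, j) / root (z(m := w)) ^ j) field_differentiable at (z m)"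
      by (intro field_differentiable_divide field_differentiable_power e r) (use r0 in simp)
    then show ?thesis using False by (simp add: section_dft_def)
  qed (simp add: section_dft_def)
  then have s: "(\<lambda>w. section_diag (z(m := w)) k i) field_differentiable at (z m)" for i
    unfolding section_diag_def idft_def
    by (intro field_differentiable_divide field_differentiable_sum_finite field_differentiable_mult field_differentiable_const) (use p_gt_1 in auto)
  have L: "(\<lambda>w. Ln (section_diag (z(m := w)) k i)) field_differentiable at (z m)" if "k \<noteq> k0" for i
    by (rule field_differentiable_Ln_comp[OF s]) (use chart_imageD(3)[OF z that] zz in simp)
  show ?thesis
  proof (cases "k = k0")
    case True
    then show ?thesis unfolding kab flat_chart_section by simp
  next
    case False
    have "(\<lambda>w. exp (Ln (section_diag (z(m := w)) k a) - (\<Sum>i\<in>UNIV. Ln (section_diag (z(m := w)) k i)) / of_nat CARD('p)) * cyc 0 $ a $ b)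
        field_differentiable at (z m)"
      by (intro field_differentiable_mult field_differentiable_exp_comp field_differentiable_diff field_differentiable_divide
          field_differentiable_sum_finite field_differentiable_const L False) (use p_gt_1 in auto)
    then show ?thesis unfolding kab flat_chart_section using False by simp
  qed
qed

lemma continuous_chart_section: "continuous_on chart_image chart_section"
proof -
  have "continuous_on chart_image (\<lambda>z. matrix_tuple (flat_tuple (chart_section z)))"
    by (rule continuous_on_compose2[OF continuous_matrix_tuple continuous_flat_chart_section]) auto
  then show ?thesis by simp
qed

lemma chart_section_in_domain:
  assumes "z \<in> U" "U \<subseteq> chart_image"
  shows "tuple_class (chart_section z) \<in> chart_domain U" "chart_map (tuple_class (chart_section z)) = z"
proof -
  have z: "z \<in> chart_image" using assms by blast
  note b = chart_section_bad[OF z] and c = coords_chart_section[OF z]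
  show "tuple_class (chart_section z) \<in> chart_domain U"
    using b c assms(1) by (auto simp: chart_domain_def coords_preimage_def)
  show "chart_map (tuple_class (chart_section z)) = z"
    using chart_map_class[OF b] c by simp
qed

lemma homeomorphic_chart_map:
  "homeomorphic_map (subtopology sing_locus (chart_domain chart_image))
    (subtopology (complex_space {..<n}) chart_image) chart_map"
proof (rule homeomorphic_maps_imp_map)
  let ?V = "chart_domain chart_image" and ?\<Psi> = "\<lambda>z. tuple_class (chart_section z)"
  have Vop: "openin sing_locus ?V"
    by (rule chart_domain_sheaf(1)[OF openin_chart_image holo_const[OF openin_chart_image]])
  have tV: "topspace (subtopology sing_locus ?V) = ?V" using openin_subset[OF Vop] by auto
  have tU: "topspace (subtopology (complex_space {..<n}) chart_image) = chart_image"
    using openin_subset[OF openin_chart_image] by auto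
  have VU: "chart_map x \<in> chart_image" if "x \<in> ?V" for x
    using that by (auto simp: chart_domain_def coords_preimage_def chart_map_class)
  show "homeomorphic_maps (subtopology sing_locus ?V) (subtopology (complex_space {..<n}) chart_image) chart_map ?\<Psi>"
    unfolding homeomorphic_maps_def tV tU
  proof (intro conjI ballI)
    show "continuous_map (subtopology sing_locus ?V) (subtopology (complex_space {..<n}) chart_image) chart_map"
      unfolding continuous_map_def tV tU
    proof (intro conjI allI impI)
      show "chart_map \<in> ?V \<rightarrow> chart_image" using VU by blast
      fix U' assume "openin (subtopology (complex_space {..<n}) chart_image) U'"
      then have U': "openin (complex_space {..<n}) U'" "U' \<subseteq> chart_image"
        using openin_open_subtopology[OF openin_chart_image] by blast+
      have "openin sing_locus (chart_domain U')" by (rule chart_domain_sheaf(1)[OF U'(1) holo_const[OF U'(1)]])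
      then show "openin (subtopology sing_locus ?V) {x \<in> ?V. chart_map x \<in> U'}"
        unfolding chart_domain_subset[OF U'(2)] openin_open_subtopology[OF Vop]
        using chart_domain_subset[OF U'(2)] by blast
    qed
    have "continuous_map (top_of_set chart_image) sing_locus ?\<Psi>"
    proof (rule continuous_map_sing_locus)
      show "continuous_map (top_of_set chart_image) (top_of_set SL_tuples) chart_section"
        using continuous_chart_section chart_section_bad(1) by (auto simp: continuous_map_in_subtopology bad_tuples_def)
    qed (use chart_section_bad(1) in simp)
    then show "continuous_map (subtopology (complex_space {..<n}) chart_image) (subtopology sing_locus ?V) ?\<Psi>"
      unfolding subtopology_complex_space[OF openin_subset[OF openin_chart_image]] continuous_map_in_subtopology
      using chart_section_in_domain(1)[of _ chart_image] by auto
    show "?\<Psi> (chart_map x) = x" if x: "x \<in> ?V" for x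
    proof -
      obtain A where A: "A \<in> bad_tuples" "A \<in> nonzero_traces" "coords A \<in> chart_image" "x = tuple_class A"
        using x by (auto simp: chart_domain_def coords_preimage_def)
      then show ?thesis using class_chart_section_coords[OF A(1-3)] chart_map_class[OF A(1,2)] by simp
    qed
    show "chart_map (?\<Psi> z) = z" if "z \<in> chart_image" for z
      by (rule chart_section_in_domain(2)[OF that order_refl])
  qed
qed

text \<open>
  Composition with the holomorphic section of the chart expresses \<open>f\<close> locally by a holomorphic function
  of the matrix entries.
\<close>

lemma chart_map_reflects_holo:
  assumes U: "openin (complex_space {..<n}) U" "U \<subseteq> chart_image"
    and sh: "sing_locus_sheaf (chart_domain U) (f \<circ> chart_map)"
  shows "holo {..<n} U f"
proof -
  have local: "\<exists>U1 k. holo UNIV U1 k \<and> flat_tuple (chart_section z) \<in> U1 \<and>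
      (\<forall>y\<in>U. flat_tuple (chart_section y) \<in> U1 \<longrightarrow> f y = k (flat_tuple (chart_section y)))" if z: "z \<in> U" for z
  proof (rule sing_locus_sheafD[OF sh])
    show "chart_section z \<in> bad_tuples" using chart_section_bad(1) z U(2) by blast
    show "tuple_class (chart_section z) \<in> chart_domain U" by (rule chart_section_in_domain(1)[OF z U(2)])
    fix U1 k assume k: "holo UNIV U1 k" "flat_tuple (chart_section z) \<in> U1"
      and eq: "\<And>B. B \<in> bad_tuples \<Longrightarrow> tuple_class B \<in> chart_domain U \<Longrightarrow> flat_tuple B \<in> U1 \<Longrightarrow>
        (f \<circ> chart_map) (tuple_class B) = k (flat_tuple B)"
    have "f y = k (flat_tuple (chart_section y))" if "y \<in> U" "flat_tuple (chart_section y) \<in> U1" for y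
      using eq[OF _ chart_section_in_domain(1)[OF that(1) U(2)] that(2)] chart_section_bad(1) that(1) U(2)
        chart_section_in_domain(2)[OF that(1) U(2)] by auto
    then show ?thesis using k by blast
  qed
  show ?thesis
    unfolding holo_iff
  proof (intro conjI ballI U(1))
    show "continuous_on U f"
      unfolding continuous_on_def
    proof
      fix z assume z: "z \<in> U"
      obtain U1 k where k: "holo UNIV U1 k" "flat_tuple (chart_section z) \<in> U1"
        and eq: "\<And>y. y \<in> U \<Longrightarrow> flat_tuple (chart_section y) \<in> U1 \<Longrightarrow> f y = k (flat_tuple (chart_section y))"
        using local[OF z] by blast
      have U1: "open U1" "continuous_on U1 k" using k(1) by (auto simp: holo_iff complex_space_UNIV)
      have fl: "((\<lambda>y. flat_tuple (chart_section y)) \<longlongrightarrow> flat_tuple (chart_section z)) (at z within U)"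
        using continuous_on_subset[OF continuous_flat_chart_section U(2)] z by (auto simp: continuous_on_def)
      have "isCont k (flat_tuple (chart_section z))"
        using U1 k(2) by (simp add: continuous_on_eq_continuous_at)
      then have "((\<lambda>y. k (flat_tuple (chart_section y))) \<longlongrightarrow> k (flat_tuple (chart_section z))) (at z within U)"
        by (rule isCont_tendsto_compose[OF _ fl])
      moreover have "eventually (\<lambda>y. k (flat_tuple (chart_section y)) = f y) (at z within U)"
      proof -
        have "eventually (\<lambda>y. flat_tuple (chart_section y) \<in> U1) (at z within U)"
          by (rule topological_tendstoD[OF fl U1(1) k(2)])
        moreover have "eventually (\<lambda>y. y \<in> U) (at z within U)" by (simp add: eventually_at_filter)
        ultimately show ?thesis by (rule eventually_elim2) (simp add: eq)
      qed
      ultimately have "(f \<longlongrightarrow> k (flat_tuple (chart_section z))) (at z within U)" by (rule Lim_transform_eventually)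
      then show "(f \<longlongrightarrow> f z) (at z within U)" using eq[OF z k(2)] by simp
    qed
  next
    fix z i assume z: "z \<in> U" and i: "i \<in> {..<n}"
    obtain U1 k where k: "holo UNIV U1 k" "flat_tuple (chart_section z) \<in> U1"
      and eq: "\<And>y. y \<in> U \<Longrightarrow> flat_tuple (chart_section y) \<in> U1 \<Longrightarrow> f y = k (flat_tuple (chart_section y))"
      using local[OF z] by blast
    have zc: "z \<in> chart_image" using z U(2) by blast
    have zz: "z(i := z i) = z" by simp
    have d: "(\<lambda>w. k (flat_tuple (chart_section (z(i := w))))) field_differentiable at (z i)"
      by (rule holo_chain_field[OF finite k(1), where F = "\<lambda>w. flat_tuple (chart_section (z(i := w)))"])
         (use k(2) flat_chart_section_differentiable[OF zc] in auto)
    obtain r where r: "r > 0" "polydisc {..<n} z r \<subseteq> U"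
      using U(1) z openin_complex_space_iff[of "{..<n}" U] by auto
    have inU: "z(i := w) \<in> U" if "dist w (z i) < r" for w
    proof -
      have "z(i := w) \<in> polydisc {..<n} z r"
        using that i r(1) chart_imageD(4)[OF zc] by (auto simp: polydisc_def dist_norm)
      then show ?thesis using r(2) by blast
    qed
    let ?G = "\<lambda>w. flat_tuple (chart_section (z(i := w)))"
    have "continuous_on (ball (z i) r) (\<lambda>w. z(i := w))"
    proof (rule continuous_on_coordinatewise_then_product)
      show "continuous_on (ball (z i) r) (\<lambda>w. (z(i := w)) m)" for m by (cases "m = i") auto
    qed
    then have "continuous_on (ball (z i) r) ?G"
      by (rule continuous_on_compose2[OF continuous_flat_chart_section]) (use inU U(2) in \<open>auto simp: dist_commute\<close>)
    moreover have "open U1" using k(1) by (simp add: holo_iff complex_space_UNIV)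
    ultimately have "open (ball (z i) r \<inter> ?G -` U1)"
      by (intro continuous_open_preimage open_ball)
    moreover have "z i \<in> ball (z i) r \<inter> ?G -` U1" using r(1) k(2) by simp
    ultimately obtain \<delta> where \<delta>: "\<delta> > 0" "ball (z i) \<delta> \<subseteq> ball (z i) r \<inter> ?G -` U1"
      by (meson open_contains_ball)
    show "(\<lambda>w. f (z(i := w))) field_differentiable at (z i)"
    proof (rule field_differentiable_transform_within[OF \<delta>(1) UNIV_I _ d])
      fix w assume "dist w (z i) < \<delta>"
      then have "w \<in> ball (z i) r \<inter> ?G -` U1" using \<delta>(2) by (auto simp: dist_commute)
      then show "k (?G w) = f (z(i := w))" using eq[OF inU] by (simp add: dist_commute)
    qed
  qed
qed

lemma complex_chart_chart_map:
  "complex_chart sing_locus sing_locus_sheaf n (chart_domain chart_image) chart_image chart_map"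
  unfolding complex_chart_def
proof (intro conjI allI impI homeomorphic_chart_map openin_chart_image)
  show "openin sing_locus (chart_domain chart_image)"
    by (rule chart_domain_sheaf(1)[OF openin_chart_image holo_const[OF openin_chart_image]])
  fix U f assume "openin (complex_space {..<n}) U \<and> U \<subseteq> chart_image"
  then have U: "openin (complex_space {..<n}) U" "U \<subseteq> chart_image" by auto
  show "holo {..<n} U f \<longleftrightarrow> sing_locus_sheaf {x \<in> chart_domain chart_image. chart_map x \<in> U} (f \<circ> chart_map)"
    unfolding chart_domain_subset[OF U(2)]
    using chart_domain_sheaf(2)[OF U(1)] chart_map_reflects_holo[OF U] by blast
qed

text \<open>
  All coordinates are 0 except the one at \<open>(k1, p - 1)\<close>, which is \<open>exp (- p)\<close> with root \<open>exp (- 1)\<close>. The diagonal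
  entries are then \<open>1 / p\<close> times 1 or \<open>1 + \<zeta>^m exp (- 1)\<close>, and these have positive real part.
\<close>

lemma chart_image_nonempty: "chart_image \<noteq> {}"
proof -
  define \<epsilon> :: complex where "\<epsilon> = exp (- of_nat CARD('p))"
  define z :: "nat \<Rightarrow> complex" where "z m = (if m < n \<and> \<beta> m = (k1, CARD('p) - 1) then \<epsilon> else 0)" for m
  have entry: "entry z (k, j) = (if (k, j) = (k1, CARD('p) - 1) then \<epsilon> else 0)" if "k \<noteq> k0" "0 < j" "j < CARD('p)" for k j
    using inv_into_into[OF index_in[OF that]] f_inv_into_f[OF index_in[OF that]] by (simp add: entry_def z_def)
  have p1: "0 < CARD('p) - 1" "CARD('p) - 1 < CARD('p)" using p_gt_1 by auto
  have top: "entry z (k1, CARD('p) - 1) = \<epsilon>" using entry[OF k1 p1] by simp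
  have "Ln \<epsilon> = - of_nat CARD('p)" unfolding \<epsilon>_def by (rule Ln_exp) auto
  then have root: "root z = exp (- 1)" unfolding root_def top using p_gt_1 by simp
  have \<epsilon>: "\<epsilon> \<notin> \<real>\<^sub>\<le>\<^sub>0"
    by (auto simp: \<epsilon>_def complex_nonpos_Reals_iff Re_exp)
  have quot: "\<epsilon> / root z ^ (CARD('p) - 1) = exp (- 1)"
  proof -
    have "root z ^ (CARD('p) - 1) * exp (- 1) = exp (- 1) ^ CARD('p)"
      unfolding root using p_gt_1 by (simp add: power_eq_if)
    also have "\<dots> = \<epsilon>" by (simp add: \<epsilon>_def exp_of_nat_mult[symmetric])
    finally show ?thesis using root by (simp add: nonzero_divide_eq_eq mult.commute)
  qed
  have "Re (section_diag z k i) > 0" if k: "k \<noteq> k0" for k i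
  proof -
    have terms: "\<zeta> ^ (j * ix i) * section_dft z k j =
        (if j = 0 then 1 else 0) + (if j = CARD('p) - 1 then (if k = k1 then \<zeta> ^ (j * ix i) * exp (- 1) else 0) else 0)"
      if j: "j < CARD('p)" for j
    proof (cases "j = 0")
      case True
      then show ?thesis using p1(1) by (simp add: section_dft_def)
    next
      case False
      then have e: "entry z (k, j) = (if (k, j) = (k1, CARD('p) - 1) then \<epsilon> else 0)" using entry k j by simp
      show ?thesis
      proof (cases "k = k1 \<and> j = CARD('p) - 1")
        case True
        then show ?thesis using False e quot by (simp add: section_dft_def)
      next
        case F: False
        then have "entry z (k, j) = 0" using e by auto
        then show ?thesis using False F by (auto simp: section_dft_def)
      qed
    qed
    have "(\<Sum>j<CARD('p). \<zeta> ^ (j * ix i) * section_dft z k j) =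
        1 + (if k = k1 then \<zeta> ^ ((CARD('p) - 1) * ix i) * exp (- 1) else 0)" (is "?S = 1 + ?w")
    proof -
      have "?S = (\<Sum>j<CARD('p). (if j = 0 then 1 else 0) + (if j = CARD('p) - 1 then (if k = k1 then \<zeta> ^ (j * ix i) * exp (- 1) else 0) else 0))"
        by (rule sum.cong) (use terms in auto)
      then show ?thesis using p1 p_gt_1 by (simp add: sum.distrib sum.delta)
    qed
    moreover have "norm ?w < 1"
      by (simp add: norm_mult norm_power \<zeta>_def)
    then have "Re (1 + ?w) > 0" using abs_Re_le_cmod[of ?w] by (simp only: plus_complex.sel one_complex.sel)
    ultimately show ?thesis using p_gt_1 by (simp add: section_diag_def idft_def)
  qed
  moreover have "z m = 0" if "m \<notin> {..<n}" for m using that by (simp add: z_def)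
  ultimately have "z \<in> chart_image" using \<epsilon> unfolding chart_image_def mem_Collect_eq top by blast
  then show ?thesis by blast
qed

lemma chart_domain_nonempty: "chart_domain chart_image \<noteq> {}"
  using chart_image_nonempty chart_section_in_domain(1)[of _ chart_image] by blast

end

theorem corollary3:
  fixes p l :: nat
  assumes "l \<ge> 2" and "prime p" and "CARD('l::finite) = l" and "CARD('p::finite) = p"
  shows "connected_space (sing_locus :: ('l \<Rightarrow> (complex^'p^'p) set) set topology) \<and>
    has_complex_dim (sing_locus :: ('l \<Rightarrow> (complex^'p^'p) set) set topology)
      sing_locus_sheaf ((p - 1) * (l - 1))"
proof -
  obtain ix :: "'p \<Rightarrow> nat" where "bij_betw ix UNIV {0..<CARD('p)}"
    using ex_bij_betw_finite_nat[of "UNIV :: 'p set"] by auto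
  then interpret cyclic_index ix
    using assms(2,4) by unfold_locales (simp_all add: atLeast0LessThan)
  obtain k0 k1 :: 'l where k1: "k1 \<noteq> k0"
    using assms(1,3) card_le_Suc0_iff_eq[of "UNIV :: 'l set"] by (auto simp: numeral_2_eq_2 not_less_eq_eq[symmetric])
  define J where "J = {(k :: 'l, j). k \<noteq> k0 \<and> 0 < j \<and> j < CARD('p)}"
  have J: "J = (UNIV - {k0}) \<times> {0<..<CARD('p)}" by (auto simp: J_def)
  then have "card J = (p - 1) * (l - 1)"
    using assms(3,4) by (simp add: card_cartesian_product card_Diff_singleton mult.commute)
  moreover have "finite J" by (simp add: J)
  ultimately obtain \<beta> where \<beta>: "bij_betw \<beta> {..<(p - 1) * (l - 1)} J"
    by (metis card_lessThan finite_lessThan finite_same_card_bij)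
  interpret chart_setup ix k0 k1 "(p - 1) * (l - 1)" \<beta>
    using k1 \<beta> by unfold_locales (simp_all add: J_def)
  have "connected_space (sing_locus :: ('l \<Rightarrow> (complex^'p^'p) set) set topology)"
    by (rule connected_space_sing_locus) (use assms in simp)
  moreover have "has_complex_dim (sing_locus :: ('l \<Rightarrow> (complex^'p^'p) set) set topology)
      sing_locus_sheaf ((p - 1) * (l - 1))"
    unfolding has_complex_dim_def
  proof (intro conjI allI impI)
    show "\<exists>V U \<phi>. V \<noteq> {} \<and> complex_chart (sing_locus :: ('l \<Rightarrow> (complex^'p^'p) set) set topology)
        sing_locus_sheaf ((p - 1) * (l - 1)) V U \<phi>"
      using chart_domain_nonempty complex_chart_chart_map by blast
    fix d V U \<phi>
    assume "V \<noteq> {} \<and> complex_chart (sing_locus :: ('l \<Rightarrow> (complex^'p^'p) set) set topology) sing_locus_sheaf d V U \<phi>"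
    then show "d \<le> (p - 1) * (l - 1)" using chart_dim_le assms(3,4) by blast
  qed
  ultimately show ?thesis by blast
qed

end
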